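(* Let $(M,\tau)$ be a tracial von Neumann algebra and let $y_1,\dots,y_n\in M$ be self-adjoint elements satisfying $\max_j\|y_j\|<R$ and $\delta^*(y_1,\dots,y_n)=n$. Assume that for some $P\in\mathcal{A}[X_1,\dots,X_n;R]$ one has $P(y_1,\dots,y_n)=0$. Then $P=0$.
   Context: A tracial von Neumann algebra $(M,\tau)$ is a von Neumann algebra $M$ with a faithful normal tracial state $\tau$. $\mathbb{C}[X_1,\dots,X_n]$ denotes the algebra of polynomials in $n$ non-commuting indeterminates. For $R'>0$, $\mathbb{C}\langle X_1,\dots,X_n;R'\rangle$ is the completion of $\mathbb{C}[X_1,\dots,X_n]$ in the norm $$\Big\|\sum_N\sum_{j_1,\dots,j_N=1}^n\alpha_{N;j_1,\dots,j_N}X_{j_1}\cdots X_{j_N}\Big\|_{R'}=\sum_N\sum_{j_1,\dots,j_N=1}^n|\alpha_{N;j_1,\dots,j_N}|(R')^N,$$ i.e. the algebra of non-commutative power series for which this sum is finite, and $\mathcal{A}[X_1,\dots,X_n;R]=\bigcup_{R'>R}\mathbb{C}\langle X_1,\dots,X_n;R'\rangle$. If $\max_j\|y_j\|<R$, $P(y_1,\dots,y_n)\in M$ denotes the (norm-convergent) evaluation of $P\in\mathcal{A}[X_1,\dots,X_n;R]$ at $X_j=y_j$. Voiculescu's non-microstates free entropy dimension $\delta^*$ is defined as follows. Let $\partial_j:\mathbb{C}[X_1,\dots,X_n]\to\mathbb{C}[X_1,\dots,X_n]\otimes\mathbb{C}[X_1,\dots,X_n]$ be the derivation with $\partial_jX_i=\delta_{i=j}1\otimes1$.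 For self-adjoint $x_1,\dots,x_n$ in a tracial von Neumann algebra, a conjugate variable is an element $\xi_j\in L^2(W^*(x_1,\dots,x_n),\tau)$ such that $\tau(\xi_jP(x_1,\dots,x_n))=(\tau\otimes\tau)((\partial_jP)(x_1,\dots,x_n))$ for all $P\in\mathbb{C}[X_1,\dots,X_n]$. Put $\Phi^*(x_1,\dots,x_n)=\sum_j\|\xi_j\|_2^2$ if all conjugate variables $\xi_1,\dots,\xi_n$ exist, and $\Phi^*(x_1,\dots,x_n)=+\infty$ otherwise. Let $S_1,\dots,S_n$ be a free family of standard (mean $0$, variance $1$) semicircular elements free from $\{x_1,\dots,x_n\}$ (in a possibly larger tracial von Neumann algebra). Put $$\chi^*(x_1,\dots,x_n)=\frac12\int_0^\infty\Big(\frac{n}{1+t}-\Phi^*(x_1+\sqrt t S_1,\dots,x_n+\sqrt t S_n)\Big)dt+\frac n2\log(2\pi e)$$ and $$\delta^*(x_1,\dots,x_n)=n-\liminf_{\epsilon\to0^+}\frac{\chi^*(x_1+\sqrt\epsilon S_1,\dots,x_n+\sqrt\epsilon S_n)}{\log\sqrt\epsilon}.$$ *)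

theory Defs
  imports "HOL-Analysis.Analysis"
begin

section \<open>Complex Hilbert spaces and bounded complex-linear operators\<close>

text \<open>
  The norm and the metric come from the underlying real Hilbert space, whose inner product is the
  real part of the complex one; \<open>cinner\<close> is linear in its second argument.
\<close>

class chilbert_space = real_inner + complete_space +
  fixes scaleC :: "complex \<Rightarrow> 'a \<Rightarrow> 'a"  (infixr \<open>*\<^sub>C\<close> 75)
    and cinner :: "'a \<Rightarrow> 'a \<Rightarrow> complex"
  assumes scaleC_add_right: "c *\<^sub>C (v + w) = c *\<^sub>C v + c *\<^sub>C w"
    and scaleC_add_left: "(c + d) *\<^sub>C v = c *\<^sub>C v + d *\<^sub>C v"
    and scaleC_scaleC: "c *\<^sub>C d *\<^sub>C v = (c * d) *\<^sub>C v"
    and scaleC_of_real: "complex_of_real r *\<^sub>C v = r *\<^sub>R v"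
    and cinner_commute: "cinner v w = cnj (cinner w v)"
    and cinner_add_right: "cinner v (w + w') = cinner v w + cinner v w'"
    and cinner_scaleC_right: "cinner v (c *\<^sub>C w) = c * cinner v w"
    and Re_cinner: "Re (cinner v w) = inner v w"
begin

lemma cinner_self: "cinner v v = complex_of_real (inner v v)"
proof (rule complex_eqI)
  show "Re (cinner v v) = Re (complex_of_real (inner v v))"
    by (simp add: Re_cinner)
  have "Im (cinner v v) = - Im (cinner v v)"
    using arg_cong[OF cinner_commute[of v v], of Im] by simp
  then show "Im (cinner v v) = Im (complex_of_real (inner v v))"
    by simp
qed

lemma norm_scaleC: "norm (c *\<^sub>C v) = cmod c * norm v"
proof -
  have "cinner (c *\<^sub>C v) (c *\<^sub>C v) = c * cnj (cinner v (c *\<^sub>C v))"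
    using cinner_commute[of "c *\<^sub>C v" v] by (simp add: cinner_scaleC_right)
  also have "\<dots> = c * cnj c * complex_of_real (inner v v)"
    by (simp add: cinner_scaleC_right cinner_self)
  also have "\<dots> = complex_of_real ((cmod c)\<^sup>2 * inner v v)"
    by (metis complex_norm_square of_real_mult)
  finally have "inner (c *\<^sub>C v) (c *\<^sub>C v) = (cmod c)\<^sup>2 * inner v v"
    by (metis Re_cinner Re_complex_of_real)
  then show ?thesis
    by (simp add: norm_eq_sqrt_inner real_sqrt_mult)
qed

end

text \<open>The space \<open>\<complex>\<close> of scalars is an instance.\<close>

instantiation complex :: chilbert_space
begin

definition scaleC_complex :: "complex \<Rightarrow> complex \<Rightarrow> complex" where
  "scaleC_complex c v = c * v"

definition cinner_complex :: "complex \<Rightarrow> complex \<Rightarrow> complex" where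
  "cinner_complex v w = cnj v * w"

instance
  by standard (auto simp: scaleC_complex_def cinner_complex_def algebra_simps scaleR_conv_of_real
      inner_complex_def)

end

text \<open>
  Bounded operators are real-linear bounded maps commuting with complex scalars; the norm of
  \<^typ>\<open>'h \<Rightarrow>\<^sub>L 'h\<close> is the operator norm.
\<close>

definition clinear_op :: "('h::chilbert_space \<Rightarrow>\<^sub>L 'h) \<Rightarrow> bool" where
  "clinear_op A \<longleftrightarrow> (\<forall>c v. A (c *\<^sub>C v) = c *\<^sub>C A v)"

lift_definition scale_op :: "complex \<Rightarrow> ('h::chilbert_space \<Rightarrow>\<^sub>L 'h) \<Rightarrow> ('h \<Rightarrow>\<^sub>L 'h)"
  is "\<lambda>c A v. c *\<^sub>C A v"
proof -
  fix c :: complex and A :: "'h \<Rightarrow> 'h"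
  assume A: "bounded_linear A"
  have "bounded_linear (\<lambda>v :: 'h. c *\<^sub>C v)"
  proof (rule bounded_linear_intro[where K = "cmod c"])
    fix r :: real and v w :: 'h
    show "c *\<^sub>C (v + w) = c *\<^sub>C v + c *\<^sub>C w"
      by (rule scaleC_add_right)
    show "c *\<^sub>C (r *\<^sub>R v) = r *\<^sub>R (c *\<^sub>C v)"
      by (metis mult.commute scaleC_of_real scaleC_scaleC)
    show "norm (c *\<^sub>C v) \<le> norm v * cmod c"
      by (simp add: norm_scaleC)
  qed
  from bounded_linear_compose[OF this A]
  show "bounded_linear (\<lambda>v. c *\<^sub>C A v)" .
qed

definition is_adjoint :: "('h::chilbert_space \<Rightarrow>\<^sub>L 'h) \<Rightarrow> ('h \<Rightarrow>\<^sub>L 'h) \<Rightarrow> bool" where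
  "is_adjoint A B \<longleftrightarrow> (\<forall>v w. cinner (A v) w = cinner v (B w))"

definition adj :: "('h::chilbert_space \<Rightarrow>\<^sub>L 'h) \<Rightarrow> ('h \<Rightarrow>\<^sub>L 'h)" where
  "adj A = (THE B. is_adjoint A B)"

definition selfadjoint :: "('h::chilbert_space \<Rightarrow>\<^sub>L 'h) \<Rightarrow> bool" where
  "selfadjoint A \<longleftrightarrow> is_adjoint A A"

definition op_le :: "('h::chilbert_space \<Rightarrow>\<^sub>L 'h) \<Rightarrow> ('h \<Rightarrow>\<^sub>L 'h) \<Rightarrow> bool" where
  "op_le A B \<longleftrightarrow> (\<forall>v. Re (cinner v (A v)) \<le> Re (cinner v (B v)))"

definition op_prod :: "('h::chilbert_space \<Rightarrow>\<^sub>L 'h) list \<Rightarrow> ('h \<Rightarrow>\<^sub>L 'h)" where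
  "op_prod As = foldr (o\<^sub>L) As id_blinfun"


section \<open>Tracial von Neumann algebras\<close>

definition commutant :: "('h::chilbert_space \<Rightarrow>\<^sub>L 'h) set \<Rightarrow> ('h \<Rightarrow>\<^sub>L 'h) set" where
  "commutant X = {B. clinear_op B \<and> (\<forall>A\<in>X. A o\<^sub>L B = B o\<^sub>L A)}"

definition von_neumann_algebra :: "('h::chilbert_space \<Rightarrow>\<^sub>L 'h) set \<Rightarrow> bool" where
  "von_neumann_algebra M \<longleftrightarrow>
     (\<forall>A\<in>M. clinear_op A) \<and> (\<forall>A\<in>M. \<exists>B\<in>M. is_adjoint A B) \<and> commutant (commutant M) = M"

text \<open>\<open>W\<^sup>*(X)\<close>\<close>

definition vn_generated :: "('h::chilbert_space \<Rightarrow>\<^sub>L 'h) set \<Rightarrow> ('h \<Rightarrow>\<^sub>L 'h) set" where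
  "vn_generated X = \<Inter>{M. von_neumann_algebra M \<and> X \<subseteq> M}"

text \<open>Normality is preservation of least upper bounds of upward directed sets of self-adjoints.\<close>

definition normal_on :: "('h::chilbert_space \<Rightarrow>\<^sub>L 'h) set \<Rightarrow> (('h \<Rightarrow>\<^sub>L 'h) \<Rightarrow> complex) \<Rightarrow> bool" where
  "normal_on M \<tau> \<longleftrightarrow>
     (\<forall>D A. D \<noteq> {} \<and> D \<subseteq> {B \<in> M. selfadjoint B} \<and>
        (\<forall>B\<in>D. \<forall>C\<in>D. \<exists>E\<in>D. op_le B E \<and> op_le C E) \<and>
        A \<in> M \<and> selfadjoint A \<and> (\<forall>B\<in>D. op_le B A) \<and>
        (\<forall>C\<in>M. selfadjoint C \<and> (\<forall>B\<in>D. op_le B C) \<longrightarrow> op_le A C)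
      \<longrightarrow> Re (\<tau> A) = (SUP B\<in>D. Re (\<tau> B)))"

locale tracial_von_neumann_algebra =
  fixes M :: "('h::chilbert_space \<Rightarrow>\<^sub>L 'h) set"
    and \<tau> :: "('h \<Rightarrow>\<^sub>L 'h) \<Rightarrow> complex"
  assumes vn_algebra: "von_neumann_algebra M"
    and tau_add: "\<And>A B. A \<in> M \<Longrightarrow> B \<in> M \<Longrightarrow> \<tau> (A + B) = \<tau> A + \<tau> B"
    and tau_scale: "\<And>c A. A \<in> M \<Longrightarrow> \<tau> (scale_op c A) = c * \<tau> A"
    and tau_one: "\<tau> id_blinfun = 1"
    and tau_nonneg: "\<And>A. A \<in> M \<Longrightarrow> \<tau> (adj A o\<^sub>L A) \<in> \<real>\<^sub>\<ge>\<^sub>0"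
    and tau_faithful: "\<And>A. A \<in> M \<Longrightarrow> \<tau> (adj A o\<^sub>L A) = 0 \<Longrightarrow> A = 0"
    and tau_trace: "\<And>A B. A \<in> M \<Longrightarrow> B \<in> M \<Longrightarrow> \<tau> (A o\<^sub>L B) = \<tau> (B o\<^sub>L A)"
    and tau_normal: "normal_on M \<tau>"

text \<open>
  Inclusion of \<open>(M, \<tau>)\<close> into a larger tracial von Neumann algebra \<open>(N, \<sigma>)\<close>, possibly acting on
  another Hilbert space. Injectivity and normality follow from preservation of the faithful
  normal traces.
\<close>

locale tracial_embedding =
  M: tracial_von_neumann_algebra M \<tau> + N: tracial_von_neumann_algebra N \<sigma>
  for M :: "('h::chilbert_space \<Rightarrow>\<^sub>L 'h) set" and \<tau>
    and N :: "('k::chilbert_space \<Rightarrow>\<^sub>L 'k) set" and \<sigma> +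
  fixes \<iota> :: "('h \<Rightarrow>\<^sub>L 'h) \<Rightarrow> ('k \<Rightarrow>\<^sub>L 'k)"
  assumes emb_mem: "\<And>A. A \<in> M \<Longrightarrow> \<iota> A \<in> N"
    and emb_add: "\<And>A B. A \<in> M \<Longrightarrow> B \<in> M \<Longrightarrow> \<iota> (A + B) = \<iota> A + \<iota> B"
    and emb_scale: "\<And>c A. A \<in> M \<Longrightarrow> \<iota> (scale_op c A) = scale_op c (\<iota> A)"
    and emb_one: "\<iota> id_blinfun = id_blinfun"
    and emb_mult: "\<And>A B. A \<in> M \<Longrightarrow> B \<in> M \<Longrightarrow> \<iota> (A o\<^sub>L B) = \<iota> A o\<^sub>L \<iota> B"
    and emb_adj: "\<And>A. A \<in> M \<Longrightarrow> \<iota> (adj A) = adj (\<iota> A)"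
    and emb_trace: "\<And>A. A \<in> M \<Longrightarrow> \<sigma> (\<iota> A) = \<tau> A"


section \<open>Non-commutative polynomials and power series\<close>

text \<open>
  The indeterminates are indexed by a finite type \<open>'n\<close>, so there are \<open>CARD('n)\<close> of them. A series
  is given by its coefficients: \<open>P w\<close> is the coefficient of the monomial \<open>X\<^bsub>w ! 0\<^esub> X\<^bsub>w ! 1\<^esub> \<cdots>\<close>.
\<close>

definition nc_polynomials :: "('n::finite list \<Rightarrow> complex) set" where
  "nc_polynomials = {P. finite {w. P w \<noteq> 0}}"

definition nc_series :: "real \<Rightarrow> ('n::finite list \<Rightarrow> complex) set" where
  "nc_series R' = {P. (\<lambda>w. cmod (P w) * R' ^ length w) summable_on UNIV}"

text \<open>The algebra \<open>\<A>[X\<^sub>1, \<dots>, X\<^sub>n; R]\<close>\<close>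

definition nc_analytic :: "real \<Rightarrow> ('n::finite list \<Rightarrow> complex) set" where
  "nc_analytic R = (\<Union>R' \<in> {R'. R' > R \<and> R' > 0}. nc_series R')"

definition nc_monomial ::
  "('n::finite \<Rightarrow> ('h::chilbert_space \<Rightarrow>\<^sub>L 'h)) \<Rightarrow> 'n list \<Rightarrow> ('h \<Rightarrow>\<^sub>L 'h)" where
  "nc_monomial x w = op_prod (map x w)"

text \<open>The sum is taken in the operator norm; it is a finite sum if \<open>P\<close> is a polynomial.\<close>

definition nc_eval ::
  "('n::finite list \<Rightarrow> complex) \<Rightarrow> ('n \<Rightarrow> ('h::chilbert_space \<Rightarrow>\<^sub>L 'h)) \<Rightarrow> ('h \<Rightarrow>\<^sub>L 'h)" where
  "nc_eval P x = (\<Sum>\<^sub>\<infinity>w. scale_op (P w) (nc_monomial x w))"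

text \<open>
  Elements of \<open>\<complex>[X] \<otimes> \<complex>[X]\<close> are given by their coefficients at the basis elements \<open>u \<otimes> v\<close>. The
  derivation \<open>\<partial>\<^sub>j\<close> sends a monomial \<open>w\<close> to the sum of \<open>u \<otimes> v\<close> over all factorizations
  \<open>w = u X\<^sub>j v\<close>, so that \<open>u \<otimes> v\<close> receives the coefficient of \<open>u X\<^sub>j v\<close>.
\<close>

definition nc_deriv :: "'n::finite \<Rightarrow> ('n list \<Rightarrow> complex) \<Rightarrow> ('n list \<times> 'n list \<Rightarrow> complex)" where
  "nc_deriv j P = (\<lambda>(u, v). P (u @ j # v))"

definition nc_mult ::
  "('n::finite list \<Rightarrow> complex) \<Rightarrow> ('n list \<Rightarrow> complex) \<Rightarrow> ('n list \<Rightarrow> complex)" where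
  "nc_mult P Q = (\<lambda>w. \<Sum>k\<le>length w. P (take k w) * Q (drop k w))"

lemma nc_deriv_indeterminate:
  "nc_deriv j (\<lambda>w. if w = [i] then 1 else 0) = (\<lambda>p. if i = j \<and> p = ([], []) then 1 else 0)"
  by (auto simp: nc_deriv_def fun_eq_iff append_eq_Cons_conv)

text \<open>The Leibniz rule \<open>\<partial>\<^sub>j(PQ) = (\<partial>\<^sub>jP)(1 \<otimes> Q) + (P \<otimes> 1)(\<partial>\<^sub>jQ)\<close>, read off at \<open>u \<otimes> v\<close>\<close>

lemma nc_deriv_mult:
  "nc_deriv j (nc_mult P Q) (u, v) =
     (\<Sum>k\<le>length v. nc_deriv j P (u, take k v) * Q (drop k v)) +
     (\<Sum>k\<le>length u. P (take k u) * nc_deriv j Q (drop k u, v))"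
proof -
  define f where "f k = P (take k (u @ j # v)) * Q (drop k (u @ j # v))" for k
  have "nc_deriv j (nc_mult P Q) (u, v) = (\<Sum>k\<le>length u + Suc (length v). f k)"
    by (simp add: nc_deriv_def nc_mult_def f_def)
  also have "\<dots> = (\<Sum>k\<in>{..length u} \<union> {Suc (length u)..length u + Suc (length v)}. f k)"
    by (rule sum.cong) auto
  also have "\<dots> = (\<Sum>k\<le>length u. f k) + (\<Sum>k=Suc (length u)..length u + Suc (length v). f k)"
    by (rule sum.union_disjoint) auto
  also have "(\<Sum>k=Suc (length u)..length u + Suc (length v). f k) =
      (\<Sum>k\<le>length v. f (k + Suc (length u)))"
    by (rule sum.reindex_bij_witness[of _ "\<lambda>k. k + Suc (length u)" "\<lambda>k. k - Suc (length u)"]) auto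
  finally show ?thesis
    by (simp add: f_def nc_deriv_def add.commute)
qed

definition tensor_trace ::
  "(('h::chilbert_space \<Rightarrow>\<^sub>L 'h) \<Rightarrow> complex) \<Rightarrow> ('n::finite \<Rightarrow> ('h \<Rightarrow>\<^sub>L 'h)) \<Rightarrow>
   ('n list \<times> 'n list \<Rightarrow> complex) \<Rightarrow> complex" where
  "tensor_trace \<tau> x T =
     (\<Sum>(u, v) | T (u, v) \<noteq> 0. T (u, v) * (\<tau> (nc_monomial x u) * \<tau> (nc_monomial x v)))"


section \<open>Freeness and semicircular elements\<close>

inductive_set star_algebra :: "('h::chilbert_space \<Rightarrow>\<^sub>L 'h) set \<Rightarrow> ('h \<Rightarrow>\<^sub>L 'h) set"
  for X :: "('h \<Rightarrow>\<^sub>L 'h) set" where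
  gen: "A \<in> X \<Longrightarrow> A \<in> star_algebra X"
| one: "id_blinfun \<in> star_algebra X"
| add: "A \<in> star_algebra X \<Longrightarrow> B \<in> star_algebra X \<Longrightarrow> A + B \<in> star_algebra X"
| scale: "A \<in> star_algebra X \<Longrightarrow> scale_op c A \<in> star_algebra X"
| mult: "A \<in> star_algebra X \<Longrightarrow> B \<in> star_algebra X \<Longrightarrow> A o\<^sub>L B \<in> star_algebra X"
| adj: "A \<in> star_algebra X \<Longrightarrow> adj A \<in> star_algebra X"

text \<open>Centred elements of algebras with alternating indices have a centred product.\<close>

definition free_family ::
  "(('h::chilbert_space \<Rightarrow>\<^sub>L 'h) \<Rightarrow> complex) \<Rightarrow> ('i \<Rightarrow> ('h \<Rightarrow>\<^sub>L 'h) set) \<Rightarrow> bool" where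
  "free_family \<sigma> X \<longleftrightarrow>
     (\<forall>as. as \<noteq> [] \<and> successively (\<lambda>p q. fst p \<noteq> fst q) as \<and>
        (\<forall>(i, A) \<in> set as. A \<in> star_algebra (X i) \<and> \<sigma> A = 0)
      \<longrightarrow> \<sigma> (op_prod (map snd as)) = 0)"

text \<open>
  Mean \<open>0\<close>, variance \<open>1\<close>: the density is \<open>sqrt (4 - t\<^sup>2) / (2 \<pi>)\<close> on \<open>[-2, 2]\<close>. The moments
  determine the distribution since it has bounded support.
\<close>

definition standard_semicircular ::
  "(('h::chilbert_space \<Rightarrow>\<^sub>L 'h) \<Rightarrow> complex) \<Rightarrow> ('h \<Rightarrow>\<^sub>L 'h) \<Rightarrow> bool" where
  "standard_semicircular \<sigma> s \<longleftrightarrow> selfadjoint s \<and>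
     (\<forall>k. \<sigma> (op_prod (replicate k s)) =
        complex_of_real (integral {-2..2} (\<lambda>t. t ^ k * (sqrt (4 - t\<^sup>2) / (2 * pi)))))"

text \<open>\<open>S\<close> is a free family of standard semicirculars in \<open>N\<close>, free from the set \<open>{x\<^sub>1, \<dots>, x\<^sub>n}\<close>.\<close>

definition free_semicirculars ::
  "('h::chilbert_space \<Rightarrow>\<^sub>L 'h) set \<Rightarrow> (('h \<Rightarrow>\<^sub>L 'h) \<Rightarrow> complex) \<Rightarrow>
   ('n::finite \<Rightarrow> ('h \<Rightarrow>\<^sub>L 'h)) \<Rightarrow> ('n \<Rightarrow> ('h \<Rightarrow>\<^sub>L 'h)) \<Rightarrow> bool" where
  "free_semicirculars N \<sigma> x S \<longleftrightarrow>
     (\<forall>j. S j \<in> N \<and> standard_semicircular \<sigma> (S j)) \<and>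
     free_family \<sigma> (\<lambda>j. {S j}) \<and>
     free_family \<sigma> (\<lambda>b::bool. if b then range x else range S)"

definition perturb ::
  "('n::finite \<Rightarrow> ('h::chilbert_space \<Rightarrow>\<^sub>L 'h)) \<Rightarrow> ('n \<Rightarrow> ('h \<Rightarrow>\<^sub>L 'h)) \<Rightarrow> real \<Rightarrow> 'n \<Rightarrow> ('h \<Rightarrow>\<^sub>L 'h)" where
  "perturb x S t = (\<lambda>j. x j + sqrt t *\<^sub>R S j)"


section \<open>Conjugate variables and non-microstates free entropy dimension\<close>

definition norm2 :: "(('h::chilbert_space \<Rightarrow>\<^sub>L 'h) \<Rightarrow> complex) \<Rightarrow> ('h \<Rightarrow>\<^sub>L 'h) \<Rightarrow> real" where
  "norm2 \<tau> A = sqrt (Re (\<tau> (adj A o\<^sub>L A)))"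

text \<open>
  \<open>L\<^sup>2(A, \<tau>)\<close> is the completion of \<open>A\<close> in the 2-norm; its elements are represented by
  Cauchy sequences in \<open>A\<close>. The pairing \<open>\<tau>(\<xi> a)\<close> and the norm extend by continuity.
\<close>

definition L2_seqs ::
  "('h::chilbert_space \<Rightarrow>\<^sub>L 'h) set \<Rightarrow> (('h \<Rightarrow>\<^sub>L 'h) \<Rightarrow> complex) \<Rightarrow> (nat \<Rightarrow> ('h \<Rightarrow>\<^sub>L 'h)) set" where
  "L2_seqs A \<tau> = {\<xi>. range \<xi> \<subseteq> A \<and> (\<forall>e>0. \<exists>K. \<forall>k\<ge>K. \<forall>l\<ge>K. norm2 \<tau> (\<xi> k - \<xi> l) < e)}"

definition L2_trace ::
  "(('h::chilbert_space \<Rightarrow>\<^sub>L 'h) \<Rightarrow> complex) \<Rightarrow> (nat \<Rightarrow> ('h \<Rightarrow>\<^sub>L 'h)) \<Rightarrow> ('h \<Rightarrow>\<^sub>L 'h) \<Rightarrow> complex" where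
  "L2_trace \<tau> \<xi> a = lim (\<lambda>k. \<tau> (\<xi> k o\<^sub>L a))"

definition L2_norm ::
  "(('h::chilbert_space \<Rightarrow>\<^sub>L 'h) \<Rightarrow> complex) \<Rightarrow> (nat \<Rightarrow> ('h \<Rightarrow>\<^sub>L 'h)) \<Rightarrow> real" where
  "L2_norm \<tau> \<xi> = lim (\<lambda>k. norm2 \<tau> (\<xi> k))"

definition conjugate_variable ::
  "(('h::chilbert_space \<Rightarrow>\<^sub>L 'h) \<Rightarrow> complex) \<Rightarrow> ('n::finite \<Rightarrow> ('h \<Rightarrow>\<^sub>L 'h)) \<Rightarrow> 'n \<Rightarrow>
   (nat \<Rightarrow> ('h \<Rightarrow>\<^sub>L 'h)) \<Rightarrow> bool" where
  "conjugate_variable \<tau> x j \<xi> \<longleftrightarrow>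
     \<xi> \<in> L2_seqs (vn_generated (range x)) \<tau> \<and>
     (\<forall>P \<in> nc_polynomials. L2_trace \<tau> \<xi> (nc_eval P x) = tensor_trace \<tau> x (nc_deriv j P))"

text \<open>A conjugate variable is unique as an element of \<open>L\<^sup>2\<close>, so the choice below is immaterial.\<close>

definition Phi_star ::
  "(('h::chilbert_space \<Rightarrow>\<^sub>L 'h) \<Rightarrow> complex) \<Rightarrow> ('n::finite \<Rightarrow> ('h \<Rightarrow>\<^sub>L 'h)) \<Rightarrow> ereal" where
  "Phi_star \<tau> x =
     (if \<forall>j. \<exists>\<xi>. conjugate_variable \<tau> x j \<xi>
      then ereal (\<Sum>j\<in>UNIV. (L2_norm \<tau> (SOME \<xi>. conjugate_variable \<tau> x j \<xi>))\<^sup>2)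
      else \<infinity>)"

text \<open>
  The integral of an extended real function is the difference of the integrals of its positive and
  negative parts (\<^const>\<open>e2ennreal\<close> truncates at \<open>0\<close>). In \<open>chi_star\<close> the first one is finite, so
  the value lies in \<open>[-\<infinity>, \<infinity>)\<close>.
\<close>

definition ereal_integral_pos :: "(real \<Rightarrow> ereal) \<Rightarrow> ereal" where
  "ereal_integral_pos f =
     enn2ereal (\<integral>\<^sup>+t\<in>{0<..}. e2ennreal (f t) \<partial>lborel) -
     enn2ereal (\<integral>\<^sup>+t\<in>{0<..}. e2ennreal (- f t) \<partial>lborel)"

text \<open>
  \<open>chi_star\<close> and \<open>delta_star\<close> take as arguments the semicircular families appearing in their
  definitions: \<open>S\<close> is meant to be a free semicircular family free from \<open>x\<close>, and \<open>T \<epsilon>\<close> one that is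
  free from the perturbation \<open>x + sqrt \<epsilon> S\<close>. The values do not depend on these choices.
\<close>

definition chi_star ::
  "(('h::chilbert_space \<Rightarrow>\<^sub>L 'h) \<Rightarrow> complex) \<Rightarrow> ('n::finite \<Rightarrow> ('h \<Rightarrow>\<^sub>L 'h)) \<Rightarrow>
   ('n \<Rightarrow> ('h \<Rightarrow>\<^sub>L 'h)) \<Rightarrow> ereal" where
  "chi_star \<sigma> x S =
     ereal (1 / 2) * ereal_integral_pos
       (\<lambda>t. ereal (real CARD('n) / (1 + t)) - Phi_star \<sigma> (perturb x S t)) +
     ereal (real CARD('n) / 2 * ln (2 * pi * exp 1))"

definition delta_star ::
  "(('h::chilbert_space \<Rightarrow>\<^sub>L 'h) \<Rightarrow> complex) \<Rightarrow> ('n::finite \<Rightarrow> ('h \<Rightarrow>\<^sub>L 'h)) \<Rightarrow>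
   ('n \<Rightarrow> ('h \<Rightarrow>\<^sub>L 'h)) \<Rightarrow> (real \<Rightarrow> 'n \<Rightarrow> ('h \<Rightarrow>\<^sub>L 'h)) \<Rightarrow> ereal" where
  "delta_star \<sigma> x S T =
     ereal (real CARD('n)) -
     Liminf (at_right 0) (\<lambda>\<epsilon>. chi_star \<sigma> (perturb x S \<epsilon>) (T \<epsilon>) / ereal (ln (sqrt \<epsilon>)))"

end

theory Submission
  imports Defs "HOL-Complex_Analysis.Conformal_Mappings"
begin

text \<open>
  Let \<open>x\<close> be the image of \<open>y\<close> in the larger algebra. Full entropy dimension says that the Fisher
  information of the perturbations \<open>z\<close> of \<open>x\<close> by free semicirculars is, along a sequence, of smaller
  order than the inverse of the total variance of the perturbation: otherwise the entropy integral
  would diverge at a positive multiple of the logarithmic rate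
  (\<open>full_dimension_small_information\<close>). In other words, the perturbation has some size \<open>d\<close>, tending
  to \<open>0\<close>, and the conjugate variables \<open>\<xi>\<^sub>j\<close> of \<open>z\<close> have 2-norm \<open>o(1/d)\<close>.

  Now let \<open>P(x) = 0\<close>. Then \<open>\<parallel>P(z)\<parallel>\<^sub>2 = O(d)\<close>, so \<open>\<tau>(\<xi>\<^sub>j B(z) P(z) C(z))\<close> tends to \<open>0\<close> for words \<open>B\<close> and
  \<open>C\<close>. The conjugate relation and the Leibniz rule turn this into
  \<open>(\<tau> \<otimes> \<tau>)((B \<otimes> 1) (\<partial>\<^sub>jP) (1 \<otimes> C)) = 0\<close> at \<open>x\<close>
  (\<open>annihilator_split_trace\<close>). So \<open>\<partial>\<^sub>jP\<close> vanishes at \<open>x\<close> in \<open>L\<^sup>2 \<otimes> L\<^sup>2\<close>, for all \<open>j\<close>.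

  This has two consequences. Applying \<open>\<tau> \<otimes> 1\<close> gives a relation again, of lower degree if \<open>P\<close> is a
  polynomial; so polynomial relations are trivial by induction on the degree. For power series there
  is no degree to reduce, but contracting \<open>\<partial>\<^sub>jP\<close> with \<open>x\<^sub>j\<close> and summing over \<open>j\<close> shows that the
  Euler derivative \<open>X\<^sub>w \<mapsto> |w| X\<^sub>w\<close> of \<open>P\<close> is a relation as well
  (\<open>annihilator_contraction\<close>, \<open>annihilator_euler\<close>). Iterating, the analytic function
  \<open>z \<mapsto> \<tau>(P(z x) C(x))\<close>, defined on a disc of radius greater than \<open>1\<close>, vanishes to infinite order at
  \<open>1\<close>. It is therefore \<open>0\<close>, the homogeneous components of \<open>P\<close> are relations, and being polynomials they
  are \<open>0\<close>.

  All estimates are made in the 2-norm and in the norm of left multiplication on \<open>L\<^sup>2\<close>, which is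
  determined by moments; the series \<open>P(z)\<close> enters only through its partial sums.
\<close>


section \<open>Operators and adjoints\<close>

instance chilbert_space \<subseteq> banach ..

lemma cinner_add_left: "cinner (v + w) u = cinner v u + cinner w (u::'h::chilbert_space)"
  by (metis cinner_add_right cinner_commute complex_cnj_add)

lemma cinner_scaleC_left: "cinner (c *\<^sub>C v) u = cnj c * cinner v (u::'h::chilbert_space)"
  by (metis cinner_scaleC_right cinner_commute complex_cnj_mult)

lemma cinner_eqI:
  fixes a b :: "'h::chilbert_space"
  assumes "\<And>v. cinner v a = cinner v b"
  shows "a = b"
proof -
  have "inner (a - b) a = inner (a - b) b"
    using assms[of "a - b"] by (metis Re_cinner)
  then have "inner (a - b) (a - b) = 0"
    by (simp add: inner_diff_right)
  then show ?thesis by simp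
qed

lemma blinfun_apply_scale_op [simp]: "blinfun_apply (scale_op c A) v = c *\<^sub>C A v"
  by transfer simp

lemma scaleC_one [simp]: "1 *\<^sub>C v = (v::'h::chilbert_space)"
  using scaleC_of_real[of 1 v] by simp

lemma scaleC_zero [simp]: "0 *\<^sub>C v = (0::'h::chilbert_space)"
  using scaleC_of_real[of 0 v] by simp

lemma scaleC_diff_right: "c *\<^sub>C (v - w) = c *\<^sub>C v - c *\<^sub>C (w::'h::chilbert_space)"
  by (metis add_diff_cancel_right' diff_add_cancel scaleC_add_right)

lemma scale_op_one [simp]: "scale_op 1 A = A"
  by (rule blinfun_eqI) simp

lemma scale_op_zero [simp]: "scale_op 0 A = 0"
  by (rule blinfun_eqI) simp

lemma scale_op_scale_op [simp]: "scale_op c (scale_op d A) = scale_op (c * d) A"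
  by (rule blinfun_eqI) (simp add: scaleC_scaleC)

lemma scale_op_of_real: "scale_op (complex_of_real r) A = r *\<^sub>R A"
  by (rule blinfun_eqI) (simp add: scaleC_of_real blinfun.scaleR_left)

lemma scale_op_minus_one: "scale_op (-1) A = - A"
  using scale_op_of_real[of "-1" A] by simp

lemma norm_scale_op_le: "norm (scale_op c A) \<le> cmod c * norm A"
  by (rule norm_blinfun_bound) (auto simp: norm_scaleC mult.assoc norm_blinfun intro!: mult_left_mono)

lemma blinfun_compose_add_left: "(A + B) o\<^sub>L C = (A o\<^sub>L C) + (B o\<^sub>L C)"
  by (rule blinfun_eqI) (simp add: blinfun.add_left)

lemma blinfun_compose_add_right: "A o\<^sub>L (B + C) = (A o\<^sub>L B) + (A o\<^sub>L C)"
  by (rule blinfun_eqI) (simp add: blinfun.add_left blinfun.add_right)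

lemma blinfun_compose_diff_left: "(A - B) o\<^sub>L C = (A o\<^sub>L C) - (B o\<^sub>L C)"
  by (rule blinfun_eqI) (simp add: blinfun.diff_left)

lemma blinfun_compose_diff_right: "A o\<^sub>L (B - C) = (A o\<^sub>L B) - (A o\<^sub>L C)"
  by (rule blinfun_eqI) (simp add: blinfun.diff_left blinfun.diff_right)

lemma blinfun_compose_scale_left: "scale_op c A o\<^sub>L B = scale_op c (A o\<^sub>L B)"
  by (rule blinfun_eqI) simp

lemma blinfun_compose_scale_right: "clinear_op A \<Longrightarrow> A o\<^sub>L scale_op c B = scale_op c (A o\<^sub>L B)"
  by (rule blinfun_eqI) (simp add: clinear_op_def)

lemma blinfun_compose_assoc: "(A o\<^sub>L B) o\<^sub>L C = A o\<^sub>L (B o\<^sub>L C)"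
  by (rule blinfun_eqI) simp

lemma blinfun_compose_id [simp]: "A o\<^sub>L id_blinfun = A" "id_blinfun o\<^sub>L A = A"
  by (rule blinfun_eqI, simp)+

lemma is_adjoint_unique:
  assumes "is_adjoint A B" "is_adjoint A C" shows "B = C"
  by (rule blinfun_eqI, rule cinner_eqI) (metis assms is_adjoint_def)

lemma adj_eq: "is_adjoint A B \<Longrightarrow> adj A = B"
  unfolding adj_def using is_adjoint_unique by blast

lemma is_adjoint_sym: "is_adjoint A B \<Longrightarrow> is_adjoint B A"
  unfolding is_adjoint_def by (metis cinner_commute)

lemma is_adjoint_id: "is_adjoint id_blinfun id_blinfun"
  by (simp add: is_adjoint_def)

lemma is_adjoint_add: "is_adjoint A A' \<Longrightarrow> is_adjoint B B' \<Longrightarrow> is_adjoint (A + B) (A' + B')"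
  by (simp add: is_adjoint_def blinfun.add_left cinner_add_left cinner_add_right)

lemma is_adjoint_scale: "is_adjoint A A' \<Longrightarrow> is_adjoint (scale_op c A) (scale_op (cnj c) A')"
  by (simp add: is_adjoint_def cinner_scaleC_left cinner_scaleC_right)

lemma is_adjoint_compose:
  "is_adjoint A A' \<Longrightarrow> is_adjoint B B' \<Longrightarrow> is_adjoint (A o\<^sub>L B) (B' o\<^sub>L A')"
  by (simp add: is_adjoint_def)

lemma op_prod_Nil [simp]: "op_prod [] = id_blinfun"
  by (simp add: op_prod_def)

lemma op_prod_Cons [simp]: "op_prod (A # As) = A o\<^sub>L op_prod As"
  by (simp add: op_prod_def)

lemma op_prod_append: "op_prod (As @ Bs) = op_prod As o\<^sub>L op_prod Bs"
  by (induction As) (auto simp: blinfun_compose_assoc)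

lemma nc_monomial_Nil [simp]: "nc_monomial x [] = id_blinfun"
  by (simp add: nc_monomial_def)

lemma nc_monomial_Cons [simp]: "nc_monomial x (j # w) = x j o\<^sub>L nc_monomial x w"
  by (simp add: nc_monomial_def)

lemma nc_monomial_append: "nc_monomial x (u @ v) = nc_monomial x u o\<^sub>L nc_monomial x v"
  by (simp add: nc_monomial_def op_prod_append)


section \<open>The Hilbert-space structure given by a trace\<close>

context tracial_von_neumann_algebra
begin

lemma clinear: "A \<in> M \<Longrightarrow> clinear_op A"
  using vn_algebra by (auto simp: von_neumann_algebra_def)

lemma mem_iff_bicommutant: "A \<in> M \<longleftrightarrow> A \<in> commutant (commutant M)"
  using vn_algebra by (auto simp: von_neumann_algebra_def)

lemma clinear_commutant: "A \<in> commutant X \<Longrightarrow> clinear_op A"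
  by (simp add: commutant_def)

lemma id_mem [simp]: "id_blinfun \<in> M"
  unfolding mem_iff_bicommutant
  by (auto simp: commutant_def clinear_op_def intro!: blinfun_eqI)

lemma add_mem [simp]: "A \<in> M \<Longrightarrow> B \<in> M \<Longrightarrow> A + B \<in> M"
  unfolding mem_iff_bicommutant commutant_def[of "commutant M"]
  by (auto simp: clinear_op_def blinfun.add_left scaleC_add_right
      blinfun_compose_add_left blinfun_compose_add_right)

lemma scale_mem [simp]: "A \<in> M \<Longrightarrow> scale_op c A \<in> M"
  unfolding mem_iff_bicommutant commutant_def[of "commutant M"]
  using clinear_commutant[of _ M]
  by (auto simp: clinear_op_def[of "scale_op c A"] clinear_op_def[of A] scaleC_scaleC mult.commute
      blinfun_compose_scale_left blinfun_compose_scale_right)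

lemma compose_mem [simp]: "A \<in> M \<Longrightarrow> B \<in> M \<Longrightarrow> A o\<^sub>L B \<in> M"
  unfolding mem_iff_bicommutant commutant_def[of "commutant M"]
  by (auto simp: clinear_op_def blinfun_compose_assoc) (metis blinfun_compose_assoc)

lemma zero_mem [simp]: "0 \<in> M"
  using scale_mem[OF id_mem, of 0] by simp

lemma uminus_mem [simp]: "A \<in> M \<Longrightarrow> - A \<in> M"
  using scale_mem[of A "-1"] by (simp add: scale_op_minus_one)

lemma diff_mem [simp]: "A \<in> M \<Longrightarrow> B \<in> M \<Longrightarrow> A - B \<in> M"
  using add_mem[of A "- B"] by simp

lemma scaleR_mem [simp]: "A \<in> M \<Longrightarrow> r *\<^sub>R A \<in> M"
  using scale_mem[of A "of_real r"] by (simp add: scale_op_of_real)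

lemma sum_mem [simp]: "(\<And>i. i \<in> F \<Longrightarrow> f i \<in> M) \<Longrightarrow> (\<Sum>i\<in>F. f i) \<in> M"
  by (induction F rule: infinite_finite_induct) auto

lemma adj_is_adjoint: "A \<in> M \<Longrightarrow> is_adjoint A (adj A)"
  using vn_algebra adj_eq by (fastforce simp: von_neumann_algebra_def)

lemma adj_mem [simp]: "A \<in> M \<Longrightarrow> adj A \<in> M"
  using vn_algebra adj_eq by (fastforce simp: von_neumann_algebra_def)

lemma adj_adj [simp]: "A \<in> M \<Longrightarrow> adj (adj A) = A"
  by (rule adj_eq[OF is_adjoint_sym[OF adj_is_adjoint]])

lemma adj_add: "A \<in> M \<Longrightarrow> B \<in> M \<Longrightarrow> adj (A + B) = adj A + adj B"
  by (intro adj_eq is_adjoint_add adj_is_adjoint)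

lemma adj_scale: "A \<in> M \<Longrightarrow> adj (scale_op c A) = scale_op (cnj c) (adj A)"
  by (intro adj_eq is_adjoint_scale adj_is_adjoint)

lemma adj_compose: "A \<in> M \<Longrightarrow> B \<in> M \<Longrightarrow> adj (A o\<^sub>L B) = adj B o\<^sub>L adj A"
  by (intro adj_eq is_adjoint_compose adj_is_adjoint)

lemma adj_id [simp]: "adj id_blinfun = id_blinfun"
  by (intro adj_eq is_adjoint_id)

lemma adj_diff: "A \<in> M \<Longrightarrow> B \<in> M \<Longrightarrow> adj (A - B) = adj A - adj B"
  using adj_add[of A "- B"] adj_scale[of B "-1"] by (simp add: scale_op_minus_one)

lemma op_prod_mem: "set As \<subseteq> M \<Longrightarrow> op_prod As \<in> M"
  by (induction As) auto

lemma monomial_mem: "(\<And>j. x j \<in> M) \<Longrightarrow> nc_monomial x w \<in> M"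
  by (induction w) auto

lemma adj_monomial:
  assumes "\<And>j. x j \<in> M" and "\<And>j. selfadjoint (x j)"
  shows "adj (nc_monomial x w) = nc_monomial x (rev w)"
proof (induction w)
  case (Cons j w)
  have "adj (x j) = x j"
    using assms(2)[of j] by (auto simp: selfadjoint_def intro: adj_eq)
  then show ?case
    using Cons by (simp add: adj_compose assms monomial_mem nc_monomial_append)
qed auto

lemma compose_scale_right: "A \<in> M \<Longrightarrow> A o\<^sub>L scale_op c B = scale_op c (A o\<^sub>L B)"
  by (simp add: blinfun_compose_scale_right clinear)

lemma tau_zero [simp]: "\<tau> 0 = 0"
  using tau_scale[OF id_mem, of 0] by simp

lemma tau_sum: "(\<And>i. i \<in> F \<Longrightarrow> f i \<in> M) \<Longrightarrow> \<tau> (\<Sum>i\<in>F. f i) = (\<Sum>i\<in>F. \<tau> (f i))"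
  by (induction F rule: infinite_finite_induct) (auto simp: tau_add)

lemma tau_diff: "A \<in> M \<Longrightarrow> B \<in> M \<Longrightarrow> \<tau> (A - B) = \<tau> A - \<tau> B"
  using tau_add[of A "- B"] tau_scale[of B "-1"] by (simp add: scale_op_minus_one)

lemma tau_scaleR: "A \<in> M \<Longrightarrow> \<tau> (r *\<^sub>R A) = of_real r * \<tau> A"
  using tau_scale[of A "of_real r"] by (simp add: scale_op_of_real)

text \<open>The inner product of \<open>L\<^sup>2(M, \<tau>)\<close>\<close>

definition ip :: "('h \<Rightarrow>\<^sub>L 'h) \<Rightarrow> ('h \<Rightarrow>\<^sub>L 'h) \<Rightarrow> complex" where
  "ip A B = \<tau> (adj A o\<^sub>L B)"

lemma ip_add_right: "A \<in> M \<Longrightarrow> B \<in> M \<Longrightarrow> C \<in> M \<Longrightarrow> ip A (B + C) = ip A B + ip A C"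
  by (simp add: ip_def blinfun_compose_add_right tau_add)

lemma ip_add_left: "A \<in> M \<Longrightarrow> B \<in> M \<Longrightarrow> C \<in> M \<Longrightarrow> ip (A + B) C = ip A C + ip B C"
  by (simp add: ip_def blinfun_compose_add_left tau_add adj_add)

lemma ip_diff_right: "A \<in> M \<Longrightarrow> B \<in> M \<Longrightarrow> C \<in> M \<Longrightarrow> ip A (B - C) = ip A B - ip A C"
  by (simp add: ip_def blinfun_compose_diff_right tau_diff)

lemma ip_diff_left: "A \<in> M \<Longrightarrow> B \<in> M \<Longrightarrow> C \<in> M \<Longrightarrow> ip (A - B) C = ip A C - ip B C"
  by (simp add: ip_def blinfun_compose_diff_left tau_diff adj_diff)

lemma ip_scale_right: "A \<in> M \<Longrightarrow> B \<in> M \<Longrightarrow> ip A (scale_op c B) = c * ip A B"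
  by (simp add: ip_def compose_scale_right tau_scale)

lemma ip_scale_left: "A \<in> M \<Longrightarrow> B \<in> M \<Longrightarrow> ip (scale_op c A) B = cnj c * ip A B"
  by (simp add: ip_def blinfun_compose_scale_left tau_scale adj_scale)

lemma ip_sum_right: "A \<in> M \<Longrightarrow> (\<And>i. i \<in> F \<Longrightarrow> f i \<in> M) \<Longrightarrow> ip A (\<Sum>i\<in>F. f i) = (\<Sum>i\<in>F. ip A (f i))"
proof (induction F rule: infinite_finite_induct)
  case (insert i F) then show ?case by (simp add: ip_add_right)
qed (auto simp: ip_def)

lemma ip_sum_left: "B \<in> M \<Longrightarrow> (\<And>i. i \<in> F \<Longrightarrow> f i \<in> M) \<Longrightarrow> ip (\<Sum>i\<in>F. f i) B = (\<Sum>i\<in>F. ip (f i) B)"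
proof (induction F rule: infinite_finite_induct)
  case (insert i F) then show ?case by (simp add: ip_add_left)
qed (use adj_scale[OF id_mem, of 0] in \<open>auto simp: ip_def\<close>)

lemma ip_self_ge0: "A \<in> M \<Longrightarrow> Im (ip A A) = 0 \<and> Re (ip A A) \<ge> 0"
  using tau_nonneg[of A] unfolding ip_def complex_nonneg_Reals_iff by auto

text \<open>
  Positivity forces the form to be hermitian: polarize with \<open>A + B\<close> and \<open>A + i B\<close>.
\<close>

lemma ip_commute:
  assumes "A \<in> M" "B \<in> M"
  shows "ip A B = cnj (ip B A)"
proof -
  have 1: "Im (ip A B + ip B A) = 0"
    using ip_self_ge0[of "A + B"] ip_self_ge0[of A] ip_self_ge0[of B] assms
    by (simp add: ip_add_left ip_add_right)
  have "Im (ip (A + scale_op \<i> B) (A + scale_op \<i> B)) = 0"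
    using ip_self_ge0[of "A + scale_op \<i> B"] assms by simp
  then have 2: "Re (ip A B) - Re (ip B A) = 0"
    using ip_self_ge0[of A] ip_self_ge0[of B] assms
    by (simp add: ip_add_left ip_add_right ip_scale_left ip_scale_right)
  show ?thesis
    using 1 2 by (simp add: complex_eq_iff)
qed

lemma norm2_eq: "norm2 \<tau> A = sqrt (Re (ip A A))"
  by (simp add: norm2_def ip_def)

lemma norm2_ge0: "A \<in> M \<Longrightarrow> norm2 \<tau> A \<ge> 0"
  using ip_self_ge0[of A] by (simp add: norm2_eq)

lemma norm2_sq: "A \<in> M \<Longrightarrow> (norm2 \<tau> A)\<^sup>2 = Re (ip A A)"
  using ip_self_ge0[of A] by (simp add: norm2_eq)

lemma ip_self: "A \<in> M \<Longrightarrow> ip A A = of_real ((norm2 \<tau> A)\<^sup>2)"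
  using ip_self_ge0[of A] by (simp add: norm2_sq complex_eq_iff)

lemma norm2_zero [simp]: "norm2 \<tau> 0 = 0"
  by (simp add: norm2_def)

lemma norm2_eq_0: "A \<in> M \<Longrightarrow> norm2 \<tau> A = 0 \<Longrightarrow> A = 0"
  using ip_self[of A] tau_faithful[of A] by (simp add: ip_def)

lemma norm2_id [simp]: "norm2 \<tau> id_blinfun = 1"
  by (simp add: norm2_def tau_one)

lemma norm2_scale: "A \<in> M \<Longrightarrow> norm2 \<tau> (scale_op c A) = cmod c * norm2 \<tau> A"
proof -
  assume A: "A \<in> M"
  have "ip (scale_op c A) (scale_op c A) = of_real ((cmod c)\<^sup>2) * ip A A"
    unfolding complex_norm_square using A by (simp add: ip_scale_left ip_scale_right)
  then have "Re (ip (scale_op c A) (scale_op c A)) = (cmod c)\<^sup>2 * Re (ip A A)"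
    by (metis Re_complex_of_real ip_self[OF A] of_real_mult)
  then show ?thesis
    by (simp add: norm2_eq real_sqrt_mult)
qed

lemma norm2_adj: "A \<in> M \<Longrightarrow> norm2 \<tau> (adj A) = norm2 \<tau> A"
  by (simp add: norm2_def tau_trace)

lemma ip_Cauchy_Schwarz:
  assumes A: "A \<in> M" and B: "B \<in> M"
  shows "cmod (ip A B) \<le> norm2 \<tau> A * norm2 \<tau> B"
proof (cases "norm2 \<tau> B = 0")
  case True
  then have "B = 0" using B norm2_eq_0 by auto
  then show ?thesis by (simp add: ip_def)
next
  case False
  define b where "b = (norm2 \<tau> B)\<^sup>2"
  define c where "c = ip A B"
  have b: "b > 0" using False by (simp add: b_def)
  have ipB: "ip B B = of_real b" using B by (simp add: ip_self b_def)
  \<comment> \<open>\<open>(c\<^sup>* / b) B\<close> is the component of \<open>A\<close> along \<open>B\<close>.\<close>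
  have "0 \<le> Re (ip (A - scale_op (cnj c / b) B) (A - scale_op (cnj c / b) B))"
    using ip_self_ge0 A B by simp
  also have "ip (A - scale_op (cnj c / b) B) (A - scale_op (cnj c / b) B)
      = ip A A - (cnj c / b) * c - (c / b) * cnj c + (c / b) * (cnj c / b) * b"
    using A B ip_commute[OF B A] ipB b
    by (simp add: ip_diff_left ip_diff_right ip_scale_left ip_scale_right algebra_simps
        flip: c_def)
  also have "\<dots> = ip A A - c * cnj c / b"
    using b by (simp add: field_simps)
  also have "\<dots> = of_real ((norm2 \<tau> A)\<^sup>2 - (cmod c)\<^sup>2 / b)"
    using A by (simp add: ip_self complex_norm_square flip: of_real_power)
  finally have "(cmod c)\<^sup>2 \<le> (norm2 \<tau> A)\<^sup>2 * b"
    using b by (simp add: field_simps)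
  then have "(cmod c)\<^sup>2 \<le> (norm2 \<tau> A * norm2 \<tau> B)\<^sup>2"
    by (simp add: b_def power_mult_distrib)
  then show ?thesis
    unfolding c_def using norm2_ge0[OF A] norm2_ge0[OF B] by - (rule power2_le_imp_le, auto)
qed

lemma tau_compose_le: "A \<in> M \<Longrightarrow> B \<in> M \<Longrightarrow> cmod (\<tau> (A o\<^sub>L B)) \<le> norm2 \<tau> A * norm2 \<tau> B"
  using ip_Cauchy_Schwarz[of "adj A" B] by (simp add: ip_def norm2_adj)

lemma tau_le_norm2: "A \<in> M \<Longrightarrow> cmod (\<tau> A) \<le> norm2 \<tau> A"
  using tau_compose_le[of id_blinfun A] by simp

lemma norm2_triangle:
  assumes A: "A \<in> M" and B: "B \<in> M"
  shows "norm2 \<tau> (A + B) \<le> norm2 \<tau> A + norm2 \<tau> B"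
proof -
  have "(norm2 \<tau> (A + B))\<^sup>2 = (norm2 \<tau> A)\<^sup>2 + (norm2 \<tau> B)\<^sup>2 + 2 * Re (ip A B)"
    using A B ip_commute[OF A B] by (simp add: norm2_sq ip_add_left ip_add_right)
  also have "\<dots> \<le> (norm2 \<tau> A)\<^sup>2 + (norm2 \<tau> B)\<^sup>2 + 2 * (norm2 \<tau> A * norm2 \<tau> B)"
    using ip_Cauchy_Schwarz[OF A B] complex_Re_le_cmod[of "ip A B"] by linarith
  also have "\<dots> = (norm2 \<tau> A + norm2 \<tau> B)\<^sup>2"
    by (simp add: power2_sum)
  finally show ?thesis
    using norm2_ge0[OF A] norm2_ge0[OF B] by - (rule power2_le_imp_le, auto)
qed

lemma norm2_uminus: "A \<in> M \<Longrightarrow> norm2 \<tau> (- A) = norm2 \<tau> A"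
  using norm2_scale[of A "-1"] by (simp add: scale_op_minus_one)

lemma norm2_diff_ge: "A \<in> M \<Longrightarrow> B \<in> M \<Longrightarrow> \<bar>norm2 \<tau> A - norm2 \<tau> B\<bar> \<le> norm2 \<tau> (A - B)"
  using norm2_triangle[of "A - B" B] norm2_triangle[of "B - A" A] norm2_uminus[of "A - B"] by simp

lemma norm2_sum_le:
  "(\<And>i. i \<in> F \<Longrightarrow> f i \<in> M) \<Longrightarrow> norm2 \<tau> (\<Sum>i\<in>F. f i) \<le> (\<Sum>i\<in>F. norm2 \<tau> (f i))"
proof (induction F rule: infinite_finite_induct)
  case (insert i F)
  then show ?case using norm2_triangle[of "f i" "\<Sum>i\<in>F. f i"] by simp
qed auto

text \<open>
  Normality applied to the directed set \<open>{B, A}\<close> with \<open>B \<le> A\<close> says that the trace is monotone for the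
  operator order; so it is a contraction, although positivity is postulated only on elements
  \<open>A\<^sup>* A\<close>.
\<close>

lemma tau_mono:
  assumes "A \<in> M" "B \<in> M" "selfadjoint A" "selfadjoint B" "op_le B A"
  shows "Re (\<tau> B) \<le> Re (\<tau> A)"
proof -
  have "Re (\<tau> A) = (SUP X\<in>{B, A}. Re (\<tau> X))"
  proof (rule tau_normal[unfolded normal_on_def, rule_format], intro conjI ballI allI impI)
    fix X Y assume "X \<in> {B, A}" "Y \<in> {B, A}"
    then show "\<exists>E\<in>{B, A}. op_le X E \<and> op_le Y E"
      using assms(5) by (auto simp: op_le_def)
  qed (use assms in \<open>auto simp: op_le_def\<close>)
  then show ?thesis
    by (metis cSUP_upper finite.emptyI finite.insertI finite_imageI bdd_above_finite insertI1)
qed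

lemma norm2_le_norm:
  assumes A: "A \<in> M"
  shows "norm2 \<tau> A \<le> norm A"
proof -
  have *: "Re (cinner v ((adj A o\<^sub>L A) v)) = (norm (A v))\<^sup>2" for v
    using is_adjoint_sym[OF adj_is_adjoint[OF A]] adj_is_adjoint[OF A]
    by (simp add: is_adjoint_def power2_norm_eq_inner flip: Re_cinner)
  have "Re (\<tau> (adj A o\<^sub>L A)) \<le> Re (\<tau> ((norm A)\<^sup>2 *\<^sub>R id_blinfun))"
  proof (rule tau_mono)
    show "selfadjoint (adj A o\<^sub>L A)"
      unfolding selfadjoint_def
      by (rule is_adjoint_compose[OF is_adjoint_sym[OF adj_is_adjoint[OF A]] adj_is_adjoint[OF A]])
    show "selfadjoint ((norm A)\<^sup>2 *\<^sub>R id_blinfun)"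
      using is_adjoint_scale[OF is_adjoint_id, of "complex_of_real ((norm A)\<^sup>2)"]
      unfolding selfadjoint_def by (simp only: scale_op_of_real complex_cnj_complex_of_real)
    show "op_le (adj A o\<^sub>L A) ((norm A)\<^sup>2 *\<^sub>R id_blinfun)"
      unfolding op_le_def *
      by (auto simp: Re_cinner blinfun.scaleR_left power2_norm_eq_inner[symmetric]
          power_mult_distrib[symmetric] norm_blinfun intro!: power_mono)
  qed (use A in auto)
  then show ?thesis
    by (simp add: norm2_def tau_scaleR tau_one real_le_lsqrt flip: of_real_power)
qed

text \<open>
  A bound for the norm of left multiplication on \<open>L\<^sup>2\<close>. It can be read off from the moments of a
  self-adjoint element (\<open>L2_bounded_moments\<close>), so that semicircular elements and images under a
  trace-preserving embedding are bounded without any spectral theory; and it behaves like the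
  operator norm in all estimates below.
\<close>

definition L2_bounded :: "('h \<Rightarrow>\<^sub>L 'h) \<Rightarrow> real \<Rightarrow> bool" where
  "L2_bounded A K \<longleftrightarrow> A \<in> M \<and> K \<ge> 0 \<and> (\<forall>V\<in>M. norm2 \<tau> (A o\<^sub>L V) \<le> K * norm2 \<tau> V)"

lemma L2_boundedD:
  assumes "L2_bounded A K"
  shows "A \<in> M" "K \<ge> 0" "V \<in> M \<Longrightarrow> norm2 \<tau> (A o\<^sub>L V) \<le> K * norm2 \<tau> V"
  using assms by (auto simp: L2_bounded_def)

lemma L2_bounded_id: "L2_bounded id_blinfun 1"
  by (auto simp: L2_bounded_def)

lemma L2_bounded_zero: "L2_bounded 0 0"
  by (auto simp: L2_bounded_def)

lemma L2_bounded_mono: "L2_bounded A K \<Longrightarrow> K \<le> L \<Longrightarrow> L2_bounded A L"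
  unfolding L2_bounded_def by (meson mult_right_mono norm2_ge0 order_trans)

lemma L2_bounded_compose:
  assumes "L2_bounded A K" "L2_bounded B L"
  shows "L2_bounded (A o\<^sub>L B) (K * L)"
  unfolding L2_bounded_def
proof (intro conjI ballI)
  fix V assume V: "V \<in> M"
  have "norm2 \<tau> (A o\<^sub>L (B o\<^sub>L V)) \<le> K * norm2 \<tau> (B o\<^sub>L V)"
    using assms V by (simp add: L2_bounded_def)
  also have "\<dots> \<le> K * (L * norm2 \<tau> V)"
    using assms V by (intro mult_left_mono) (auto simp: L2_bounded_def)
  finally show "norm2 \<tau> ((A o\<^sub>L B) o\<^sub>L V) \<le> K * L * norm2 \<tau> V"
    by (simp add: blinfun_compose_assoc mult.assoc)
qed (use assms in \<open>auto simp: L2_bounded_def\<close>)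

lemma L2_bounded_add:
  assumes "L2_bounded A K" "L2_bounded B L"
  shows "L2_bounded (A + B) (K + L)"
  unfolding L2_bounded_def
proof (intro conjI ballI)
  fix V assume V: "V \<in> M"
  show "norm2 \<tau> ((A + B) o\<^sub>L V) \<le> (K + L) * norm2 \<tau> V"
    using norm2_triangle[of "A o\<^sub>L V" "B o\<^sub>L V"] L2_boundedD[OF assms(1)] L2_boundedD[OF assms(2)] V
    by (fastforce simp: blinfun_compose_add_left distrib_right)
qed (use assms in \<open>auto simp: L2_bounded_def\<close>)

lemma L2_bounded_scaleR: "L2_bounded A K \<Longrightarrow> L2_bounded (r *\<^sub>R A) (\<bar>r\<bar> * K)"
  unfolding L2_bounded_def
  by (auto simp: norm2_scale blinfun_compose_scale_left scale_op_of_real[symmetric] mult.assoc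
      intro: mult_left_mono)

lemma L2_bounded_norm2: "L2_bounded A K \<Longrightarrow> norm2 \<tau> A \<le> K"
  using L2_boundedD(3)[of A K id_blinfun] by simp

lemma L2_bounded_tau: "L2_bounded A K \<Longrightarrow> cmod (\<tau> A) \<le> K"
  using L2_bounded_norm2 tau_le_norm2 L2_boundedD(1) order_trans by blast

text \<open>From \<open>\<parallel>A\<^sup>* V\<parallel>\<^sub>2\<^sup>2 = \<langle>V, A A\<^sup>* V\<rangle> \<le> K \<parallel>V\<parallel>\<^sub>2 \<parallel>A\<^sup>* V\<parallel>\<^sub>2\<close>\<close>

lemma L2_bounded_adj:
  assumes A: "L2_bounded A K" shows "L2_bounded (adj A) K"
  unfolding L2_bounded_def
proof (intro conjI ballI)
  fix V assume V: "V \<in> M"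
  have AM: "A \<in> M" using A by (rule L2_boundedD)
  let ?W = "adj A o\<^sub>L V"
  have "(norm2 \<tau> ?W)\<^sup>2 = Re (ip V (A o\<^sub>L ?W))"
    using V AM by (simp add: norm2_sq ip_def adj_compose blinfun_compose_assoc)
  also have "\<dots> \<le> norm2 \<tau> V * norm2 \<tau> (A o\<^sub>L ?W)"
    using ip_Cauchy_Schwarz[of V "A o\<^sub>L ?W"] complex_Re_le_cmod[of "ip V (A o\<^sub>L ?W)"] V AM by simp
  also have "\<dots> \<le> norm2 \<tau> V * (K * norm2 \<tau> ?W)"
    using L2_boundedD(3)[OF A, of ?W] V AM norm2_ge0 by (intro mult_left_mono) auto
  finally have *: "norm2 \<tau> ?W * norm2 \<tau> ?W \<le> (K * norm2 \<tau> V) * norm2 \<tau> ?W"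
    by (simp add: power2_eq_square ac_simps)
  show "norm2 \<tau> ?W \<le> K * norm2 \<tau> V"
  proof (cases "norm2 \<tau> ?W = 0")
    case True then show ?thesis using L2_boundedD(2)[OF A] norm2_ge0[OF V] by simp
  next
    case False
    then have "norm2 \<tau> ?W > 0" using norm2_ge0[of ?W] V AM by simp
    then show ?thesis using * by simp
  qed
qed (use A in \<open>auto simp: L2_bounded_def\<close>)

text \<open>Right multiplication is left multiplication by the adjoint, since the adjoint preserves \<open>\<parallel>\<cdot>\<parallel>\<^sub>2\<close>.\<close>

lemma L2_bounded_right:
  assumes A: "L2_bounded A K" and V: "V \<in> M"
  shows "norm2 \<tau> (V o\<^sub>L A) \<le> K * norm2 \<tau> V"
proof -
  have "norm2 \<tau> (V o\<^sub>L A) = norm2 \<tau> (adj A o\<^sub>L adj V)"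
    using norm2_adj[of "V o\<^sub>L A"] V L2_boundedD(1)[OF A] by (simp add: adj_compose)
  also have "\<dots> \<le> K * norm2 \<tau> V"
    using L2_boundedD(3)[OF L2_bounded_adj[OF A], of "adj V"] V by (simp add: norm2_adj)
  finally show ?thesis .
qed

lemma L2_bounded_monomial:
  assumes "\<And>j. L2_bounded (z j) K"
  shows "L2_bounded (nc_monomial z w) (K ^ length w)"
proof (induction w)
  case Nil then show ?case by (simp add: L2_bounded_id)
next
  case (Cons j w)
  show ?case using L2_bounded_compose[OF assms[of j] Cons] by simp
qed

text \<open>Telescoping: changing the factors of a word one at a time\<close>

lemma L2_bounded_monomial_diff:
  assumes z: "\<And>j. L2_bounded (z j) K" and x: "\<And>j. L2_bounded (x j) K"
    and d: "\<And>j. L2_bounded (z j - x j) d" and K: "K > 0"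
  shows "L2_bounded (nc_monomial z w - nc_monomial x w) (real (length w) * K ^ length w * (d / K))"
proof (induction w)
  case Nil then show ?case by (simp add: L2_bounded_zero)
next
  case (Cons j w)
  have "nc_monomial z (j # w) - nc_monomial x (j # w) =
     (z j o\<^sub>L (nc_monomial z w - nc_monomial x w)) + ((z j - x j) o\<^sub>L nc_monomial x w)"
    by (simp add: blinfun_compose_diff_left blinfun_compose_diff_right)
  moreover have "L2_bounded \<dots> (K * (real (length w) * K ^ length w * (d / K)) + d * K ^ length w)"
    by (intro L2_bounded_add L2_bounded_compose z d Cons L2_bounded_monomial x)
  moreover have "K * (real (length w) * K ^ length w * (d / K)) + d * K ^ length w =
     real (length (j # w)) * K ^ length (j # w) * (d / K)"
    using K by (simp add: field_simps)
  ultimately show ?case by simp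
qed

text \<open>
  Put \<open>f m = \<parallel>s\<^sup>m V\<parallel>\<^sub>2\<^sup>2\<close>. Then \<open>f m\<^sup>2 \<le> f 0 f (2m)\<close>, and \<open>f\<close> grows at most like \<open>K\<^sup>2\<^sup>m\<close> because
  of the moments: \<open>\<tau>(V V\<^sup>* s\<^sup>2\<^sup>m) \<le> \<parallel>V V\<^sup>*\<parallel>\<^sub>2 \<parallel>s\<^sup>2\<^sup>m\<parallel>\<^sub>2\<close>. Iterating along powers of two gives \<open>f 1 \<le> K\<^sup>2 f 0\<close>.
\<close>

lemma L2_bounded_moments:
  assumes s: "s \<in> M" "selfadjoint s" and K: "K > 0"
    and mom: "\<And>k. Re (\<tau> (op_prod (replicate (2 * k) s))) \<le> K ^ (2 * k)"
  shows "L2_bounded s K"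
  unfolding L2_bounded_def
proof (intro conjI ballI)
  fix V assume V: "V \<in> M"
  define S where "S m = op_prod (replicate m s)" for m
  have S_mem [simp]: "S m \<in> M" for m
    using s by (auto simp: S_def intro!: op_prod_mem)
  have S_add: "S m o\<^sub>L S n = S (m + n)" for m n
    by (simp add: S_def replicate_add op_prod_append)
  have S_adj: "adj (S m) = S m" for m
  proof (induction m)
    case (Suc m)
    have "adj s = s" using s by (auto simp: selfadjoint_def intro: adj_eq)
    moreover have "S (Suc m) = s o\<^sub>L S m" by (simp add: S_def)
    ultimately show ?case
      using Suc s S_add[of m 1] by (simp add: adj_compose) (simp add: S_def)
  qed (simp add: S_def)
  define f where "f m = (norm2 \<tau> (S m o\<^sub>L V))\<^sup>2" for m
  have f_eq: "f m = Re (ip V (S (2 * m) o\<^sub>L V))" for m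
    using V by (simp add: f_def norm2_sq ip_def adj_compose S_adj blinfun_compose_assoc mult_2 flip: S_add)
  have f0: "f 0 = (norm2 \<tau> V)\<^sup>2" by (simp add: f_def S_def)
  have f_ge0: "f m \<ge> 0" for m by (simp add: f_def)
  have conv: "(f m)\<^sup>2 \<le> f 0 * f (2 * m)" for m
  proof -
    have "f m \<le> norm2 \<tau> V * norm2 \<tau> (S (2 * m) o\<^sub>L V)"
      unfolding f_eq using ip_Cauchy_Schwarz[of V "S (2 * m) o\<^sub>L V"] complex_Re_le_cmod V
      by (meson S_mem compose_mem order_trans)
    then have "(f m)\<^sup>2 \<le> (norm2 \<tau> V * norm2 \<tau> (S (2 * m) o\<^sub>L V))\<^sup>2"
      using f_ge0 by (intro power_mono)
    then show ?thesis by (simp add: power_mult_distrib f0) (simp add: f_def)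
  qed
  define D where "D = norm2 \<tau> (V o\<^sub>L adj V)"
  have D0: "D \<ge> 0" using V by (simp add: D_def norm2_ge0)
  have growth: "f m \<le> D * K ^ (2 * m)" for m
  proof -
    have "(norm2 \<tau> (S (2 * m)))\<^sup>2 = Re (\<tau> (S (2 * (2 * m))))"
      by (simp add: norm2_sq ip_def S_adj S_add mult_2)
    also have "\<dots> \<le> (K ^ (2 * m))\<^sup>2"
      using mom[of "2 * m"] by (simp add: S_def power_mult[symmetric] mult.commute)
    finally have S2: "norm2 \<tau> (S (2 * m)) \<le> K ^ (2 * m)"
      using K by - (rule power2_le_imp_le, auto)
    have "ip V (S (2 * m) o\<^sub>L V) = \<tau> ((V o\<^sub>L adj V) o\<^sub>L S (2 * m))"
      using V tau_trace[of V "adj V o\<^sub>L S (2 * m)"] by (simp add: ip_def blinfun_compose_assoc)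
    also have "cmod \<dots> \<le> D * norm2 \<tau> (S (2 * m))"
      unfolding D_def using V by (intro tau_compose_le) auto
    also have "\<dots> \<le> D * K ^ (2 * m)"
      by (intro mult_left_mono S2 D0)
    finally show ?thesis
      unfolding f_eq using complex_Re_le_cmod order_trans by blast
  qed
  have iter: "f 1 ^ (2 ^ k) * f 0 \<le> f 0 ^ (2 ^ k) * f (2 ^ k)" for k
  proof (induction k)
    case (Suc k)
    have sq: "a ^ (2 ^ Suc k) = (a ^ (2 ^ k))\<^sup>2" for a :: real
      by (simp add: mult.commute flip: power_mult)
    have "f 0 * (f 1 ^ (2 ^ Suc k) * f 0) = (f 1 ^ (2 ^ k) * f 0)\<^sup>2"
      unfolding sq power2_eq_square by (simp add: ac_simps)
    also have "\<dots> \<le> (f 0 ^ (2 ^ k) * f (2 ^ k))\<^sup>2"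
      using Suc f_ge0 by (intro power_mono) auto
    also have "\<dots> = (f 0 ^ (2 ^ k))\<^sup>2 * (f (2 ^ k))\<^sup>2" by (simp add: power_mult_distrib)
    also have "\<dots> \<le> (f 0 ^ (2 ^ k))\<^sup>2 * (f 0 * f (2 * 2 ^ k))"
      by (intro mult_left_mono conv) auto
    also have "\<dots> = f 0 * (f 0 ^ (2 ^ Suc k) * f (2 ^ Suc k))"
      unfolding sq by (simp add: power2_eq_square ac_simps)
    finally have "f 0 = 0 \<or> ?case"
      using f_ge0[of 0] by (auto simp: mult_le_cancel_left)
    then show ?case using f_ge0 by auto
  qed simp
  have "f 1 \<le> K\<^sup>2 * f 0"
  proof (cases "f 0 = 0")
    case True
    then have "V = 0" using V norm2_eq_0[of V] by (simp add: f0)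
    then show ?thesis by (simp add: f_def)
  next
    case False
    then have f0': "f 0 > 0" using f_ge0[of 0] by simp
    define q where "q = f 1 / (K\<^sup>2 * f 0)"
    have bound: "q ^ (2 ^ k) \<le> D / f 0" for k
    proof -
      have "f 1 ^ (2 ^ k) * f 0 \<le> f 0 ^ (2 ^ k) * (D * K ^ (2 * 2 ^ k))"
        using iter[of k] growth[of "2 ^ k"] f0' by (meson mult_left_mono order_trans zero_le_power less_imp_le)
      then show ?thesis
        unfolding q_def using f0' K by (simp add: field_simps power_mult_distrib power_mult)
    qed
    have "q \<le> 1"
    proof (rule ccontr)
      assume "\<not> q \<le> 1"
      then obtain n where n: "D / f 0 < q ^ n" using real_arch_pow[of q] by auto
      have "q ^ n \<le> q ^ (2 ^ n)"
        using \<open>\<not> q \<le> 1\<close> by (intro power_increasing) (auto simp: less_imp_le)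
      then show False using n bound[of n] by simp
    qed
    then show ?thesis using K f0' by (simp add: q_def field_simps)
  qed
  then have "(norm2 \<tau> (s o\<^sub>L V))\<^sup>2 \<le> (K * norm2 \<tau> V)\<^sup>2"
    by (simp add: f0 power_mult_distrib) (simp add: f_def S_def)
  then show "norm2 \<tau> (s o\<^sub>L V) \<le> K * norm2 \<tau> V"
    using K norm2_ge0[OF V] by - (rule power2_le_imp_le, auto)
qed (use s K in auto)

end


section \<open>Semicircular elements\<close>

lemma semicircle_integrable:
  "(\<lambda>t::real. t ^ k * (sqrt (4 - t\<^sup>2) / (2 * pi))) integrable_on {-2..2}"
  by (intro integrable_continuous_real continuous_intros) auto

lemma semicircle_mean:
  "integral {-2..2} (\<lambda>t::real. t ^ 1 * (sqrt (4 - t\<^sup>2) / (2 * pi))) = 0" (is "?I = 0")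
proof -
  have "?I = integral {-2..2} (\<lambda>t::real. (-t) ^ 1 * (sqrt (4 - (-t)\<^sup>2) / (2 * pi)))"
    using Henstock_Kurzweil_Integration.integral_reflect_real[where a = "-2" and b = 2 and
        f = "\<lambda>t. t ^ 1 * (sqrt (4 - t\<^sup>2) / (2 * pi))"]
    unfolding minus_minus by (rule sym)
  also have "\<dots> = - ?I"
    unfolding power2_minus power_one_right mult_minus_left by (rule integral_neg)
  finally have "?I = - ?I" .
  then show ?thesis by linarith
qed

text \<open>\<open>(4 - 4t\<^sup>2) sqrt (4 - t\<^sup>2)\<close> is the derivative of \<open>t (4 - t\<^sup>2) sqrt (4 - t\<^sup>2)\<close>, which vanishes at \<open>-2\<close> and \<open>2\<close>.\<close>

lemma semicircle_variance:
  "integral {-2..2} (\<lambda>t::real. t ^ 2 * (sqrt (4 - t\<^sup>2) / (2 * pi))) =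
   integral {-2..2} (\<lambda>t::real. t ^ 0 * (sqrt (4 - t\<^sup>2) / (2 * pi)))" (is "?I2 = ?I0")
proof -
  define F where "F t = t * ((4 - t\<^sup>2) * sqrt (4 - t\<^sup>2)) / (8 * pi)" for t :: real
  define f where "f t = t ^ 0 * (sqrt (4 - t\<^sup>2) / (2 * pi)) - t ^ 2 * (sqrt (4 - t\<^sup>2) / (2 * pi))" for t :: real
  have "(f has_integral (F 2 - F (-2))) {-2..2}"
  proof (rule fundamental_theorem_of_calculus_interior)
    show "continuous_on {-2..2} F"
      unfolding F_def by (intro continuous_intros) auto
    fix t :: real assume t: "t \<in> {-2<..<2}"
    then have pos: "4 - t\<^sup>2 > 0"
      using abs_square_less_1[of "t/2"] by (auto simp: power2_eq_square field_simps abs_if split: if_splits)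
    define r where "r = sqrt (4 - t\<^sup>2)"
    have r: "r > 0" "r * r = 4 - t\<^sup>2"
      using pos by (auto simp: r_def)
    have "((\<lambda>t. t * ((4 - t\<^sup>2) * sqrt (4 - t\<^sup>2))) has_real_derivative
      1 * ((4 - t\<^sup>2) * r) + (- (2 * t) * r + (- (2 * t)) * (inverse r / 2) * (4 - t\<^sup>2)) * t) (at t)"
      unfolding r_def using pos by (auto intro!: derivative_eq_intros)
    moreover have "inverse r * (4 - t\<^sup>2) = r"
      using r by (metis left_inverse mult.assoc mult_1 less_irrefl)
    then have "1 * ((4 - t\<^sup>2) * r) + (- (2 * t) * r + (- (2 * t)) * (inverse r / 2) * (4 - t\<^sup>2)) * t
      = (4 - 4 * t\<^sup>2) * r"
      by (simp add: mult.assoc) (simp add: algebra_simps power2_eq_square)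
    ultimately have "(F has_real_derivative (4 - 4 * t\<^sup>2) * r / (8 * pi)) (at t)"
      unfolding F_def by (intro DERIV_cdivide) simp
    also have "(4 - 4 * t\<^sup>2) * r / (8 * pi) = f t"
      by (simp add: f_def left_diff_distrib diff_divide_distrib flip: r_def)
    finally show "(F has_vector_derivative f t) (at t)"
      by (simp add: has_real_derivative_iff_has_vector_derivative)
  qed auto
  then have "integral {-2..2} f = 0"
    by (intro integral_unique) (simp add: F_def)
  moreover have "integral {-2..2} f = ?I0 - ?I2"
    unfolding f_def by (intro integral_diff semicircle_integrable)
  ultimately show ?thesis by simp
qed

lemma semicircle_even_moment_le:
  "integral {-2..2} (\<lambda>t::real. t ^ (2 * k) * (sqrt (4 - t\<^sup>2) / (2 * pi)))
   \<le> 2 ^ (2 * k) * integral {-2..2} (\<lambda>t::real. t ^ 0 * (sqrt (4 - t\<^sup>2) / (2 * pi)))"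
proof -
  have "integral {-2..2} (\<lambda>t::real. t ^ (2 * k) * (sqrt (4 - t\<^sup>2) / (2 * pi)))
     \<le> integral {-2..2} (\<lambda>t::real. 2 ^ (2 * k) * (t ^ 0 * (sqrt (4 - t\<^sup>2) / (2 * pi))))"
  proof (rule integral_le[OF semicircle_integrable integrable_on_mult_right[OF semicircle_integrable]])
    fix t :: real assume t: "t \<in> {-2..2}"
    then have "\<bar>t\<bar> \<le> 2" by auto
    then have "\<bar>t\<bar> ^ (2 * k) \<le> 2 ^ (2 * k)" by (intro power_mono) auto
    then have "t ^ (2 * k) \<le> 2 ^ (2 * k)" by (simp add: power_even_abs)
    moreover have "t\<^sup>2 \<le> 4" using \<open>\<bar>t\<bar> \<le> 2\<close> abs_le_square_iff[of t 2] by simp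
    ultimately have "t ^ (2 * k) * (sqrt (4 - t\<^sup>2) / (2 * pi)) \<le> 2 ^ (2 * k) * (sqrt (4 - t\<^sup>2) / (2 * pi))"
      by (intro mult_right_mono) auto
    then show "t ^ (2 * k) * (sqrt (4 - t\<^sup>2) / (2 * pi)) \<le> 2 ^ (2 * k) * (t ^ 0 * (sqrt (4 - t\<^sup>2) / (2 * pi)))"
      by (simp only: power_0 mult_1)
  qed
  then show ?thesis by simp
qed

context tracial_von_neumann_algebra
begin

lemma adj_selfadjoint: "selfadjoint A \<Longrightarrow> adj A = A"
  by (auto simp: selfadjoint_def intro: adj_eq)

text \<open>
  The total mass of the density is never computed: it is \<open>\<tau>(1) = 1\<close>, and the other moments are
  compared with it.
\<close>

lemma semicircular_moments:
  assumes "standard_semicircular \<tau> s"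
  shows "\<tau> s = 0" and "\<tau> (s o\<^sub>L s) = 1" and "Re (\<tau> (op_prod (replicate (2 * k) s))) \<le> 2 ^ (2 * k)"
proof -
  let ?m = "\<lambda>k. integral {-2..2} (\<lambda>t::real. t ^ k * (sqrt (4 - t\<^sup>2) / (2 * pi)))"
  have m: "\<tau> (op_prod (replicate k s)) = of_real (?m k)" for k
    using assms unfolding standard_semicircular_def by blast
  have m0: "?m 0 = 1"
    using m[of 0] by (metis op_prod_Nil replicate_0 tau_one of_real_eq_1_iff)
  show "\<tau> s = 0" using m[of 1] semicircle_mean by simp
  show "\<tau> (s o\<^sub>L s) = 1"
    using m[of 2] unfolding semicircle_variance m0
    by (simp only: numeral_2_eq_2 replicate.simps op_prod_Nil op_prod_Cons blinfun_compose_id of_real_1)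
  have "Re (\<tau> (op_prod (replicate (2 * k) s))) = ?m (2 * k)"
    using m[of "2 * k"] by simp
  also have "\<dots> \<le> 2 ^ (2 * k) * ?m 0" by (rule semicircle_even_moment_le)
  finally show "Re (\<tau> (op_prod (replicate (2 * k) s))) \<le> 2 ^ (2 * k)"
    by (simp only: m0)
qed

lemma L2_bounded_semicircular:
  "s \<in> M \<Longrightarrow> standard_semicircular \<tau> s \<Longrightarrow> L2_bounded s 2"
  using semicircular_moments(3)[of s]
  by (intro L2_bounded_moments) (auto simp: standard_semicircular_def)

lemma norm2_semicircular: "s \<in> M \<Longrightarrow> standard_semicircular \<tau> s \<Longrightarrow> norm2 \<tau> s = 1"
  using semicircular_moments(2)[of s]
  by (simp add: norm2_def standard_semicircular_def adj_selfadjoint)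

lemma selfadjoint_perturb:
  assumes "\<And>j. selfadjoint (x j)" "\<And>j. selfadjoint (S j)"
  shows "selfadjoint (perturb x S t j)"
  using is_adjoint_add[of "x j" "x j" "sqrt t *\<^sub>R S j" "sqrt t *\<^sub>R S j"]
    is_adjoint_scale[of "S j" "S j" "of_real (sqrt t)"] assms
  by (simp add: selfadjoint_def perturb_def scale_op_of_real del: of_real_sqrt)

text \<open>Freeness makes \<open>x\<^sub>j\<close> orthogonal to the centred element \<open>S\<^sub>j\<close>, so the variances add up.\<close>

lemma norm2_perturb:
  assumes x: "\<And>j. x j \<in> M" "\<And>j. selfadjoint (x j)" and S: "free_semicirculars M \<tau> x S" and t: "t \<ge> 0"
  shows "(norm2 \<tau> (perturb x S t j))\<^sup>2 = (norm2 \<tau> (x j))\<^sup>2 + t"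
proof -
  have Sj: "S j \<in> M" "standard_semicircular \<tau> (S j)"
    using S by (auto simp: free_semicirculars_def)
  define c where "c = \<tau> (x j)"
  define A where "A = x j + scale_op (- c) id_blinfun"
  have "\<tau> (op_prod (map snd [(True, A), (False, S j)])) = 0"
  proof (rule S[unfolded free_semicirculars_def free_family_def, THEN conjunct2, THEN conjunct2, rule_format])
    have "A \<in> star_algebra (range x)"
      unfolding A_def by (intro star_algebra.intros) auto
    moreover have "\<tau> A = 0"
      using x tau_scale[of id_blinfun "- c"] by (simp add: A_def tau_add tau_one c_def)
    moreover have "S j \<in> star_algebra (range S)"
      by (intro star_algebra.intros) auto
    ultimately show "[(True, A), (False, S j)] \<noteq> [] \<and>
      successively (\<lambda>p q. fst p \<noteq> fst q) [(True, A), (False, S j)] \<and>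
      (\<forall>(i, A)\<in>set [(True, A), (False, S j)]. A \<in> star_algebra (if i then range x else range S) \<and> \<tau> A = 0)"
      using semicircular_moments(1)[OF Sj(2)] by auto
  qed
  then have "\<tau> (x j o\<^sub>L S j) = 0"
    using x Sj semicircular_moments(1)[OF Sj(2)]
    by (simp add: A_def blinfun_compose_add_left blinfun_compose_scale_left tau_add tau_scale)
  then have ip: "ip (x j) (S j) = 0"
    using x by (simp add: ip_def adj_selfadjoint)
  have "ip (S j) (S j) = 1"
    using ip_self[OF Sj(1)] norm2_semicircular[OF Sj] by simp
  then show ?thesis
    using x Sj ip ip_commute[OF x(1) Sj(1), of j] t
    unfolding perturb_def scale_op_of_real[symmetric]
    by (simp add: norm2_sq ip_add_left ip_add_right ip_scale_left ip_scale_right flip: of_real_mult)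
qed


section \<open>Conjugate variables\<close>

lemma L2_seqs_conv:
  assumes "\<xi> \<in> L2_seqs A \<tau>" "A \<subseteq> M"
  shows "(\<lambda>k. norm2 \<tau> (\<xi> k)) \<longlonglongrightarrow> L2_norm \<tau> \<xi>"
    and "a \<in> M \<Longrightarrow> (\<lambda>k. \<tau> (\<xi> k o\<^sub>L a)) \<longlonglongrightarrow> L2_trace \<tau> \<xi> a"
proof -
  have xi: "\<xi> k \<in> M" for k using assms unfolding L2_seqs_def by blast
  have cau: "\<exists>K. \<forall>k\<ge>K. \<forall>l\<ge>K. norm2 \<tau> (\<xi> k - \<xi> l) < e" if "e > 0" for e
    using assms that by (auto simp: L2_seqs_def)
  have "Cauchy (\<lambda>k. norm2 \<tau> (\<xi> k))"
  proof (rule CauchyI)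
    fix e :: real assume "e > 0"
    from cau[OF this] show "\<exists>K. \<forall>k\<ge>K. \<forall>l\<ge>K. norm (norm2 \<tau> (\<xi> k) - norm2 \<tau> (\<xi> l)) < e"
      using norm2_diff_ge[OF xi xi] by (metis real_norm_def order_le_less_trans)
  qed
  then show "(\<lambda>k. norm2 \<tau> (\<xi> k)) \<longlonglongrightarrow> L2_norm \<tau> \<xi>"
    unfolding L2_norm_def using Cauchy_convergent_iff convergent_LIMSEQ_iff by blast
  assume a: "a \<in> M"
  have "Cauchy (\<lambda>k. \<tau> (\<xi> k o\<^sub>L a))"
  proof (rule CauchyI)
    fix e :: real assume "e > 0"
    then have "e / (norm2 \<tau> a + 1) > 0" using norm2_ge0[OF a] by simp
    from cau[OF this] obtain K where K: "\<forall>k\<ge>K. \<forall>l\<ge>K. norm2 \<tau> (\<xi> k - \<xi> l) < e / (norm2 \<tau> a + 1)" by blast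
    have "norm (\<tau> (\<xi> k o\<^sub>L a) - \<tau> (\<xi> l o\<^sub>L a)) < e" if "k \<ge> K" "l \<ge> K" for k l
    proof -
      have "norm (\<tau> (\<xi> k o\<^sub>L a) - \<tau> (\<xi> l o\<^sub>L a)) = cmod (\<tau> ((\<xi> k - \<xi> l) o\<^sub>L a))"
        using xi a by (simp add: blinfun_compose_diff_left tau_diff)
      also have "\<dots> \<le> norm2 \<tau> (\<xi> k - \<xi> l) * norm2 \<tau> a"
        using xi a by (intro tau_compose_le) auto
      also have "\<dots> \<le> norm2 \<tau> (\<xi> k - \<xi> l) * (norm2 \<tau> a + 1)"
        using xi by (intro mult_left_mono) (auto simp: norm2_ge0)
      also have "\<dots> < e"
        using K that norm2_ge0[OF a] by (simp add: pos_less_divide_eq)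
      finally show ?thesis .
    qed
    then show "\<exists>K. \<forall>k\<ge>K. \<forall>l\<ge>K. norm (\<tau> (\<xi> k o\<^sub>L a) - \<tau> (\<xi> l o\<^sub>L a)) < e" by blast
  qed
  then show "(\<lambda>k. \<tau> (\<xi> k o\<^sub>L a)) \<longlonglongrightarrow> L2_trace \<tau> \<xi> a"
    unfolding L2_trace_def using Cauchy_convergent_iff convergent_LIMSEQ_iff by blast
qed

lemma L2_trace_le:
  assumes "\<xi> \<in> L2_seqs A \<tau>" "A \<subseteq> M" "a \<in> M"
  shows "cmod (L2_trace \<tau> \<xi> a) \<le> L2_norm \<tau> \<xi> * norm2 \<tau> a"
proof (rule LIMSEQ_le)
  have xi: "\<xi> k \<in> M" for k using assms unfolding L2_seqs_def by blast
  show "(\<lambda>k. cmod (\<tau> (\<xi> k o\<^sub>L a))) \<longlonglongrightarrow> cmod (L2_trace \<tau> \<xi> a)"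
    by (intro tendsto_norm L2_seqs_conv[OF assms(1,2)] assms)
  show "(\<lambda>k. norm2 \<tau> (\<xi> k) * norm2 \<tau> a) \<longlonglongrightarrow> L2_norm \<tau> \<xi> * norm2 \<tau> a"
    by (intro tendsto_mult tendsto_const L2_seqs_conv[OF assms(1,2)])
  show "\<exists>N. \<forall>n\<ge>N. cmod (\<tau> (\<xi> n o\<^sub>L a)) \<le> norm2 \<tau> (\<xi> n) * norm2 \<tau> a"
    using tau_compose_le[OF xi assms(3)] by auto
qed

lemma L2_trace_sum:
  assumes "\<xi> \<in> L2_seqs A \<tau>" "A \<subseteq> M" "\<And>w. w \<in> F \<Longrightarrow> f w \<in> M"
  shows "L2_trace \<tau> \<xi> (\<Sum>w\<in>F. scale_op (c w) (f w)) = (\<Sum>w\<in>F. c w * L2_trace \<tau> \<xi> (f w))"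
proof -
  have xi: "\<xi> k \<in> M" for k using assms unfolding L2_seqs_def by blast
  have *: "\<tau> (\<xi> k o\<^sub>L (\<Sum>w\<in>F. scale_op (c w) (f w))) = (\<Sum>w\<in>F. c w * \<tau> (\<xi> k o\<^sub>L f w))" for k
    using ip_sum_right[of "adj (\<xi> k)" F "\<lambda>w. scale_op (c w) (f w)"] xi assms(3)
    by (simp add: ip_def compose_scale_right tau_scale)
  have "(\<lambda>k. \<tau> (\<xi> k o\<^sub>L (\<Sum>w\<in>F. scale_op (c w) (f w)))) \<longlonglongrightarrow> (\<Sum>w\<in>F. c w * L2_trace \<tau> \<xi> (f w))"
    unfolding * by (intro tendsto_sum tendsto_mult tendsto_const L2_seqs_conv[OF assms(1,2)] assms)
  moreover have "(\<lambda>k. \<tau> (\<xi> k o\<^sub>L (\<Sum>w\<in>F. scale_op (c w) (f w)))) \<longlonglongrightarrow> L2_trace \<tau> \<xi> (\<Sum>w\<in>F. scale_op (c w) (f w))"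
    using assms by (intro L2_seqs_conv[OF assms(1,2)]) auto
  ultimately show ?thesis using LIMSEQ_unique by blast
qed

lemma vn_generated_subset: "X \<subseteq> M \<Longrightarrow> vn_generated X \<subseteq> M"
  using vn_algebra by (auto simp: vn_generated_def)

end

text \<open>The index set of the terms of \<open>\<partial>\<^sub>j w\<close>\<close>

definition occurrences :: "'n \<Rightarrow> 'n list \<Rightarrow> nat set" where
  "occurrences j w = {k. k < length w \<and> w ! k = j}"

lemma finite_occurrences [simp]: "finite (occurrences j w)"
  by (simp add: occurrences_def)

lemma occurrences_split: "k \<in> occurrences j w \<Longrightarrow> take k w @ j # drop (Suc k) w = w"
  unfolding occurrences_def by (metis (mono_tags) id_take_nth_drop mem_Collect_eq)

lemma nc_eval_monomial:
  "nc_eval (\<lambda>v. if v = w then 1 else 0) z = nc_monomial z w"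
proof -
  have "nc_eval (\<lambda>v. if v = w then 1 else 0) z = (\<Sum>\<^sub>\<infinity>v\<in>{w}. scale_op 1 (nc_monomial z v))"
    unfolding nc_eval_def by (rule infsum_cong_neutral) auto
  then show ?thesis by simp
qed

lemma tensor_trace_deriv_monomial:
  "tensor_trace \<tau> z (nc_deriv j (\<lambda>v. if v = w then 1 else 0)) =
   (\<Sum>k\<in>occurrences j w. \<tau> (nc_monomial z (take k w)) * \<tau> (nc_monomial z (drop (Suc k) w)))"
proof -
  have S: "{p. case p of (u, v) \<Rightarrow> nc_deriv j (\<lambda>v. if v = w then 1 else (0::complex)) (u, v) \<noteq> 0} =
    (\<lambda>k. (take k w, drop (Suc k) w)) ` occurrences j w"
  proof (intro equalityI subsetI)
    fix p assume "p \<in> {p. case p of (u, v) \<Rightarrow> nc_deriv j (\<lambda>v. if v = w then 1 else (0::complex)) (u, v) \<noteq> 0}"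
    then obtain u v where "p = (u, v)" "w = u @ j # v"
      by (auto simp: nc_deriv_def split: if_splits)
    then show "p \<in> (\<lambda>k. (take k w, drop (Suc k) w)) ` occurrences j w"
      by (intro image_eqI[of _ _ "length u"]) (auto simp: occurrences_def)
  qed (auto simp: nc_deriv_def occurrences_split)
  have inj: "inj_on (\<lambda>k. (take k w, drop (Suc k) w)) (occurrences j w)"
  proof (rule inj_onI)
    fix k l assume "k \<in> occurrences j w" "l \<in> occurrences j w"
      "(take k w, drop (Suc k) w) = (take l w, drop (Suc l) w)"
    then have "k < length w" "l < length w" "length (take k w) = length (take l w)"
      by (auto simp: occurrences_def)
    then show "k = l" by simp
  qed
  have "tensor_trace \<tau> z (nc_deriv j (\<lambda>v. if v = w then 1 else 0)) =
    (\<Sum>(u, v)\<in>(\<lambda>k. (take k w, drop (Suc k) w)) ` occurrences j w.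
       nc_deriv j (\<lambda>v. if v = w then 1 else 0) (u, v) * (\<tau> (nc_monomial z u) * \<tau> (nc_monomial z v)))"
    unfolding tensor_trace_def S ..
  also have "\<dots> = (\<Sum>k\<in>occurrences j w. \<tau> (nc_monomial z (take k w)) * \<tau> (nc_monomial z (drop (Suc k) w)))"
    unfolding sum.reindex[OF inj]
    by (intro sum.cong) (auto simp: nc_deriv_def occurrences_split)
  finally show ?thesis .
qed

lemma conjugate_variable_monomial:
  assumes "conjugate_variable \<tau> z j \<xi>"
  shows "L2_trace \<tau> \<xi> (nc_monomial z w) =
    (\<Sum>k\<in>occurrences j w. \<tau> (nc_monomial z (take k w)) * \<tau> (nc_monomial z (drop (Suc k) w)))"
proof -
  have "(\<lambda>v. if v = w then 1 else 0) \<in> nc_polynomials"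
    by (auto simp: nc_polynomials_def)
  then show ?thesis
    using assms by (auto simp: conjugate_variable_def nc_eval_monomial tensor_trace_deriv_monomial)
qed

context tracial_von_neumann_algebra
begin

text \<open>The free Cramer-Rao inequality: test the conjugate variable against its own variable.\<close>

lemma conjugate_variable_norm_ge:
  assumes "conjugate_variable \<tau> z j \<xi>" "\<And>j. z j \<in> M"
  shows "1 \<le> L2_norm \<tau> \<xi> * norm2 \<tau> (z j)"
proof -
  have "occurrences j [j] = {0}" by (auto simp: occurrences_def)
  then have "L2_trace \<tau> \<xi> (z j) = 1"
    using conjugate_variable_monomial[OF assms(1), of "[j]"] by (simp add: tau_one)
  moreover have "cmod (L2_trace \<tau> \<xi> (z j)) \<le> L2_norm \<tau> \<xi> * norm2 \<tau> (z j)"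
    using assms vn_generated_subset[of "range z"]
    by (intro L2_trace_le) (auto simp: conjugate_variable_def)
  ultimately show ?thesis by simp
qed

text \<open>
  Under a perturbation of variance \<open>t\<close> the bound is \<open>n / (C + t)\<close>, which agrees with the term
  \<open>n / (1 + t)\<close> of the entropy integral up to an integrable error.
\<close>

lemma Phi_star_ge:
  fixes z :: "'n::finite \<Rightarrow> ('h \<Rightarrow>\<^sub>L 'h)"
  assumes z: "\<And>j. z j \<in> M" and B: "\<And>j. (norm2 \<tau> (z j))\<^sup>2 \<le> B"
  shows "ereal (real CARD('n) / B) \<le> Phi_star \<tau> z"
proof (cases "\<forall>j. \<exists>\<xi>. conjugate_variable \<tau> z j \<xi>")
  case True
  have "1 / B \<le> (L2_norm \<tau> (SOME \<xi>. conjugate_variable \<tau> z j \<xi>))\<^sup>2" for j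
  proof -
    define l where "l = L2_norm \<tau> (SOME \<xi>. conjugate_variable \<tau> z j \<xi>)"
    have "conjugate_variable \<tau> z j (SOME \<xi>. conjugate_variable \<tau> z j \<xi>)"
      by (rule someI_ex[OF True[rule_format]])
    from conjugate_variable_norm_ge[OF this z] have 1: "1 \<le> l * norm2 \<tau> (z j)"
      by (simp add: l_def)
    then have "1 \<le> (l * norm2 \<tau> (z j))\<^sup>2" using power_mono[OF 1, of 2] by simp
    also have "\<dots> \<le> l\<^sup>2 * B"
      using B[of j] by (simp add: power_mult_distrib mult_left_mono)
    finally have *: "1 \<le> l\<^sup>2 * B" .
    have "B > 0"
      using * B[of j] by (metis mult_zero_right less_eq_real_def not_one_le_zero order_trans zero_le_power2)
    then show ?thesis using * by (simp add: field_simps l_def)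
  qed
  then have "(\<Sum>j\<in>(UNIV::'n set). 1 / B) \<le> (\<Sum>j\<in>UNIV. (L2_norm \<tau> (SOME \<xi>. conjugate_variable \<tau> z j \<xi>))\<^sup>2)"
    by (intro sum_mono)
  then show ?thesis using True by (simp add: Phi_star_def)
next
  case False
  then show ?thesis unfolding Phi_star_def if_not_P[OF False] by simp
qed

lemma Phi_star_less_conjugate_variable:
  assumes "Phi_star \<tau> z < ereal c"
  obtains \<xi> where "\<And>j. conjugate_variable \<tau> z j (\<xi> j)" "\<And>j. (L2_norm \<tau> (\<xi> j))\<^sup>2 < c"
proof
  have ex: "\<forall>j. \<exists>\<xi>. conjugate_variable \<tau> z j \<xi>"
    using assms by (auto simp: Phi_star_def split: if_splits)
  let ?xi = "\<lambda>j. SOME \<xi>. conjugate_variable \<tau> z j \<xi>"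
  show "conjugate_variable \<tau> z j (?xi j)" for j
    by (rule someI_ex[OF ex[rule_format]])
  have "(\<Sum>j\<in>UNIV. (L2_norm \<tau> (?xi j))\<^sup>2) < c"
    using assms ex by (simp add: Phi_star_def)
  moreover have "(L2_norm \<tau> (?xi j))\<^sup>2 \<le> (\<Sum>j\<in>UNIV. (L2_norm \<tau> (?xi j))\<^sup>2)" for j
    by (intro member_le_sum) auto
  ultimately show "(L2_norm \<tau> (?xi j))\<^sup>2 < c" for j
    using order_le_less_trans by blast
qed

end


section \<open>Small Fisher information from full entropy dimension\<close>

text \<open>
  The positive part of the integrand is controlled for all \<open>t\<close> by the Cramer-Rao bound \<open>n / (C + t)\<close>,
  with an integral independent of \<open>\<epsilon>\<close>. For \<open>t \<le> t0\<close> the information dominates the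
  term \<open>n / (1 + t)\<close>, and half of the lower bound \<open>c / (\<epsilon> + t)\<close> remains in the negative part;
  its integral is logarithmic. As \<open>\<Phi>\<close> is not known to be measurable, the integrals are compared by
  monotonicity and never split.
\<close>

lemma entropy_integral_le:
  fixes \<Phi> :: "real \<Rightarrow> ereal"
  assumes C: "C \<ge> 1" and n: "n \<ge> 0" and c: "c > 0" and \<epsilon>: "\<epsilon> > 0" and t0: "t0 > 0"
    and small: "n * (\<epsilon> + t0) \<le> c / 2"
    and cr: "\<And>t. t > 0 \<Longrightarrow> ereal (n / (C + t)) \<le> \<Phi> t"
    and low: "\<And>t. 0 < t \<Longrightarrow> t \<le> t0 \<Longrightarrow> ereal (c / (\<epsilon> + t)) \<le> \<Phi> t"
  shows "ereal_integral_pos (\<lambda>t. ereal (n / (1 + t)) - \<Phi> t) \<le>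
    ereal (n * (C - 1) - c / 2 * ln ((\<epsilon> + t0) / \<epsilon>))"
proof -
  let ?f = "\<lambda>t. ereal (n / (1 + t)) - \<Phi> t"
  have "(\<integral>\<^sup>+t\<in>{0<..}. e2ennreal (?f t) \<partial>lborel) \<le>
    (\<integral>\<^sup>+t\<in>{0..}. ennreal (n * (C - 1) / (1 + t)\<^sup>2) \<partial>lborel)"
  proof (intro nn_integral_mono)
    fix t :: real
    show "e2ennreal (?f t) * indicator {0<..} t \<le> ennreal (n * (C - 1) / (1 + t)\<^sup>2) * indicator {0..} t"
    proof (cases "t > 0")
      case True
      have "?f t \<le> ereal (n / (1 + t)) - ereal (n / (C + t))"
        using cr[OF True] by (intro ereal_minus_mono) auto
      also have "\<dots> = ereal (n * (C - 1) / ((1 + t) * (C + t)))"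
        using True C by (simp add: field_simps)
      also have "\<dots> \<le> ereal (n * (C - 1) / (1 + t)\<^sup>2)"
        unfolding ereal_less_eq power2_eq_square
        using True C n by (intro divide_left_mono mult_left_mono mult_pos_pos mult_nonneg_nonneg) auto
      finally have "e2ennreal (?f t) \<le> e2ennreal (ereal (n * (C - 1) / (1 + t)\<^sup>2))"
        by (rule e2ennreal_mono)
      then show ?thesis using True by (simp add: ennreal_def)
    qed auto
  qed
  also have "\<dots> = ennreal (0 - (- (n * (C - 1)) / (1 + 0)))"
  proof (rule nn_integral_FTC_atLeast)
    show "((\<lambda>t. - (n * (C - 1)) / (1 + t)) \<longlongrightarrow> 0) at_top"
      by (intro tendsto_divide_0[OF tendsto_const] filterlim_at_top_imp_at_infinity
          filterlim_tendsto_add_at_top[OF tendsto_const] filterlim_ident)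
    fix t :: real assume "0 \<le> t"
    then show "((\<lambda>t. - (n * (C - 1)) / (1 + t)) has_real_derivative n * (C - 1) / (1 + t)\<^sup>2) (at t)"
      by (auto intro!: derivative_eq_intros simp: power2_eq_square)
  qed (use n C in \<open>auto intro!: divide_nonneg_nonneg mult_nonneg_nonneg\<close>)
  finally have pos: "enn2ereal (\<integral>\<^sup>+t\<in>{0<..}. e2ennreal (?f t) \<partial>lborel) \<le> ereal (n * (C - 1))"
    using n C by (simp add: less_eq_ennreal.rep_eq)

  have "ennreal (c / 2 * ln (\<epsilon> + t0) - c / 2 * ln (\<epsilon> + 0)) =
    (\<integral>\<^sup>+t\<in>{0..t0}. ennreal (c / 2 * (1 / (\<epsilon> + t))) \<partial>lborel)"
  proof (rule nn_integral_FTC_Icc[where F = "\<lambda>t. c / 2 * ln (\<epsilon> + t)" and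
        f = "\<lambda>t. c / 2 * (1 / (\<epsilon> + t))", symmetric])
    fix t :: real assume "t \<in> {0..t0}"
    then show "((\<lambda>t. c / 2 * ln (\<epsilon> + t)) has_real_derivative c / 2 * (1 / (\<epsilon> + t))) (at t)"
      using \<epsilon> by (auto intro!: derivative_eq_intros simp: divide_simps)
  qed (use c \<epsilon> t0 in \<open>auto\<close>)
  also have "\<dots> \<le> (\<integral>\<^sup>+t\<in>{0<..}. e2ennreal (- ?f t) \<partial>lborel)"
  proof (rule nn_integral_mono_AE)
    have "AE t in lborel. t \<noteq> (0::real)" by (rule AE_lborel_singleton)
    then show "AE t in lborel. ennreal (c / 2 * (1 / (\<epsilon> + t))) * indicator {0..t0} t
        \<le> e2ennreal (- ?f t) * indicator {0<..} t"
    proof eventually_elim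
      fix t :: real assume "t \<noteq> 0"
      show "ennreal (c / 2 * (1 / (\<epsilon> + t))) * indicator {0..t0} t \<le> e2ennreal (- ?f t) * indicator {0<..} t"
      proof (cases "t \<in> {0..t0}")
        case True
        then have t: "0 < t" "t \<le> t0" using \<open>t \<noteq> 0\<close> by auto
        have "n * (\<epsilon> + t) \<le> c / 2"
          using small n t mult_left_mono[of "\<epsilon> + t" "\<epsilon> + t0" n] by simp
        then have "n \<le> c / 2 / (\<epsilon> + t)"
          using t \<epsilon> by (subst pos_le_divide_eq) auto
        moreover have "n / (1 + t) \<le> n"
          using n t divide_left_mono[of 1 "1 + t" n] by simp
        moreover have "c / (\<epsilon> + t) = c / 2 / (\<epsilon> + t) + c / 2 * (1 / (\<epsilon> + t))"
          by (metis add_divide_distrib field_sum_of_halves mult.right_neutral times_divide_eq_right)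
        ultimately have "ereal (c / 2 * (1 / (\<epsilon> + t))) \<le> ereal (c / (\<epsilon> + t)) - ereal (n / (1 + t))"
          by simp
        also have "\<dots> \<le> \<Phi> t - ereal (n / (1 + t))"
          using low[OF t] by (intro ereal_minus_mono) auto
        also have "\<dots> = - ?f t"
          by (cases "\<Phi> t") auto
        finally have "e2ennreal (ereal (c / 2 * (1 / (\<epsilon> + t)))) \<le> e2ennreal (- ?f t)"
          by (rule e2ennreal_mono)
        then show ?thesis using t by (simp add: ennreal_def)
      qed auto
    qed
  qed
  finally have neg: "ereal (c / 2 * ln ((\<epsilon> + t0) / \<epsilon>)) \<le> enn2ereal (\<integral>\<^sup>+t\<in>{0<..}. e2ennreal (- ?f t) \<partial>lborel)"
  proof -
    assume *: "ennreal (c / 2 * ln (\<epsilon> + t0) - c / 2 * ln (\<epsilon> + 0)) \<le> (\<integral>\<^sup>+t\<in>{0<..}. e2ennreal (- ?f t) \<partial>lborel)"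
    have "c / 2 * ln (\<epsilon> + t0) - c / 2 * ln (\<epsilon> + 0) = c / 2 * ln ((\<epsilon> + t0) / \<epsilon>)"
      using \<epsilon> t0 by (simp add: ln_div algebra_simps)
    moreover have "c / 2 * ln ((\<epsilon> + t0) / \<epsilon>) \<ge> 0"
      using c \<epsilon> t0 by (intro mult_nonneg_nonneg ln_ge_zero) auto
    ultimately show ?thesis
      using *[unfolded less_eq_ennreal.rep_eq] by (simp only: enn2ereal_ennreal)
  qed
  have "ereal_integral_pos ?f \<le> ereal (n * (C - 1)) - ereal (c / 2 * ln ((\<epsilon> + t0) / \<epsilon>))"
    unfolding ereal_integral_pos_def by (rule ereal_minus_mono[OF pos neg])
  then show ?thesis by simp
qed

text \<open>
  Abstractly, \<open>\<Phi> \<epsilon> t\<close> is the Fisher information after perturbations of total variance \<open>\<epsilon> + t\<close>.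
  If \<open>(\<epsilon> + t) \<Phi> \<epsilon> t\<close> stayed above some \<open>c > 0\<close> for small \<open>\<epsilon>\<close> and \<open>t\<close>, the entropy
  would be at most \<open>(c / 4) ln \<epsilon>\<close> up to a constant. Its quotient by \<open>ln (sqrt \<epsilon>)\<close> would have
  limes inferior at least \<open>c / 4\<close>, and the entropy dimension would be at most \<open>n - c / 4\<close>.
\<close>

lemma full_dimension_small_information:
  fixes \<Phi> :: "real \<Rightarrow> real \<Rightarrow> ereal"
  assumes C: "C \<ge> 1" and n: "n \<ge> 0"
    and cr: "\<And>\<epsilon> t. 0 < \<epsilon> \<Longrightarrow> \<epsilon> < 1 \<Longrightarrow> t > 0 \<Longrightarrow> ereal (n / (C + t)) \<le> \<Phi> \<epsilon> t"
    and dim: "ereal n - Liminf (at_right 0) (\<lambda>\<epsilon>.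
      (ereal (1 / 2) * ereal_integral_pos (\<lambda>t. ereal (n / (1 + t)) - \<Phi> \<epsilon> t) + ereal \<kappa>) / ereal (ln (sqrt \<epsilon>))) = ereal n"
    and c: "c > 0" and e0: "e0 > 0"
  obtains \<epsilon> t where "0 < \<epsilon>" "\<epsilon> < e0" "0 < t" "t < e0" "\<Phi> \<epsilon> t < ereal (c / (\<epsilon> + t))"
proof (rule ccontr)
  assume "\<not> thesis"
  note witness = that
  have low: "ereal (c / (\<epsilon> + t)) \<le> \<Phi> \<epsilon> t" if "0 < \<epsilon>" "\<epsilon> < e0" "0 < t" "t < e0" for \<epsilon> t
    using that witness[of \<epsilon> t] \<open>\<not> thesis\<close> by (meson not_less)
  \<comment> \<open>so small that \<open>n \<le> c / (2 (\<epsilon> + t))\<close> for \<open>\<epsilon>, t \<le> t0\<close>\<close>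
  define t0 where "t0 = min (e0 / 2) (c / (4 * (n + 1)))"
  have t0: "t0 > 0" "t0 < e0" using e0 c n by (auto simp: t0_def)
  have nt0: "n * (2 * t0) \<le> c / 2"
  proof -
    have "n * (2 * t0) \<le> (n + 1) * (2 * (c / (4 * (n + 1))))"
      using n c e0 by (intro mult_mono) (auto simp: t0_def)
    also have "\<dots> = c / 2" using n by (simp add: field_simps)
    finally show ?thesis .
  qed
  define B where "B = n * (C - 1) / 2 - c / 4 * ln t0 + \<kappa>"
  let ?chi = "\<lambda>\<epsilon>. ereal (1 / 2) * ereal_integral_pos (\<lambda>t. ereal (n / (1 + t)) - \<Phi> \<epsilon> t) + ereal \<kappa>"
  have chi_le: "?chi \<epsilon> \<le> ereal (B + c / 4 * ln \<epsilon>)" if \<epsilon>: "0 < \<epsilon>" "\<epsilon> < t0" "\<epsilon> < 1" for \<epsilon>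
  proof -
    have "ereal_integral_pos (\<lambda>t. ereal (n / (1 + t)) - \<Phi> \<epsilon> t) \<le>
      ereal (n * (C - 1) - c / 2 * ln ((\<epsilon> + t0) / \<epsilon>))"
    proof (rule entropy_integral_le)
      show "n * (\<epsilon> + t0) \<le> c / 2"
        using nt0 \<epsilon> n mult_left_mono[of "\<epsilon> + t0" "2 * t0" n] by simp
    qed (use C n c \<epsilon> t0 cr low in auto)
    also have "\<dots> \<le> ereal (n * (C - 1) - c / 2 * (ln t0 - ln \<epsilon>))"
      using \<epsilon> t0 c by (simp add: ln_div)
    finally have "?chi \<epsilon> \<le> ereal (1 / 2) * ereal (n * (C - 1) - c / 2 * (ln t0 - ln \<epsilon>)) + ereal \<kappa>"
      by (intro add_right_mono ereal_mult_left_mono) auto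
    also have "\<dots> = ereal (B + c / 4 * ln \<epsilon>)"
      by (simp add: B_def field_simps)
    finally show ?thesis .
  qed
  have "((\<lambda>\<epsilon>. 2 * B / ln \<epsilon>) \<longlongrightarrow> 0) (at_right 0)"
    by (intro tendsto_divide_0[OF tendsto_const] filterlim_at_bot_imp_at_infinity ln_at_0)
  then have "eventually (\<lambda>\<epsilon>. 2 * B / ln \<epsilon> > - (c / 4)) (at_right 0)"
    by (rule order_tendstoD) (use c in auto)
  moreover have "eventually (\<lambda>\<epsilon>::real. \<epsilon> \<in> {0<..<min t0 1}) (at_right 0)"
    using t0 by (intro eventually_at_right_real) auto
  ultimately have "eventually (\<lambda>\<epsilon>. ereal (c / 4) \<le> ?chi \<epsilon> / ereal (ln (sqrt \<epsilon>))) (at_right 0)"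
  proof eventually_elim
    fix \<epsilon> :: real assume B: "2 * B / ln \<epsilon> > - (c / 4)" and "\<epsilon> \<in> {0<..<min t0 1}"
    then have \<epsilon>: "0 < \<epsilon>" "\<epsilon> < t0" "\<epsilon> < 1" by auto
    have L: "ln \<epsilon> < 0" "ln (sqrt \<epsilon>) = ln \<epsilon> / 2" using \<epsilon> by (auto simp: ln_sqrt)
    have main: "c / 4 \<le> v / (ln \<epsilon> / 2)" if "v \<le> B + c / 4 * ln \<epsilon>" for v
    proof -
      have "c / 4 \<le> 2 * B / ln \<epsilon> + c / 2" using B c by simp
      also have "\<dots> = (B + c / 4 * ln \<epsilon>) / (ln \<epsilon> / 2)" using L by (simp add: field_simps)
      also have "\<dots> \<le> v / (ln \<epsilon> / 2)"
        using that L by (intro divide_right_mono_neg) auto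
      finally show ?thesis .
    qed
    show "ereal (c / 4) \<le> ?chi \<epsilon> / ereal (ln (sqrt \<epsilon>))"
    proof (cases "?chi \<epsilon>")
      case (real v)
      then have "v \<le> B + c / 4 * ln \<epsilon>" using chi_le[OF \<epsilon>] by simp
      from main[OF this] show ?thesis
        unfolding real L(2) using L(1) by simp
    next
      case PInf
      then show ?thesis using chi_le[OF \<epsilon>] by simp
    next
      case MInf
      then show ?thesis using L by (simp add: divide_ereal_def)
    qed
  qed
  then have "ereal (c / 4) \<le> Liminf (at_right 0) (\<lambda>\<epsilon>. ?chi \<epsilon> / ereal (ln (sqrt \<epsilon>)))"
    by (rule Liminf_bounded)
  then show False
    using dim c by (cases "Liminf (at_right 0) (\<lambda>\<epsilon>. ?chi \<epsilon> / ereal (ln (sqrt \<epsilon>)))") auto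
qed

lemma delta_star_full_small_information:
  fixes x :: "'n::finite \<Rightarrow> ('h::chilbert_space \<Rightarrow>\<^sub>L 'h)"
  assumes M: "tracial_von_neumann_algebra M \<tau>"
    and x: "\<And>j. x j \<in> M" "\<And>j. selfadjoint (x j)"
    and bd: "\<And>j. tracial_von_neumann_algebra.L2_bounded M \<tau> (x j) r"
    and S: "free_semicirculars M \<tau> x S"
    and T: "\<And>\<epsilon>. \<epsilon> > 0 \<Longrightarrow> free_semicirculars M \<tau> (perturb x S \<epsilon>) (T \<epsilon>)"
    and dim: "delta_star \<tau> x S T = ereal (real CARD('n))"
    and c: "c > 0" and e0: "e0 > 0"
  obtains \<epsilon> t where "0 < \<epsilon>" "\<epsilon> < e0" "0 < t" "t < e0"
    "Phi_star \<tau> (perturb (perturb x S \<epsilon>) (T \<epsilon>) t) < ereal (c / (\<epsilon> + t))"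
proof -
  interpret tracial_von_neumann_algebra M \<tau> by (rule M)
  have Sj: "S j \<in> M" "standard_semicircular \<tau> (S j)" "selfadjoint (S j)" for j
    using S by (auto simp: free_semicirculars_def standard_semicircular_def)
  have Tj: "T \<epsilon> j \<in> M" "standard_semicircular \<tau> (T \<epsilon> j)" if "\<epsilon> > 0" for \<epsilon> j
    using T[OF that] by (auto simp: free_semicirculars_def)
  have r: "r \<ge> 0" using bd[of undefined] by (auto simp: L2_bounded_def)
  define C where "C = r\<^sup>2 + 1"
  have cr: "ereal (real CARD('n) / (C + t)) \<le> Phi_star \<tau> (perturb (perturb x S \<epsilon>) (T \<epsilon>) t)"
    if \<epsilon>: "0 < \<epsilon>" "\<epsilon> < 1" and t: "t > 0" for \<epsilon> t
  proof (rule Phi_star_ge)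
    have mem: "perturb x S \<epsilon> j \<in> M" for j
      using x Sj by (simp add: perturb_def)
    show "perturb (perturb x S \<epsilon>) (T \<epsilon>) t j \<in> M" for j
      unfolding perturb_def[of "perturb x S \<epsilon>"] using mem Tj[OF \<epsilon>(1)] by simp
    have "(norm2 \<tau> (perturb (perturb x S \<epsilon>) (T \<epsilon>) t j))\<^sup>2 = (norm2 \<tau> (x j))\<^sup>2 + \<epsilon> + t" for j
      using norm2_perturb[OF mem selfadjoint_perturb[OF x(2) Sj(3)] T[OF \<epsilon>(1)], of t j]
        norm2_perturb[OF x S, of \<epsilon> j] \<epsilon> t by simp
    moreover have "(norm2 \<tau> (x j))\<^sup>2 \<le> r\<^sup>2" for j
      using L2_bounded_norm2[OF bd] norm2_ge0[OF x(1)] by (intro power_mono)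
    ultimately show "(norm2 \<tau> (perturb (perturb x S \<epsilon>) (T \<epsilon>) t j))\<^sup>2 \<le> C + t" for j
      using \<epsilon> by (simp add: C_def add_mono)
  qed
  show ?thesis
    by (rule full_dimension_small_information[of C "real CARD('n)"
      "\<lambda>\<epsilon> t. Phi_star \<tau> (perturb (perturb x S \<epsilon>) (T \<epsilon>) t)", OF _ _ cr dim[unfolded delta_star_def chi_star_def] c e0])
      (auto simp: C_def intro: that)
qed


section \<open>Weighted summability of power series\<close>

lemma nc_analyticE:
  assumes "P \<in> nc_analytic K"
  obtains R where "R > K" "R > 0" "(\<lambda>w. cmod (P w) * R ^ length w) summable_on UNIV"
  using assms by (auto simp: nc_analytic_def nc_series_def)

lemma nc_analyticI:
  "R > K \<Longrightarrow> R > 0 \<Longrightarrow> (\<lambda>w. cmod (P w) * R ^ length w) summable_on UNIV \<Longrightarrow> P \<in> nc_analytic K"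
  by (auto simp: nc_analytic_def nc_series_def)

lemma nc_analytic_summable:
  assumes P: "P \<in> nc_analytic K" and K: "K \<ge> 0"
  shows "(\<lambda>w. cmod (P w) * K ^ length w) summable_on UNIV"
proof -
  obtain R where R: "R > K" "R > 0" "(\<lambda>w. cmod (P w) * R ^ length w) summable_on UNIV"
    using P by (rule nc_analyticE)
  show ?thesis
    by (rule summable_on_comparison_test[OF R(3)]) (use R K in \<open>auto intro!: mult_left_mono power_mono\<close>)
qed

text \<open>The Euler derivation \<open>X\<^sub>w \<mapsto> |w| X\<^sub>w\<close>\<close>

definition nc_euler :: "('n::finite list \<Rightarrow> complex) \<Rightarrow> ('n list \<Rightarrow> complex)" where
  "nc_euler P = (\<lambda>w. of_nat (length w) * P w)"

text \<open>The factor \<open>|w|\<close> is absorbed by a slightly smaller radius, still above \<open>K\<close>.\<close>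

lemma nc_analytic_euler:
  assumes P: "P \<in> nc_analytic K"
  shows "nc_euler P \<in> nc_analytic K"
proof -
  obtain R where R: "R > K" "R > 0" "(\<lambda>w. cmod (P w) * R ^ length w) summable_on UNIV"
    using P by (rule nc_analyticE)
  define r where "r = (max K 0 + R) / 2"
  have r: "r > K" "r > 0" "r < R" using R by (auto simp: r_def max_def)
  have "(\<lambda>n. of_nat n * (r / R) ^ n) \<longlonglongrightarrow> (0::real)"
    by (rule powser_times_n_limit_0) (use r R in auto)
  then have "Bseq (\<lambda>n. of_nat n * (r / R) ^ n)"
    by (simp add: convergent_imp_Bseq convergentI)
  then obtain B where B: "B > 0" "\<And>n. norm (real n * (r / R) ^ n) \<le> B"
    by (auto simp: Bseq_def)
  have n: "real n * r ^ n \<le> B * R ^ n" for n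
    using B(2)[of n] r R by (simp add: power_divide field_simps abs_mult)
  show ?thesis
  proof (rule nc_analyticI[OF r(1,2)], rule summable_on_comparison_test)
    show "(\<lambda>w. B * (cmod (P w) * R ^ length w)) summable_on UNIV"
      by (intro summable_on_cmult_right R)
    fix w :: "'a list"
    show "cmod (nc_euler P w) * r ^ length w \<le> B * (cmod (P w) * R ^ length w)"
      using mult_left_mono[OF n[of "length w"], of "cmod (P w)"]
      by (simp add: nc_euler_def norm_mult ac_simps)
  qed (use r in auto)
qed

lemma nc_analytic_weighted_summable:
  assumes "P \<in> nc_analytic K" "K \<ge> 0"
  shows "(\<lambda>w. cmod (P w) * real (length w) * K ^ length w) summable_on UNIV"
  using nc_analytic_summable[OF nc_analytic_euler[OF assms(1)] assms(2)]
  by (simp add: nc_euler_def norm_mult ac_simps)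

lemma nc_analytic_weighted_summable2:
  assumes "P \<in> nc_analytic K" "K \<ge> 0"
  shows "(\<lambda>w. cmod (P w) * real (length w) * real (length w) * K ^ length w) summable_on UNIV"
  using nc_analytic_weighted_summable[OF nc_analytic_euler[OF assms(1)] assms(2)]
  by (simp add: nc_euler_def norm_mult ac_simps)

lemma has_sum_partial_le:
  fixes f :: "'a \<Rightarrow> complex"
  assumes "(f has_sum s) UNIV" "(g has_sum G) UNIV" "\<And>x. cmod (f x) \<le> g x" "finite F"
  shows "cmod (s - sum f F) \<le> G - sum g F"
proof (rule norm_infsum_le)
  show "(f has_sum (s - sum f F)) (UNIV - F)"
    by (intro has_sum_Diff assms has_sum_finite) auto
  show "(g has_sum (G - sum g F)) (UNIV - F)"
    by (intro has_sum_Diff assms has_sum_finite) auto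
qed (use assms in auto)


section \<open>Differentiating a relation with conjugate variables\<close>

lemma sum_occurrences_append:
  fixes f :: "nat \<Rightarrow> 'b::comm_monoid_add"
  shows "(\<Sum>k\<in>occurrences j (u @ v). f k) =
    (\<Sum>k\<in>occurrences j u. f k) + (\<Sum>k\<in>occurrences j v. f (length u + k))"
proof -
  have "occurrences j (u @ v) = occurrences j u \<union> (+) (length u) ` occurrences j v"
  proof (intro equalityI subsetI)
    fix k assume k: "k \<in> occurrences j (u @ v)"
    show "k \<in> occurrences j u \<union> (+) (length u) ` occurrences j v"
    proof (cases "k < length u")
      case False
      then have "k = length u + (k - length u)" "k - length u \<in> occurrences j v"
        using k by (auto simp: occurrences_def nth_append)
      then show ?thesis by blast
    qed (use k in \<open>auto simp: occurrences_def nth_append\<close>)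
  qed (auto simp: occurrences_def nth_append)
  moreover have "occurrences j u \<inter> (+) (length u) ` occurrences j v = {}"
    by (auto simp: occurrences_def)
  ultimately show ?thesis
    by (simp add: sum.union_disjoint sum.reindex)
qed

lemma card_occurrences_le: "card (occurrences j w) \<le> length w"
  using card_mono[of "{..<length w}" "occurrences j w"] by (auto simp: occurrences_def)

context tracial_von_neumann_algebra
begin

text \<open>
  The part of \<open>(\<tau> \<otimes> \<tau>)(\<partial>\<^sub>j (X\<^sub>b X\<^sub>w X\<^sub>c))\<close> in which the derivation hits the middle word.
\<close>

definition split_trace :: "('n::finite \<Rightarrow> ('h \<Rightarrow>\<^sub>L 'h)) \<Rightarrow> 'n \<Rightarrow> 'n list \<Rightarrow> 'n list \<Rightarrow> 'n list \<Rightarrow> complex" where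
  "split_trace x j b w c = (\<Sum>k\<in>occurrences j w.
     \<tau> (nc_monomial x (b @ take k w)) * \<tau> (nc_monomial x (drop (Suc k) w @ c)))"

lemma norm2_sandwich:
  assumes z: "\<And>j. L2_bounded (z j) K" and Q: "Q \<in> M"
  shows "norm2 \<tau> (nc_monomial z u o\<^sub>L Q o\<^sub>L nc_monomial z v) \<le> K ^ (length u + length v) * norm2 \<tau> Q"
proof -
  have K: "K \<ge> 0" using z L2_boundedD(2) by blast
  have m: "nc_monomial z w \<in> M" for w using z L2_boundedD(1) by (blast intro: monomial_mem)
  have "norm2 \<tau> ((nc_monomial z u o\<^sub>L Q) o\<^sub>L nc_monomial z v) \<le> K ^ length v * norm2 \<tau> (nc_monomial z u o\<^sub>L Q)"
    using m Q by (intro L2_bounded_right L2_bounded_monomial z) auto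
  also have "\<dots> \<le> K ^ length v * (K ^ length u * norm2 \<tau> Q)"
    using K Q by (intro mult_left_mono L2_boundedD(3)[OF L2_bounded_monomial] z) auto
  finally show ?thesis by (simp add: power_add ac_simps)
qed

text \<open>
  The conjugate relation for \<open>X\<^sub>b Q X\<^sub>c\<close>. All terms of the Leibniz rule except the one with \<open>\<partial>\<^sub>j Q\<close>
  contain \<open>Q(z)\<close> undifferentiated, so they are small together with it.
\<close>

lemma conjugate_variable_bound:
  assumes cv: "conjugate_variable \<tau> z j \<xi>" and z: "\<And>j. L2_bounded (z j) K" and K: "K > 0" and F: "finite F"
  shows "cmod (\<Sum>w\<in>F. P w * split_trace z j b w c) \<le>
    (L2_norm \<tau> \<xi> + (length b + length c) / K) * K ^ (length b + length c) *
    norm2 \<tau> (\<Sum>w\<in>F. scale_op (P w) (nc_monomial z w))"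
proof -
  define Q where "Q = (\<Sum>w\<in>F. scale_op (P w) (nc_monomial z w))"
  have zM: "z j \<in> M" for j using z by (rule L2_boundedD)
  have m [simp]: "nc_monomial z w \<in> M" for w using zM by (blast intro: monomial_mem)
  have Q: "Q \<in> M" by (simp add: Q_def)
  have xi: "\<xi> \<in> L2_seqs (vn_generated (range z)) \<tau>" "vn_generated (range z) \<subseteq> M"
    using cv zM vn_generated_subset[of "range z"] by (auto simp: conjugate_variable_def)
  have nQ: "norm2 \<tau> Q \<ge> 0" using Q by (rule norm2_ge0)
  have sandwich: "nc_monomial z u o\<^sub>L Q o\<^sub>L nc_monomial z v =
      (\<Sum>w\<in>F. scale_op (P w) (nc_monomial z (u @ w @ v)))" for u v
    unfolding Q_def
    by (induction F rule: infinite_finite_induct)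
      (auto simp: blinfun_compose_add_left blinfun_compose_add_right compose_scale_right
        blinfun_compose_scale_left nc_monomial_append blinfun_compose_assoc intro!: blinfun_eqI)
  have tau_sandwich: "\<tau> (nc_monomial z u o\<^sub>L Q o\<^sub>L nc_monomial z v) = (\<Sum>w\<in>F. P w * \<tau> (nc_monomial z (u @ w @ v)))" for u v
    unfolding sandwich by (simp add: tau_sum tau_scale)
  have tau_le: "cmod (\<tau> (nc_monomial z u)) \<le> K ^ length u" for u
    by (intro L2_bounded_tau L2_bounded_monomial z)
  have tau_sandwich_le: "cmod (\<tau> (nc_monomial z u o\<^sub>L Q o\<^sub>L nc_monomial z v)) \<le> K ^ (length u + length v) * norm2 \<tau> Q" for u v
    using tau_le_norm2[of "nc_monomial z u o\<^sub>L Q o\<^sub>L nc_monomial z v"] norm2_sandwich[of z K Q u v, OF z Q] Q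
    by (meson compose_mem m order_trans)
  let ?N = "length b + length c"
  define left where "left = (\<Sum>k\<in>occurrences j b. \<tau> (nc_monomial z (take k b)) *
      \<tau> (nc_monomial z (drop (Suc k) b) o\<^sub>L Q o\<^sub>L nc_monomial z c))"
  define right where "right = (\<Sum>k\<in>occurrences j c.
      \<tau> (nc_monomial z b o\<^sub>L Q o\<^sub>L nc_monomial z (take k c)) * \<tau> (nc_monomial z (drop (Suc k) c)))"
  have pow: "K ^ n = K ^ Suc n / K" for n using K by simp
  have "cmod left \<le> real (card (occurrences j b)) * (K ^ ?N / K * norm2 \<tau> Q)"
    unfolding left_def
  proof (rule sum_norm_bound)
    fix k assume "k \<in> occurrences j b"
    then have k: "k < length b" by (simp add: occurrences_def)
    have "cmod (\<tau> (nc_monomial z (take k b)) * \<tau> (nc_monomial z (drop (Suc k) b) o\<^sub>L Q o\<^sub>L nc_monomial z c))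
      \<le> K ^ k * (K ^ (length b - Suc k + length c) * norm2 \<tau> Q)"
      unfolding norm_mult using tau_le[of "take k b"] tau_sandwich_le[of "drop (Suc k) b" c] k K
      by (intro mult_mono) auto
    also have "\<dots> = K ^ (k + (length b - Suc k + length c)) * norm2 \<tau> Q"
      by (simp add: power_add)
    also have "\<dots> = K ^ ?N / K * norm2 \<tau> Q"
    proof -
      have e: "Suc (k + (length b - Suc k + length c)) = ?N" using k by simp
      show ?thesis by (simp only: pow[of "k + (length b - Suc k + length c)"] e)
    qed
    finally show "cmod (\<tau> (nc_monomial z (take k b)) * \<tau> (nc_monomial z (drop (Suc k) b) o\<^sub>L Q o\<^sub>L nc_monomial z c))
      \<le> K ^ ?N / K * norm2 \<tau> Q" .
  qed
  also have "\<dots> \<le> real (length b) * (K ^ ?N / K * norm2 \<tau> Q)"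
    using card_occurrences_le K nQ by (intro mult_right_mono) auto
  finally have left: "cmod left \<le> real (length b) * (K ^ ?N / K * norm2 \<tau> Q)" .
  have "cmod right \<le> real (card (occurrences j c)) * (K ^ ?N / K * norm2 \<tau> Q)"
    unfolding right_def
  proof (rule sum_norm_bound)
    fix k assume "k \<in> occurrences j c"
    then have k: "k < length c" by (simp add: occurrences_def)
    have "cmod (\<tau> (nc_monomial z b o\<^sub>L Q o\<^sub>L nc_monomial z (take k c)) * \<tau> (nc_monomial z (drop (Suc k) c)))
      \<le> (K ^ (length b + k) * norm2 \<tau> Q) * K ^ (length c - Suc k)"
      unfolding norm_mult using tau_le[of "drop (Suc k) c"] tau_sandwich_le[of b "take k c"] k K nQ
      by (intro mult_mono) auto
    also have "\<dots> = K ^ (length b + k + (length c - Suc k)) * norm2 \<tau> Q"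
      by (simp add: power_add)
    also have "\<dots> = K ^ ?N / K * norm2 \<tau> Q"
    proof -
      have e: "Suc (length b + k + (length c - Suc k)) = ?N" using k by simp
      show ?thesis by (simp only: pow[of "length b + k + (length c - Suc k)"] e)
    qed
    finally show "cmod (\<tau> (nc_monomial z b o\<^sub>L Q o\<^sub>L nc_monomial z (take k c)) * \<tau> (nc_monomial z (drop (Suc k) c)))
      \<le> K ^ ?N / K * norm2 \<tau> Q" .
  qed
  also have "\<dots> \<le> real (length c) * (K ^ ?N / K * norm2 \<tau> Q)"
    using card_occurrences_le K nQ by (intro mult_right_mono) auto
  finally have right: "cmod right \<le> real (length c) * (K ^ ?N / K * norm2 \<tau> Q)" .

  have "L2_trace \<tau> \<xi> (nc_monomial z b o\<^sub>L Q o\<^sub>L nc_monomial z c) =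
      (\<Sum>w\<in>F. P w * L2_trace \<tau> \<xi> (nc_monomial z (b @ w @ c)))"
    unfolding sandwich by (rule L2_trace_sum[OF xi]) simp
  also have "\<dots> = (\<Sum>w\<in>F. P w * (\<Sum>k\<in>occurrences j b. \<tau> (nc_monomial z (take k b)) * \<tau> (nc_monomial z (drop (Suc k) b @ w @ c))))
      + (\<Sum>w\<in>F. P w * split_trace z j b w c)
      + (\<Sum>w\<in>F. P w * (\<Sum>k\<in>occurrences j c. \<tau> (nc_monomial z (b @ w @ take k c)) * \<tau> (nc_monomial z (drop (Suc k) c))))"
  proof -
    have "L2_trace \<tau> \<xi> (nc_monomial z (b @ w @ c)) =
      (\<Sum>k\<in>occurrences j b. \<tau> (nc_monomial z (take k b)) * \<tau> (nc_monomial z (drop (Suc k) b @ w @ c)))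
      + (split_trace z j b w c
      + (\<Sum>k\<in>occurrences j c. \<tau> (nc_monomial z (b @ w @ take k c)) * \<tau> (nc_monomial z (drop (Suc k) c))))" for w
      unfolding conjugate_variable_monomial[OF cv] sum_occurrences_append split_trace_def
      by (intro arg_cong2[of _ _ _ _ "(+)"] sum.cong) (auto simp: occurrences_def)
    then show ?thesis by (simp add: distrib_left sum.distrib)
  qed
  also have "(\<Sum>w\<in>F. P w * (\<Sum>k\<in>occurrences j b. \<tau> (nc_monomial z (take k b)) * \<tau> (nc_monomial z (drop (Suc k) b @ w @ c)))) = left"
    unfolding left_def tau_sandwich sum_distrib_left by (subst sum.swap) (simp add: ac_simps)
  also have "(\<Sum>w\<in>F. P w * (\<Sum>k\<in>occurrences j c. \<tau> (nc_monomial z (b @ w @ take k c)) * \<tau> (nc_monomial z (drop (Suc k) c)))) = right"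
    unfolding right_def tau_sandwich sum_distrib_left sum_distrib_right by (subst sum.swap) (simp add: ac_simps)
  finally have "(\<Sum>w\<in>F. P w * split_trace z j b w c) =
      L2_trace \<tau> \<xi> (nc_monomial z b o\<^sub>L Q o\<^sub>L nc_monomial z c) - left - right"
    by (simp add: algebra_simps)
  also have "cmod \<dots> \<le> cmod (L2_trace \<tau> \<xi> (nc_monomial z b o\<^sub>L Q o\<^sub>L nc_monomial z c)) + cmod left + cmod right"
    by (smt (verit) norm_triangle_ineq4)
  also have "cmod (L2_trace \<tau> \<xi> (nc_monomial z b o\<^sub>L Q o\<^sub>L nc_monomial z c)) \<le> L2_norm \<tau> \<xi> * (K ^ ?N * norm2 \<tau> Q)"
  proof -
    have "L2_norm \<tau> \<xi> \<ge> 0"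
      using conjugate_variable_norm_ge[OF cv zM] norm2_ge0[OF zM, of j]
      by (meson mult_nonpos_nonneg not_le order.trans zero_less_one order_less_le_trans less_imp_le)
    then show ?thesis
      using L2_trace_le[OF xi, of "nc_monomial z b o\<^sub>L Q o\<^sub>L nc_monomial z c"] norm2_sandwich[of z K Q b c, OF z Q] Q
      by (meson compose_mem m mult_left_mono order_trans)
  qed
  finally have "cmod (\<Sum>w\<in>F. P w * split_trace z j b w c) \<le> L2_norm \<tau> \<xi> * (K ^ ?N * norm2 \<tau> Q)
     + real (length b) * (K ^ ?N / K * norm2 \<tau> Q) + real (length c) * (K ^ ?N / K * norm2 \<tau> Q)"
    using left right by linarith
  also have "\<dots> = (L2_norm \<tau> \<xi> + (length b + length c) / K) * K ^ ?N * norm2 \<tau> Q"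
    by (simp add: algebra_simps add_divide_distrib)
  finally show ?thesis by (simp add: Q_def)
qed

lemma tau_monomial_diff:
  assumes "\<And>j. L2_bounded (z j) K" "\<And>j. L2_bounded (x j) K" "\<And>j. L2_bounded (z j - x j) d" "K > 0"
  shows "cmod (\<tau> (nc_monomial z w) - \<tau> (nc_monomial x w)) \<le> real (length w) * K ^ length w * (d / K)"
proof -
  have "nc_monomial z w \<in> M" "nc_monomial x w \<in> M"
    using assms L2_boundedD(1) by (blast intro: monomial_mem)+
  then show ?thesis
    using L2_bounded_tau[OF L2_bounded_monomial_diff[of z K x d w, OF assms]] by (simp add: tau_diff)
qed

lemma split_trace_diff:
  assumes z: "\<And>j. L2_bounded (z j) K" and x: "\<And>j. L2_bounded (x j) K"
    and d: "\<And>j. L2_bounded (z j - x j) d" and K: "K > 0"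
  shows "cmod (split_trace z j b w c - split_trace x j b w c) \<le>
    real (length w) * (real (length b + length c + length w) * K ^ (length b + length c + length w) * (d / K\<^sup>2))"
proof -
  let ?N = "length b + length c + length w"
  have d0: "d \<ge> 0" using d L2_boundedD(2) by blast
  have "cmod (split_trace z j b w c - split_trace x j b w c) \<le>
     real (card (occurrences j w)) * (real ?N * K ^ ?N * (d / K\<^sup>2))"
    unfolding split_trace_def sum_subtractf[symmetric]
  proof (rule sum_norm_bound)
    fix k assume "k \<in> occurrences j w"
    then have k: "k < length w" by (simp add: occurrences_def)
    define u where "u = b @ take k w"
    define v where "v = drop (Suc k) w @ c"
    have len: "Suc (length u + length v) = ?N"
      using k by (simp add: u_def v_def)
    have "cmod (\<tau> (nc_monomial z u) * \<tau> (nc_monomial z v) - \<tau> (nc_monomial x u) * \<tau> (nc_monomial x v))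
      = cmod ((\<tau> (nc_monomial z u) - \<tau> (nc_monomial x u)) * \<tau> (nc_monomial z v)
         + \<tau> (nc_monomial x u) * (\<tau> (nc_monomial z v) - \<tau> (nc_monomial x v)))"
      by (simp add: algebra_simps)
    also have "\<dots> \<le> (real (length u) * K ^ length u * (d / K)) * K ^ length v
        + K ^ length u * (real (length v) * K ^ length v * (d / K))"
      using K d0
      by (intro order_trans[OF norm_triangle_ineq] add_mono; unfold norm_mult;
          intro mult_mono tau_monomial_diff z x d K L2_bounded_tau L2_bounded_monomial) auto
    also have "\<dots> = real (length u + length v) * K ^ Suc (length u + length v) * (d / K\<^sup>2)"
      using K by (simp add: power_add power2_eq_square field_simps)
    also have "\<dots> \<le> real ?N * K ^ ?N * (d / K\<^sup>2)"
      unfolding len using len K d0 by (intro mult_right_mono) auto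
    finally show "cmod (\<tau> (nc_monomial z (b @ take k w)) * \<tau> (nc_monomial z (drop (Suc k) w @ c))
       - \<tau> (nc_monomial x (b @ take k w)) * \<tau> (nc_monomial x (drop (Suc k) w @ c))) \<le> real ?N * K ^ ?N * (d / K\<^sup>2)"
      by (simp add: u_def v_def)
  qed
  also have "\<dots> \<le> real (length w) * (real ?N * K ^ ?N * (d / K\<^sup>2))"
    using card_occurrences_le K d0 by (intro mult_right_mono) auto
  finally show ?thesis .
qed

lemma split_trace_le:
  assumes x: "\<And>j. L2_bounded (x j) K" and K: "K > 0"
  shows "cmod (split_trace x j b w c) \<le> real (length w) * (K ^ (length b + length c + length w) / K)"
proof -
  let ?N = "length b + length c + length w"
  have "cmod (split_trace x j b w c) \<le> real (card (occurrences j w)) * (K ^ ?N / K)"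
    unfolding split_trace_def
  proof (rule sum_norm_bound)
    fix k assume "k \<in> occurrences j w"
    then have k: "k < length w" by (simp add: occurrences_def)
    have "cmod (\<tau> (nc_monomial x (b @ take k w)) * \<tau> (nc_monomial x (drop (Suc k) w @ c)))
      \<le> K ^ length (b @ take k w) * K ^ length (drop (Suc k) w @ c)"
      unfolding norm_mult using K by (intro mult_mono L2_bounded_tau L2_bounded_monomial x) auto
    also have "\<dots> = K ^ (length (b @ take k w) + length (drop (Suc k) w @ c))"
      by (simp only: power_add)
    also have "\<dots> = K ^ Suc (length (b @ take k w) + length (drop (Suc k) w @ c)) / K"
      using K by simp
    also have "Suc (length (b @ take k w) + length (drop (Suc k) w @ c)) = ?N"
      using k by simp
    finally show "cmod (\<tau> (nc_monomial x (b @ take k w)) * \<tau> (nc_monomial x (drop (Suc k) w @ c))) \<le> K ^ ?N / K" .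
  qed
  also have "\<dots> \<le> real (length w) * (K ^ ?N / K)"
    using card_occurrences_le K by (intro mult_right_mono) auto
  finally show ?thesis .
qed

text \<open>
  The series that vanish at \<open>x\<close>, tested against all words. Stating this with traces makes it a
  condition on scalars, which passes through an embedding and is easy to sum termwise.
\<close>

definition annihilator :: "('n::finite \<Rightarrow> ('h \<Rightarrow>\<^sub>L 'h)) \<Rightarrow> real \<Rightarrow> ('n list \<Rightarrow> complex) set" where
  "annihilator x K = {P \<in> nc_analytic K. \<forall>c. ((\<lambda>w. P w * \<tau> (nc_monomial x (w @ c))) has_sum 0) UNIV}"

text \<open>
  The square of the 2-norm of a partial sum over \<open>F\<close> is a double sum, whose inner sums are partial
  sums over \<open>F\<close> of series with sum \<open>0\<close>; they are bounded by the tail of \<open>\<Sum>\<^sub>w |P w| K\<^sup>|\<^sup>w\<^sup>|\<close> outside \<open>F\<close>.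
\<close>

lemma annihilator_norm2_tendsto:
  assumes x: "\<And>j. L2_bounded (x j) K" "\<And>j. selfadjoint (x j)" and P: "P \<in> annihilator x K"
  shows "((\<lambda>F. norm2 \<tau> (\<Sum>w\<in>F. scale_op (P w) (nc_monomial x w))) \<longlongrightarrow> 0) (finite_subsets_at_top UNIV)"
proof -
  have K: "K \<ge> 0" using x L2_boundedD(2) by blast
  have xM: "x j \<in> M" for j using x(1) by (rule L2_boundedD)
  have m [simp]: "nc_monomial x w \<in> M" for w using xM by (blast intro: monomial_mem)
  let ?h = "\<lambda>w. cmod (P w) * K ^ length w"
  define H where "H = infsum ?h UNIV"
  have P': "P \<in> nc_analytic K" using P by (simp add: annihilator_def)
  have H: "(?h has_sum H) UNIV"
    unfolding H_def by (intro has_sum_infsum nc_analytic_summable[OF P' K])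
  have le: "(norm2 \<tau> (\<Sum>w\<in>F. scale_op (P w) (nc_monomial x w)))\<^sup>2 \<le> H * (H - sum ?h F)" if F: "finite F" for F
  proof -
    let ?Q = "\<Sum>w\<in>F. scale_op (P w) (nc_monomial x w)"
    have HF: "sum ?h F \<le> H"
      unfolding H_def using F K by (intro finite_sum_le_infsum nc_analytic_summable P') auto
    have part: "cmod (\<Sum>w\<in>F. P w * \<tau> (nc_monomial x (w @ c))) \<le> K ^ length c * (H - sum ?h F)" for c
    proof -
      have "cmod (0 - (\<Sum>w\<in>F. P w * \<tau> (nc_monomial x (w @ c)))) \<le> K ^ length c * H - (\<Sum>w\<in>F. K ^ length c * ?h w)"
      proof (rule has_sum_partial_le[OF _ _ _ F])
        show "((\<lambda>w. P w * \<tau> (nc_monomial x (w @ c))) has_sum 0) UNIV"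
          using P by (simp add: annihilator_def)
        show "((\<lambda>w. K ^ length c * ?h w) has_sum K ^ length c * H) UNIV"
          by (intro has_sum_cmult_right H)
        fix w
        show "cmod (P w * \<tau> (nc_monomial x (w @ c))) \<le> K ^ length c * ?h w"
          using mult_left_mono[OF L2_bounded_tau[OF L2_bounded_monomial[of x K "w @ c", OF x(1)]], of "cmod (P w)"]
          by (simp add: norm_mult power_add ac_simps)
      qed
      then show ?thesis by (simp add: sum_distrib_left right_diff_distrib)
    qed
    have "ip ?Q ?Q = (\<Sum>v\<in>F. cnj (P v) * (\<Sum>w\<in>F. P w * \<tau> (nc_monomial x (w @ rev v))))"
    proof -
      have "ip (nc_monomial x v) (nc_monomial x w) = \<tau> (nc_monomial x (w @ rev v))" for v w
        by (simp add: ip_def adj_monomial[OF xM x(2)] nc_monomial_append tau_trace)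
      then have "ip (nc_monomial x v) ?Q = (\<Sum>w\<in>F. P w * \<tau> (nc_monomial x (w @ rev v)))" for v
        by (simp add: ip_sum_right ip_scale_right)
      moreover have "ip ?Q ?Q = (\<Sum>v\<in>F. cnj (P v) * ip (nc_monomial x v) ?Q)"
        by (subst ip_sum_left) (auto simp: ip_scale_left)
      ultimately show ?thesis by simp
    qed
    also have "cmod \<dots> \<le> (\<Sum>v\<in>F. ?h v * (H - sum ?h F))"
      using part K HF
      by (intro sum_norm_le) (auto simp: norm_mult mult.assoc intro!: mult_left_mono order_trans[OF part])
    also have "\<dots> \<le> H * (H - sum ?h F)"
      unfolding sum_distrib_right[symmetric] using HF by (intro mult_right_mono) auto
    finally show ?thesis
      by (subst norm2_sq) (auto intro: order_trans[OF complex_Re_le_cmod])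
  qed
  have "((\<lambda>F. H * (H - sum ?h F)) \<longlongrightarrow> H * (H - H)) (finite_subsets_at_top UNIV)"
    using H unfolding has_sum_def by (intro tendsto_intros)
  then have "((\<lambda>F. sqrt (H * (H - sum ?h F))) \<longlongrightarrow> 0) (finite_subsets_at_top UNIV)"
    using tendsto_real_sqrt by fastforce
  then show ?thesis
  proof (rule tendsto_sandwich[OF _ _ tendsto_const, rotated -1])
    show "\<forall>\<^sub>F F in finite_subsets_at_top UNIV. 0 \<le> norm2 \<tau> (\<Sum>w\<in>F. scale_op (P w) (nc_monomial x w))"
      by (intro always_eventually allI norm2_ge0) simp
    show "\<forall>\<^sub>F F in finite_subsets_at_top UNIV. norm2 \<tau> (\<Sum>w\<in>F. scale_op (P w) (nc_monomial x w)) \<le> sqrt (H * (H - sum ?h F))"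
      using eventually_finite_subsets_at_top_weakI[of UNIV finite]
      by (rule eventually_mono) (auto intro: real_le_rsqrt le)
  qed
qed

end

text \<open>
  What is used of \<open>\<delta>\<^sup>* = n\<close>: arbitrarily small perturbations \<open>z\<close> of \<open>x\<close> of size \<open>d\<close> have conjugate
  variables of norm \<open>o(1 / d)\<close>.
\<close>

locale vanishing_information = tracial_von_neumann_algebra M \<tau>
  for M :: "('h::chilbert_space \<Rightarrow>\<^sub>L 'h) set" and \<tau> +
  fixes x :: "'n::finite \<Rightarrow> ('h \<Rightarrow>\<^sub>L 'h)" and K :: real
  assumes K_pos: "K > 0"
    and x_selfadjoint: "\<And>j. selfadjoint (x j)"
    and x_bounded: "\<And>j. L2_bounded (x j) K"
    and information: "\<And>e. e > 0 \<Longrightarrow> \<exists>z \<xi> d. d < e \<and> (\<forall>j. L2_bounded (z j) K \<and> L2_bounded (z j - x j) d \<and>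
      conjugate_variable \<tau> z j (\<xi> j) \<and> L2_norm \<tau> (\<xi> j) * d < e)"
begin

lemma x_mem [simp]: "x j \<in> M"
  using x_bounded by (rule L2_boundedD)

lemma monomial_x_mem [simp]: "nc_monomial x w \<in> M"
  by (rule monomial_mem) simp

text \<open>
  With \<open>Q\<close> a partial sum of \<open>P\<close>, \<open>\<parallel>Q(z)\<parallel>\<^sub>2\<close> is of order \<open>d\<close> up to \<open>\<parallel>Q(x)\<parallel>\<^sub>2\<close>, which tends to \<open>0\<close>.
  So the conjugate variables of \<open>z\<close> bound the derivative by \<open>o(1)\<close>, and the bound passes to \<open>x\<close>.
\<close>

theorem annihilator_split_trace:
  assumes P: "P \<in> annihilator x K"
  shows "((\<lambda>w. P w * split_trace x j b w c) has_sum 0) UNIV"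
proof -
  let ?L = "length b + length c"
  let ?g1 = "\<lambda>w. cmod (P w) * (real (length w) * K ^ length w)"
  let ?g2 = "\<lambda>w. cmod (P w) * (real (length w) * (real (?L + length w) * K ^ (?L + length w)))"
  have P': "P \<in> nc_analytic K" using P by (simp add: annihilator_def)
  have s1: "?g1 summable_on UNIV"
    using nc_analytic_weighted_summable[OF P'] K_pos by (simp add: mult.assoc)
  have s2: "?g2 summable_on UNIV"
  proof -
    have "(\<lambda>w. (real ?L * K ^ ?L) * ?g1 w + K ^ ?L * (cmod (P w) * real (length w) * real (length w) * K ^ length w)) summable_on UNIV"
      using nc_analytic_weighted_summable2[OF P'] K_pos by (intro summable_on_add summable_on_cmult_right s1) auto
    then show ?thesis
      by (rule summable_on_cong[THEN iffD1, rotated]) (simp add: power_add algebra_simps)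
  qed
  have "(\<lambda>w. norm (P w * split_trace x j b w c)) summable_on UNIV"
  proof (rule Infinite_Sum.abs_summable_on_comparison_test')
    show "(\<lambda>w. K ^ ?L / K * ?g1 w) summable_on UNIV"
      by (intro summable_on_cmult_right s1)
    show "norm (P w * split_trace x j b w c) \<le> K ^ ?L / K * ?g1 w" for w
      using mult_left_mono[OF split_trace_le[of x K j b w c, OF x_bounded K_pos], of "cmod (P w)"]
      by (simp add: norm_mult power_add ac_simps)
  qed
  then have "(\<lambda>w. P w * split_trace x j b w c) summable_on UNIV"
    by (rule Infinite_Sum.abs_summable_summable)
  then obtain s where s: "((\<lambda>w. P w * split_trace x j b w c) has_sum s) UNIV"
    using has_sum_infsum by blast
  define C1 where "C1 = infsum ?g1 UNIV / K"
  define C2 where "C2 = infsum ?g2 UNIV / K\<^sup>2"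
  have C: "C1 \<ge> 0" "C2 \<ge> 0"
    using K_pos by (auto simp: C1_def C2_def intro!: divide_nonneg_nonneg infsum_nonneg mult_nonneg_nonneg)
  let ?Q = "\<lambda>z F. \<Sum>w\<in>F. scale_op (P w) (nc_monomial z w)"
  have small: "cmod s \<le> e * (K ^ ?L * C1 + ?L / K * K ^ ?L * C1 + C2)" if e: "e > 0" for e
  proof -
    from information[OF e] obtain z \<xi> d where "d < e"
      and z: "\<And>j. L2_bounded (z j) K" and zx: "\<And>j. L2_bounded (z j - x j) d"
      and cv: "\<And>j. conjugate_variable \<tau> z j (\<xi> j)" and xi: "\<And>j. L2_norm \<tau> (\<xi> j) * d < e"
      by blast
    have d0: "d \<ge> 0" using zx L2_boundedD(2) by blast
    have zM: "z j \<in> M" for j using z by (rule L2_boundedD)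
    have m [simp]: "nc_monomial z w \<in> M" for w using zM by (blast intro: monomial_mem)
    have xi0: "L2_norm \<tau> (\<xi> j) \<ge> 0"
      using conjugate_variable_norm_ge[OF cv zM, of j] norm2_ge0[OF zM, of j]
      by (meson mult_nonpos_nonneg not_le order.trans zero_less_one order_less_le_trans less_imp_le)
    let ?A = "(L2_norm \<tau> (\<xi> j) + ?L / K) * K ^ ?L"
    have A0: "?A \<ge> 0" using xi0 K_pos by simp
    have bound: "cmod (\<Sum>w\<in>F. P w * split_trace x j b w c) \<le> ?A * (norm2 \<tau> (?Q x F) + C1 * d) + C2 * d"
      if F: "finite F" for F
    proof -
      have "norm2 \<tau> (?Q z F - ?Q x F) \<le> (\<Sum>w\<in>F. ?g1 w * (d / K))"
      proof -
        have "?Q z F - ?Q x F = (\<Sum>w\<in>F. scale_op (P w) (nc_monomial z w - nc_monomial x w))"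
          unfolding sum_subtractf[symmetric]
          by (intro sum.cong refl blinfun_eqI) (simp add: blinfun.diff_left scaleC_diff_right)
        also have "norm2 \<tau> \<dots> \<le> (\<Sum>w\<in>F. norm2 \<tau> (scale_op (P w) (nc_monomial z w - nc_monomial x w)))"
          by (intro norm2_sum_le) auto
        also have "\<dots> \<le> (\<Sum>w\<in>F. ?g1 w * (d / K))"
        proof (rule sum_mono)
          fix w
          show "norm2 \<tau> (scale_op (P w) (nc_monomial z w - nc_monomial x w)) \<le> ?g1 w * (d / K)"
            using mult_left_mono[OF L2_bounded_norm2[OF L2_bounded_monomial_diff[of z K x d w, OF z x_bounded zx K_pos]], of "cmod (P w)"]
            by (simp add: norm2_scale mult.assoc)
        qed
        finally show ?thesis .
      qed
      also have "\<dots> = sum ?g1 F * (d / K)" by (simp only: sum_distrib_right)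
      also have "\<dots> \<le> infsum ?g1 UNIV * (d / K)"
        using F K_pos d0 by (intro mult_right_mono finite_sum_le_infsum s1) auto
      finally have Qd: "norm2 \<tau> (?Q z F - ?Q x F) \<le> C1 * d" by (simp add: C1_def)
      have Qz: "norm2 \<tau> (?Q z F) \<le> norm2 \<tau> (?Q x F) + C1 * d"
        using norm2_diff_ge[of "?Q z F" "?Q x F"] Qd by auto
      have "cmod ((\<Sum>w\<in>F. P w * split_trace z j b w c) - (\<Sum>w\<in>F. P w * split_trace x j b w c)) \<le> (\<Sum>w\<in>F. ?g2 w * (d / K\<^sup>2))"
        unfolding sum_subtractf[symmetric] right_diff_distrib[symmetric]
      proof (rule sum_norm_le)
        fix w
        show "cmod (P w * (split_trace z j b w c - split_trace x j b w c)) \<le> ?g2 w * (d / K\<^sup>2)"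
          using mult_left_mono[OF split_trace_diff[of z K x d j b w c, OF z x_bounded zx K_pos], of "cmod (P w)"]
          by (simp add: norm_mult mult.assoc)
      qed
      also have "\<dots> = sum ?g2 F * (d / K\<^sup>2)" by (simp only: sum_distrib_right)
      also have "\<dots> \<le> infsum ?g2 UNIV * (d / K\<^sup>2)"
        using F K_pos d0 by (intro mult_right_mono finite_sum_le_infsum s2) auto
      finally have "cmod ((\<Sum>w\<in>F. P w * split_trace z j b w c) - (\<Sum>w\<in>F. P w * split_trace x j b w c)) \<le> C2 * d"
        by (simp add: C2_def)
      then have "cmod (\<Sum>w\<in>F. P w * split_trace x j b w c) \<le> cmod (\<Sum>w\<in>F. P w * split_trace z j b w c) + C2 * d"
        by (smt (verit) norm_triangle_sub norm_minus_commute)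
      also have "cmod (\<Sum>w\<in>F. P w * split_trace z j b w c) \<le> ?A * norm2 \<tau> (?Q z F)"
        by (rule conjugate_variable_bound[OF cv z K_pos F])
      also have "\<dots> \<le> ?A * (norm2 \<tau> (?Q x F) + C1 * d)"
        using A0 Qz by (intro mult_left_mono)
      finally show ?thesis by simp
    qed
    have "cmod s \<le> ?A * (0 + C1 * d) + C2 * d"
    proof (rule tendsto_le)
      show "((\<lambda>F. cmod (\<Sum>w\<in>F. P w * split_trace x j b w c)) \<longlongrightarrow> cmod s) (finite_subsets_at_top UNIV)"
        using s unfolding has_sum_def by (rule tendsto_norm)
      show "((\<lambda>F. ?A * (norm2 \<tau> (?Q x F) + C1 * d) + C2 * d) \<longlongrightarrow> ?A * (0 + C1 * d) + C2 * d) (finite_subsets_at_top UNIV)"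
        by (intro tendsto_add tendsto_mult tendsto_const
            annihilator_norm2_tendsto[of x K, OF x_bounded x_selfadjoint P])
      show "\<forall>\<^sub>F F in finite_subsets_at_top UNIV. cmod (\<Sum>w\<in>F. P w * split_trace x j b w c) \<le> ?A * (norm2 \<tau> (?Q x F) + C1 * d) + C2 * d"
        using eventually_finite_subsets_at_top_weakI[of UNIV finite]
        by (rule eventually_mono) (simp, rule bound)
    qed simp
    also have "\<dots> = (L2_norm \<tau> (\<xi> j) * d) * (K ^ ?L * C1) + d * (?L / K * K ^ ?L * C1 + C2)"
      by (simp add: algebra_simps)
    also have "\<dots> \<le> e * (K ^ ?L * C1) + e * (?L / K * K ^ ?L * C1 + C2)"
      using xi[of j] \<open>d < e\<close> C K_pos by (intro add_mono mult_right_mono) auto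
    finally show ?thesis by (simp add: algebra_simps)
  qed
  have "cmod s \<le> 0"
  proof (rule field_le_epsilon)
    fix e :: real assume "e > 0"
    define A where "A = K ^ ?L * C1 + ?L / K * K ^ ?L * C1 + C2"
    have "A \<ge> 0" using C K_pos by (auto simp: A_def)
    then show "cmod s \<le> 0 + e"
      using small[of "e / (A + 1)"] \<open>e > 0\<close> unfolding A_def[symmetric]
      by (smt (verit) divide_pos_pos mult_left_mono nonzero_eq_divide_eq times_divide_eq_left)
  qed
  then show ?thesis using s by simp
qed

end


section \<open>Power series whose iterated Euler derivatives vanish at a point\<close>

text \<open>
  The hypothesis says that all Taylor coefficients of \<open>f z = (\<Sum>m. a m * z ^ m)\<close> at \<open>1\<close> vanish. Since
  \<open>f\<close> is analytic on a disc around \<open>0\<close> of radius greater than \<open>1\<close>, it is identically \<open>0\<close>.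
\<close>

lemma coeffs_zero_of_taylor_zero_at_one:
  fixes a :: "nat \<Rightarrow> complex"
  assumes q: "q > 1" and sa: "summable (\<lambda>m. cmod (a m) * q ^ m)"
    and zero: "\<And>k. ((\<lambda>m. of_nat (m choose k) * a m) has_sum 0) UNIV"
  shows "a m = 0"
proof -
  define f where "f z = (\<Sum>m. a m * z ^ m)" for z
  have conv: "summable (\<lambda>m. cmod (a m) * r ^ m)" if "0 \<le> r" "r \<le> q" for r
    by (rule summable_comparison_test'[OF sa, of 0]) (use that in \<open>auto intro!: mult_left_mono power_mono\<close>)
  have sums: "(\<lambda>m. a m * z ^ m) sums f z" if "cmod z < q" for z
    unfolding f_def
    by (intro summable_sums summable_norm_cancel[of "\<lambda>m. a m * z ^ m"])
      (use conv[of "cmod z"] that in \<open>simp add: norm_mult norm_power\<close>)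
  have hol: "f holomorphic_on ball 0 q"
    by (rule power_series_holomorphic[of 0 q a]) (auto intro: sums)
  have near: "f (1 + t) = 0" if t: "cmod t < q - 1" for t
  proof -
    define G where "G = (\<lambda>(m, k). a m * (of_nat (m choose k) * t ^ k))"
    have abs_G: "(\<lambda>p. norm (G p)) summable_on UNIV \<times> UNIV"
    proof (rule summable_on_SigmaI)
      fix m :: nat
      have "((\<lambda>k. norm (G (m, k))) has_sum (\<Sum>k\<le>m. norm (G (m, k)))) UNIV"
        by (rule has_sum_finite_neutralI[of "{..m}"]) (auto simp: G_def)
      moreover have "(\<Sum>k\<le>m. norm (G (m, k))) = cmod (a m) * (1 + cmod t) ^ m"
      proof -
        have "(1 + cmod t) ^ m = (cmod t + 1) ^ m" by (simp add: add.commute)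
        also have "\<dots> = (\<Sum>k\<le>m. of_nat (m choose k) * cmod t ^ k)"
          by (subst binomial_ring) simp
        finally show ?thesis
          by (simp add: G_def norm_mult norm_power sum_distrib_left)
      qed
      ultimately show "((\<lambda>k. norm (G (m, k))) has_sum cmod (a m) * (1 + cmod t) ^ m) UNIV"
        by simp
    next
      have "summable (\<lambda>m. cmod (a m) * (1 + cmod t) ^ m)"
        using t by (intro conv) auto
      then show "(\<lambda>m. cmod (a m) * (1 + cmod t) ^ m) summable_on UNIV"
        by (intro norm_summable_imp_summable_on) (simp add: norm_mult norm_power)
    qed auto
    then have "G summable_on UNIV \<times> UNIV" by (rule Infinite_Sum.abs_summable_summable)
    then obtain s where s: "(G has_sum s) (UNIV \<times> UNIV)" using has_sum_infsum by blast
    have "((\<lambda>m. a m * (1 + t) ^ m) has_sum s) UNIV"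
    proof (rule has_sum_SigmaD[OF s])
      fix m :: nat
      have "((\<lambda>k. G (m, k)) has_sum (\<Sum>k\<le>m. G (m, k))) UNIV"
        by (rule has_sum_finite_neutralI[of "{..m}"]) (auto simp: G_def)
      moreover have "(\<Sum>k\<le>m. G (m, k)) = a m * (1 + t) ^ m"
      proof -
        have "(1 + t) ^ m = (t + 1) ^ m" by (simp add: add.commute)
        also have "\<dots> = (\<Sum>k\<le>m. of_nat (m choose k) * t ^ k)"
          by (subst binomial_ring) simp
        finally show ?thesis by (simp add: G_def sum_distrib_left)
      qed
      ultimately show "((\<lambda>k. G (m, k)) has_sum a m * (1 + t) ^ m) UNIV" by simp
    qed
    then have "(\<lambda>m. a m * (1 + t) ^ m) sums s" by (rule has_sum_imp_sums)
    moreover have "cmod (1 + t) < q"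
      using t norm_triangle_ineq[of 1 t] by simp
    ultimately have "f (1 + t) = s" using sums sums_unique2 by blast
    moreover have "((\<lambda>k. 0) has_sum s) (UNIV :: nat set)"
    proof (rule has_sum_SigmaD)
      show "((\<lambda>(k, m). G (m, k)) has_sum s) (UNIV \<times> UNIV)"
        using s has_sum_swap by blast
      fix k :: nat
      show "((\<lambda>m. case (k, m) of (k, m) \<Rightarrow> G (m, k)) has_sum 0) UNIV"
        using has_sum_cmult_right[OF zero[of k], of "t ^ k"] by (simp add: G_def ac_simps)
    qed
    then have "s = 0" by (metis has_sum_0 has_sum_unique)
    ultimately show ?thesis by simp
  qed
  have f0: "f z = 0" if "z \<in> ball 0 q" for z
  proof (rule analytic_continuation[OF hol, of "ball 1 (q - 1)" 1])
    show "ball (1::complex) (q - 1) \<subseteq> ball 0 q"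
      using q by (simp add: ball_subset_ball_iff)
    show "1 islimpt ball (1::complex) (q - 1)" using q by (simp add: islimpt_ball)
    show "f z = 0" if "z \<in> ball 1 (q - 1)" for z
      using near[of "z - 1"] that by (simp add: dist_norm norm_minus_commute)
  qed (use q that in auto)
  have a0: "a 0 = 0"
    using sums[of 0] f0[of 0] q sums_unique2 powser_sums_zero[of a] by fastforce
  show ?thesis
  proof (rule ccontr)
    assume am: "a m \<noteq> 0"
    then have "m > 0" using a0 by (cases m) auto
    obtain s where "0 < s" "\<And>z. z \<in> cball 0 s - {0} \<Longrightarrow> f z \<noteq> 0"
      by (rule powser_0_nonzero[of q 0 a f m]) (use q am \<open>m > 0\<close> sums f0 in auto)
    then have "f (of_real (min s (q / 2))) \<noteq> 0" using q by auto
    moreover have "f (of_real (min s (q / 2))) = 0" using q \<open>0 < s\<close> by (intro f0) auto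
    ultimately show False by simp
  qed
qed

lemma nc_analytic_lincomb:
  assumes P: "P \<in> nc_analytic K" and Q: "Q \<in> nc_analytic K"
  shows "(\<lambda>w. a * P w + b * Q w) \<in> nc_analytic K"
proof -
  obtain R where R: "R > K" "R > 0" "(\<lambda>w. cmod (P w) * R ^ length w) summable_on UNIV"
    using P by (rule nc_analyticE)
  obtain R' where R': "R' > K" "R' > 0" "(\<lambda>w. cmod (Q w) * R' ^ length w) summable_on UNIV"
    using Q by (rule nc_analyticE)
  define r where "r = min R R'"
  have r: "r > K" "r > 0" "r \<le> R" "r \<le> R'" using R R' by (auto simp: r_def)
  show ?thesis
  proof (rule nc_analyticI[OF r(1,2)], rule summable_on_comparison_test)
    show "(\<lambda>w. cmod a * (cmod (P w) * R ^ length w) + cmod b * (cmod (Q w) * R' ^ length w)) summable_on UNIV"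
      by (intro summable_on_add summable_on_cmult_right R R')
    fix w :: "'a list"
    have "cmod (a * P w + b * Q w) * r ^ length w \<le> (cmod a * cmod (P w) + cmod b * cmod (Q w)) * r ^ length w"
      using r by (intro mult_right_mono order_trans[OF norm_triangle_ineq]) (auto simp: norm_mult)
    also have "\<dots> = cmod a * (cmod (P w) * r ^ length w) + cmod b * (cmod (Q w) * r ^ length w)"
      by (simp add: algebra_simps)
    also have "\<dots> \<le> cmod a * (cmod (P w) * R ^ length w) + cmod b * (cmod (Q w) * R' ^ length w)"
      using r by (intro add_mono mult_left_mono power_mono) auto
    finally show "cmod (a * P w + b * Q w) * r ^ length w \<le> \<dots>" .
  qed (use r in auto)
qed


section \<open>Sums over factorizations of words\<close>

lemma has_sum_finite_sum:
  fixes f :: "'i \<Rightarrow> 'a \<Rightarrow> 'b::topological_comm_monoid_add"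
  assumes "\<And>i. i \<in> I \<Longrightarrow> (f i has_sum s i) A"
  shows "((\<lambda>x. \<Sum>i\<in>I. f i x) has_sum (\<Sum>i\<in>I. s i)) A"
  using assms by (induction I rule: infinite_finite_induct) (auto intro: has_sum_add)

text \<open>
  A marked occurrence of \<open>j\<close> in a word corresponds to what follows and what precedes it. The suffix
  comes first in the pairs, since the prefix is what gets summed away in \<open>partial_trace\<close> below.
\<close>

lemma has_sum_occurrences:
  "((\<lambda>(w, k). g (drop (Suc k) w, take k w)) has_sum s) (Sigma UNIV (occurrences j)) =
   (g has_sum s) (UNIV \<times> UNIV)"
  by (rule has_sum_reindex_bij_witness[where j = "\<lambda>(w, k). (drop (Suc k) w, take k w)"
      and i = "\<lambda>(v, u). (u @ j # v, length u)"])
    (auto simp: occurrences_split, auto simp: occurrences_def)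

lemma nc_analytic_factorization_summable:
  assumes P: "P \<in> nc_analytic K" and K: "K \<ge> 0"
  shows "(\<lambda>(v, u). cmod (P (u @ j # v)) * K ^ length (u @ j # v)) summable_on UNIV \<times> UNIV"
proof -
  have "(\<lambda>(w, k). cmod (P w) * K ^ length w) summable_on Sigma UNIV (occurrences j)"
  proof (rule summable_on_SigmaI)
    fix w
    show "((\<lambda>k. case (w, k) of (w, k) \<Rightarrow> cmod (P w) * K ^ length w) has_sum
      (\<Sum>k\<in>occurrences j w. cmod (P w) * K ^ length w)) (occurrences j w)"
      by (intro has_sum_finiteI) auto
  next
    show "(\<lambda>w. \<Sum>k\<in>occurrences j w. cmod (P w) * K ^ length w) summable_on UNIV"
    proof (rule summable_on_comparison_test[OF nc_analytic_weighted_summable[OF P K]])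
      fix w
      show "(\<Sum>k\<in>occurrences j w. cmod (P w) * K ^ length w) \<le> cmod (P w) * real (length w) * K ^ length w"
        using mult_right_mono[of "real (card (occurrences j w))" "real (length w)" "cmod (P w) * K ^ length w"]
          card_occurrences_le[of j w] K by (simp add: ac_simps)
    qed (use K in \<open>auto intro!: sum_nonneg\<close>)
  qed (use K in auto)
  then obtain s where "((\<lambda>(w, k). cmod (P w) * K ^ length w) has_sum s) (Sigma UNIV (occurrences j))"
    using has_sum_infsum by blast
  also have "?this \<longleftrightarrow> ((\<lambda>(w, k). (\<lambda>(v, u). cmod (P (u @ j # v)) * K ^ length (u @ j # v)) (drop (Suc k) w, take k w)) has_sum s) (Sigma UNIV (occurrences j))"
    by (intro has_sum_cong) (auto simp only: occurrences_split split: prod.split)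
  finally show ?thesis
    unfolding has_sum_occurrences by (rule has_sum_imp_summable)
qed


section \<open>Orthonormal bases of spaces of words\<close>

context tracial_von_neumann_algebra
begin

lemma annihilator_lincomb:
  assumes "P \<in> annihilator x K" "Q \<in> annihilator x K"
  shows "(\<lambda>w. a * P w + b * Q w) \<in> annihilator x K"
proof -
  have "((\<lambda>w. (a * P w + b * Q w) * \<tau> (nc_monomial x (w @ c))) has_sum 0) UNIV" for c
  proof -
    have "((\<lambda>w. a * (P w * \<tau> (nc_monomial x (w @ c))) + b * (Q w * \<tau> (nc_monomial x (w @ c)))) has_sum a * 0 + b * 0) UNIV"
      using assms by (intro has_sum_add has_sum_cmult_right) (auto simp: annihilator_def)
    then show ?thesis by (simp add: algebra_simps)
  qed
  then show ?thesis
    using assms nc_analytic_lincomb by (auto simp: annihilator_def)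
qed

inductive_set word_span :: "('n::finite \<Rightarrow> ('h \<Rightarrow>\<^sub>L 'h)) \<Rightarrow> ('h \<Rightarrow>\<^sub>L 'h) set" for x where
  word: "nc_monomial x w \<in> word_span x"
| add: "A \<in> word_span x \<Longrightarrow> B \<in> word_span x \<Longrightarrow> A + B \<in> word_span x"
| scale: "A \<in> word_span x \<Longrightarrow> scale_op c A \<in> word_span x"

lemma word_span_mem: "A \<in> word_span x \<Longrightarrow> (\<And>j. x j \<in> M) \<Longrightarrow> A \<in> M"
  by (induction rule: word_span.induct) (auto intro: monomial_mem)

lemma word_span_zero: "0 \<in> word_span x"
  using word_span.scale[OF word_span.word, of 0] by simp

lemma word_span_diff: "A \<in> word_span x \<Longrightarrow> B \<in> word_span x \<Longrightarrow> A - B \<in> word_span x"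
  using word_span.add[OF _ word_span.scale[of B x "-1"]] by (simp add: scale_op_minus_one)

lemma word_span_sum: "(\<And>i. i \<in> F \<Longrightarrow> f i \<in> word_span x) \<Longrightarrow> sum f F \<in> word_span x"
  by (induction F rule: infinite_finite_induct) (auto intro: word_span.add word_span_zero)

lemma word_span_adj:
  assumes "A \<in> word_span x" "\<And>j. x j \<in> M" "\<And>j. selfadjoint (x j)"
  shows "adj A \<in> word_span x"
  using assms(1)
proof induction
  case (word w)
  then show ?case using assms by (simp add: adj_monomial word_span.word)
next
  case (add A B)
  have "A \<in> M" "B \<in> M" using add.hyps word_span_mem[of _ x] assms(2) by blast+
  then show ?case using add.IH by (simp add: adj_add word_span.add)
next
  case (scale A c)
  have "A \<in> M" using scale.hyps word_span_mem[of _ x] assms(2) by blast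
  then show ?case using scale.IH by (simp add: adj_scale word_span.scale)
qed

lemma word_span_compose_left:
  assumes "A \<in> word_span x" "\<And>j. x j \<in> M"
  shows "nc_monomial x w o\<^sub>L A \<in> word_span x"
  using assms(1)
proof induction
  case (word v)
  then show ?case by (metis nc_monomial_append word_span.word)
next
  case (add A B)
  then show ?case by (simp add: blinfun_compose_add_right word_span.add)
next
  case (scale A c)
  then show ?case using assms(2) by (simp add: compose_scale_right monomial_mem word_span.scale)
qed

lemma word_span_compose_right:
  assumes "A \<in> word_span x"
  shows "A o\<^sub>L nc_monomial x w \<in> word_span x"
  using assms
proof induction
  case (word v)
  then show ?case by (metis nc_monomial_append word_span.word)
next
  case (add A B)
  then show ?case by (simp add: blinfun_compose_add_left word_span.add)
next
  case (scale A c)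
  then show ?case by (simp add: blinfun_compose_scale_left word_span.scale)
qed

definition orthonormal :: "('h \<Rightarrow>\<^sub>L 'h) set \<Rightarrow> bool" where
  "orthonormal E \<longleftrightarrow> finite E \<and> E \<subseteq> M \<and> (\<forall>e\<in>E. \<forall>f\<in>E. ip e f = (if e = f then 1 else 0))"

definition projection :: "('h \<Rightarrow>\<^sub>L 'h) set \<Rightarrow> ('h \<Rightarrow>\<^sub>L 'h) \<Rightarrow> ('h \<Rightarrow>\<^sub>L 'h)" where
  "projection E A = (\<Sum>e\<in>E. scale_op (ip e A) e)"

lemma projection_mem: "orthonormal E \<Longrightarrow> projection E A \<in> M"
  unfolding projection_def orthonormal_def by (intro sum_mem scale_mem) auto

lemma ip_projection:
  assumes "orthonormal E" "A \<in> M" "B \<in> M"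
  shows "ip B (projection E A) = (\<Sum>e\<in>E. ip e A * ip B e)"
  unfolding projection_def using assms
  by (subst ip_sum_right) (auto simp: orthonormal_def ip_scale_right subset_iff)

lemma ip_diff_projection:
  assumes E: "orthonormal E" and A: "A \<in> M" and e: "e \<in> E"
  shows "ip e (A - projection E A) = 0"
proof -
  have eM: "e \<in> M" using E e by (auto simp: orthonormal_def)
  have "ip e (projection E A) = (\<Sum>f\<in>E. if f = e then ip f A else 0)"
    unfolding ip_projection[OF E A eM] using E e by (intro sum.cong) (auto simp: orthonormal_def)
  also have "\<dots> = ip e A" using E e by (simp add: orthonormal_def)
  finally show ?thesis using eM A projection_mem[OF E] by (simp add: ip_diff_right)
qed

lemma norm2_diff_projection_le:
  assumes E: "orthonormal E" and A: "A \<in> M"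
  shows "norm2 \<tau> (A - projection E A) \<le> norm2 \<tau> A"
proof -
  define D where "D = A - projection E A"
  have D: "D \<in> M" and pM: "projection E A \<in> M" using A projection_mem[OF E] by (auto simp: D_def)
  have "ip D e = 0" if "e \<in> E" for e
    using ip_diff_projection[OF E A that] ip_commute[OF D, of e] E that by (auto simp: D_def orthonormal_def)
  then have 0: "ip D (projection E A) = 0"
    by (simp add: ip_projection[OF E A D])
  have "ip A A = ip (D + projection E A) (D + projection E A)" by (simp add: D_def)
  also have "\<dots> = ip D D + ip (projection E A) (projection E A)"
    using D pM 0 ip_commute[OF pM D] by (simp add: ip_add_left ip_add_right)
  finally have "(norm2 \<tau> D)\<^sup>2 \<le> (norm2 \<tau> A)\<^sup>2"
    using ip_self_ge0[OF pM] A D by (simp add: norm2_sq)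
  then show ?thesis
    unfolding D_def[symmetric] using norm2_ge0[OF A] by (rule power2_le_imp_le)
qed

text \<open>
  Gram-Schmidt: if the remainder \<open>D\<close> of the next element is non-zero, faithfulness of the trace
  allows it to be normalized.
\<close>

lemma orthonormal_exists:
  assumes xM: "\<And>j. x j \<in> M" and W: "finite W" "W \<subseteq> word_span x"
  shows "\<exists>E. orthonormal E \<and> E \<subseteq> word_span x \<and> (\<forall>A\<in>W. projection E A = A)"
  using W
proof (induction W)
  case empty
  show ?case by (rule exI[of _ "{}"]) (auto simp: orthonormal_def)
next
  case (insert A W)
  then obtain E where E: "orthonormal E" "E \<subseteq> word_span x" "\<And>B. B \<in> W \<Longrightarrow> projection E B = B" by auto
  have A: "A \<in> word_span x" "A \<in> M" using insert.prems word_span_mem xM by auto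
  define D where "D = A - projection E A"
  have DM: "D \<in> M" using A projection_mem[OF E(1)] by (simp add: D_def)
  show ?case
  proof (cases "D = 0")
    case True
    then show ?thesis using E by (intro exI[of _ E]) (auto simp: D_def)
  next
    case False
    then have n: "norm2 \<tau> D > 0" using norm2_eq_0[OF DM] norm2_ge0[OF DM] by fastforce
    define e where "e = scale_op (of_real (1 / norm2 \<tau> D)) D"
    have eM: "e \<in> M" using DM by (simp add: e_def)
    have "projection E A \<in> word_span x"
      unfolding projection_def using E(2) by (intro word_span_sum word_span.scale) auto
    then have e_span: "e \<in> word_span x"
      unfolding e_def D_def by (intro word_span.scale word_span_diff A)
    have EM: "f \<in> M" if "f \<in> E" for f using that E(1) by (auto simp: orthonormal_def)
    have fe: "ip f e = 0" if "f \<in> E" for f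
      using ip_diff_projection[OF E(1) A(2) that] EM[OF that] DM by (simp add: e_def D_def[symmetric] ip_scale_right)
    have ef: "ip e f = 0" if "f \<in> E" for f
      using ip_commute[OF eM EM[OF that]] fe[OF that] by simp
    have ee: "ip e e = 1"
      using DM n by (simp add: e_def ip_scale_left ip_scale_right ip_self[OF DM] power2_eq_square)
    have "e \<notin> E" using fe ee by auto
    have on: "orthonormal (insert e E)"
      using E(1) fe ef ee eM \<open>e \<notin> E\<close> by (auto simp: orthonormal_def)
    have proj: "projection (insert e E) B = scale_op (ip e B) e + projection E B" for B
      using E(1) \<open>e \<notin> E\<close> by (simp add: projection_def orthonormal_def)
    have "projection (insert e E) B = B" if "B \<in> W" for B
    proof -
      have "B \<in> M" using that insert.prems word_span_mem[of B x, OF _ xM] by auto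
      then have "ip e (projection E B) = 0"
        using ip_projection[OF E(1) _ eM] ef by simp
      then show ?thesis using E(3)[OF that] by (simp add: proj)
    qed
    moreover have "projection (insert e E) A = A"
    proof -
      have "ip e A = ip e D + ip e (projection E A)"
        using eM DM projection_mem[OF E(1)] by (simp add: ip_add_right[symmetric] D_def)
      also have "ip e (projection E A) = 0"
        using ip_projection[OF E(1) A(2) eM] ef by simp
      also have "ip e D = of_real (norm2 \<tau> D)"
        using DM n by (simp add: e_def ip_scale_left ip_self[OF DM] power2_eq_square)
      finally have "scale_op (ip e A) e = D" using n by (simp add: e_def)
      then show ?thesis by (simp add: proj D_def)
    qed
    ultimately show ?thesis
      using on e_span E(2) by (intro exI[of _ "insert e E"]) auto
  qed
qed

end


section \<open>The relations of a tuple with vanishing information\<close>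

context vanishing_information
begin

lemma tau_monomial_le: "cmod (\<tau> (nc_monomial x w)) \<le> K ^ length w"
  by (intro L2_bounded_tau L2_bounded_monomial x_bounded)

lemma norm2_monomial_le: "norm2 \<tau> (nc_monomial x w) \<le> K ^ length w"
  by (intro L2_bounded_norm2 L2_bounded_monomial x_bounded)

lemma factorization_abs_summable:
  fixes P :: "'n list \<Rightarrow> complex" and g :: "'n list \<Rightarrow> 'n list \<Rightarrow> complex"
  assumes P: "P \<in> nc_analytic K" and g: "\<And>u v. cmod (g v u) \<le> C * K ^ (length u + length v)"
  shows "(\<lambda>p. norm ((\<lambda>(v, u). P (u @ j # v) * g v u) p)) summable_on UNIV \<times> UNIV"
proof (rule Infinite_Sum.abs_summable_on_comparison_test')
  show "(\<lambda>p. C / K * (\<lambda>(v, u). cmod (P (u @ j # v)) * K ^ length (u @ j # v)) p) summable_on UNIV \<times> UNIV"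
    using K_pos by (intro summable_on_cmult_right nc_analytic_factorization_summable P) simp
  fix p :: "'n list \<times> 'n list"
  obtain v u where p: "p = (v, u)" by (cases p)
  have "cmod (P (u @ j # v)) * cmod (g v u) \<le> cmod (P (u @ j # v)) * (C * K ^ (length u + length v))"
    by (intro mult_left_mono g) auto
  then show "norm ((\<lambda>(v, u). P (u @ j # v) * g v u) p) \<le> C / K * (\<lambda>(v, u). cmod (P (u @ j # v)) * K ^ length (u @ j # v)) p"
    using K_pos by (simp add: p norm_mult ac_simps)
qed

text \<open>
  Rearranged over factorizations of words, \<open>annihilator_split_trace\<close> exhibits the coefficients of
  \<open>\<partial>\<^sub>j P\<close> and separates the two tensor factors.
\<close>

lemma annihilator_factorization_words:
  assumes P: "P \<in> annihilator x K"
  shows "((\<lambda>(v, u). P (u @ j # v) * (\<tau> (nc_monomial x (b @ u)) * \<tau> (nc_monomial x (v @ c)))) has_sum 0) (UNIV \<times> UNIV)"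
    (is "(?g has_sum 0) _")
proof -
  have P': "P \<in> nc_analytic K" using P by (simp add: annihilator_def)
  have "(\<lambda>p. norm (?g p)) summable_on UNIV \<times> UNIV"
  proof (rule factorization_abs_summable[OF P'])
    fix u v
    have "cmod (\<tau> (nc_monomial x (b @ u)) * \<tau> (nc_monomial x (v @ c))) \<le> K ^ length (b @ u) * K ^ length (v @ c)"
      unfolding norm_mult using K_pos by (intro mult_mono tau_monomial_le) auto
    then show "cmod (\<tau> (nc_monomial x (b @ u)) * \<tau> (nc_monomial x (v @ c))) \<le> K ^ (length b + length c) * K ^ (length u + length v)"
      by (simp add: power_add ac_simps)
  qed
  then have "?g summable_on UNIV \<times> UNIV" by (rule Infinite_Sum.abs_summable_summable)
  then obtain s where s: "(?g has_sum s) (UNIV \<times> UNIV)" using has_sum_infsum by blast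
  then have "((\<lambda>(w, k). ?g (drop (Suc k) w, take k w)) has_sum s) (Sigma UNIV (occurrences j))"
    by (simp only: has_sum_occurrences)
  then have "((\<lambda>w. P w * split_trace x j b w c) has_sum s) UNIV"
  proof (rule has_sum_SigmaD)
    fix w
    have "P w * split_trace x j b w c = (\<Sum>k\<in>occurrences j w. ?g (drop (Suc k) w, take k w))"
      unfolding split_trace_def sum_distrib_left by (intro sum.cong) (auto simp: occurrences_split)
    then show "((\<lambda>k. case (w, k) of (w, k) \<Rightarrow> ?g (drop (Suc k) w, take k w)) has_sum P w * split_trace x j b w c) (occurrences j w)"
      by (intro has_sum_finiteI) auto
  qed
  then have "s = 0" using annihilator_split_trace[OF P] has_sum_unique by blast
  then show ?thesis using s by simp
qed

lemma annihilator_factorization: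
  assumes P: "P \<in> annihilator x K" and A: "A \<in> word_span x" and B: "B \<in> word_span x"
  shows "((\<lambda>(v, u). P (u @ j # v) * (\<tau> (A o\<^sub>L nc_monomial x u) * \<tau> (nc_monomial x v o\<^sub>L B))) has_sum 0) (UNIV \<times> UNIV)"
  using A
proof induction
  case (word b)
  show ?case using B
  proof induction
    case (word c)
    show ?case using annihilator_factorization_words[OF P, of j b c] by (simp add: nc_monomial_append)
  next
    case (add B B')
    then have "B \<in> M" "B' \<in> M" by (auto intro: word_span_mem)
    then show ?case
      using has_sum_add[OF add.IH] by (simp add: blinfun_compose_add_right tau_add case_prod_unfold algebra_simps)
  next
    case (scale B a)
    then have "B \<in> M" by (auto intro: word_span_mem)
    then show ?case
      using has_sum_cmult_right[OF scale.IH, of a] by (simp add: compose_scale_right tau_scale case_prod_unfold algebra_simps)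
  qed
next
  case (add A A')
  then have "A \<in> M" "A' \<in> M" by (auto intro: word_span_mem)
  then show ?case
    using has_sum_add[OF add.IH] by (simp add: blinfun_compose_add_left tau_add case_prod_unfold algebra_simps)
next
  case (scale A a)
  then have "A \<in> M" by (auto intro: word_span_mem)
  then show ?case
    using has_sum_cmult_right[OF scale.IH, of a] by (simp add: blinfun_compose_scale_left tau_scale case_prod_unfold algebra_simps)
qed

text \<open>
  Contracting \<open>(\<partial>\<^sub>j P)(x)\<close> with \<open>a \<otimes> b \<mapsto> a x\<^sub>j b\<close>. This map is not continuous for the Hilbert space
  tensor norm, but a finite-rank projection \<open>p\<close> fixing the finitely many dominant words makes
  \<open>\<tau>(p(a) x\<^sub>j b c)\<close> a combination of product functionals, while the remaining terms are small.
\<close>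

lemma annihilator_contraction:
  assumes P: "P \<in> annihilator x K"
  shows "((\<lambda>(v, u). P (u @ j # v) * \<tau> (nc_monomial x (u @ j # v @ c))) has_sum 0) (UNIV \<times> UNIV)"
    (is "(?g has_sum 0) _")
proof -
  have P': "P \<in> nc_analytic K" using P by (simp add: annihilator_def)
  let ?h = "\<lambda>(v, u). cmod (P (u @ j # v)) * K ^ length (u @ j # v)"
  have hs: "?h summable_on UNIV \<times> UNIV"
    using K_pos by (intro nc_analytic_factorization_summable P') simp
  define H where "H = infsum ?h (UNIV \<times> UNIV)"
  have H: "(?h has_sum H) (UNIV \<times> UNIV)" unfolding H_def by (rule has_sum_infsum[OF hs])
  have "(\<lambda>p. norm (?g p)) summable_on UNIV \<times> UNIV"
  proof (rule factorization_abs_summable[OF P'])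
    fix u v
    show "cmod (\<tau> (nc_monomial x (u @ j # v @ c))) \<le> (K * K ^ length c) * K ^ (length u + length v)"
      using tau_monomial_le[of "u @ j # v @ c"] by (simp add: power_add ac_simps)
  qed
  then have "?g summable_on UNIV \<times> UNIV" by (rule Infinite_Sum.abs_summable_summable)
  then obtain s where s: "(?g has_sum s) (UNIV \<times> UNIV)" using has_sum_infsum by blast
  have small: "cmod s \<le> K ^ length c * e" if e: "e > 0" for e
  proof -
    have "eventually (\<lambda>F. dist (sum ?h F) H < e) (finite_subsets_at_top (UNIV \<times> UNIV))"
      using H e unfolding has_sum_def by (rule tendstoD)
    then obtain F where F: "finite F" "dist (sum ?h F) H < e"
      unfolding eventually_finite_subsets_at_top by blast
    have "\<exists>E. orthonormal E \<and> E \<subseteq> word_span x \<and> (\<forall>A\<in>nc_monomial x ` snd ` F. projection E A = A)"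
      using F(1) by (intro orthonormal_exists) (auto intro: word_span.word)
    then obtain E where E: "orthonormal E" "E \<subseteq> word_span x"
      and fix_F: "\<And>u. u \<in> snd ` F \<Longrightarrow> projection E (nc_monomial x u) = nc_monomial x u"
      by blast
    have EM: "e \<in> M" if "e \<in> E" for e using E(1) that by (auto simp: orthonormal_def)
    have proj0: "((\<lambda>(v, u). P (u @ j # v) * \<tau> (projection E (nc_monomial x u) o\<^sub>L nc_monomial x (j # v @ c))) has_sum 0) (UNIV \<times> UNIV)"
    proof -
      have "((\<lambda>p. \<Sum>e\<in>E. (\<lambda>(v, u). P (u @ j # v) * (\<tau> (adj e o\<^sub>L nc_monomial x u) *
          \<tau> (nc_monomial x v o\<^sub>L (nc_monomial x c o\<^sub>L (e o\<^sub>L nc_monomial x [j]))))) p) has_sum (\<Sum>e\<in>E. 0)) (UNIV \<times> UNIV)"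
        using E(2) by (intro has_sum_finite_sum annihilator_factorization P word_span_adj word_span_compose_left
            word_span_compose_right x_mem x_selfadjoint) auto
      moreover have "(\<Sum>e\<in>E. (\<lambda>(v, u). P (u @ j # v) * (\<tau> (adj e o\<^sub>L nc_monomial x u) *
          \<tau> (nc_monomial x v o\<^sub>L (nc_monomial x c o\<^sub>L (e o\<^sub>L nc_monomial x [j]))))) p) =
        (\<lambda>(v, u). P (u @ j # v) * \<tau> (projection E (nc_monomial x u) o\<^sub>L nc_monomial x (j # v @ c))) p" for p
      proof -
        obtain v u where p: "p = (v, u)" by (cases p)
        \<comment> \<open>traciality separates \<open>x\<^sub>v\<close> from the basis element\<close>
        have cyc: "\<tau> (nc_monomial x v o\<^sub>L (nc_monomial x c o\<^sub>L (e o\<^sub>L nc_monomial x [j]))) = \<tau> (e o\<^sub>L nc_monomial x (j # v @ c))"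
          if "e \<in> E" for e
          using tau_trace[of "nc_monomial x (v @ c)" "e o\<^sub>L nc_monomial x [j]"] EM[OF that]
          by (simp add: nc_monomial_append blinfun_compose_assoc)
        have "projection E (nc_monomial x u) o\<^sub>L nc_monomial x (j # v @ c) =
          (\<Sum>e\<in>E. scale_op (ip e (nc_monomial x u)) (e o\<^sub>L nc_monomial x (j # v @ c)))"
          unfolding projection_def
          by (induction E rule: infinite_finite_induct) (auto simp: blinfun_compose_add_left blinfun_compose_scale_left intro!: blinfun_eqI)
        then have "\<tau> (projection E (nc_monomial x u) o\<^sub>L nc_monomial x (j # v @ c)) =
          (\<Sum>e\<in>E. ip e (nc_monomial x u) * \<tau> (e o\<^sub>L nc_monomial x (j # v @ c)))"
          using EM by (simp add: tau_sum tau_scale del: nc_monomial_Cons)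
        then show ?thesis
          by (simp add: p cyc ip_def sum_distrib_left del: nc_monomial_Cons)
      qed
      ultimately show ?thesis by simp
    qed
    let ?d = "\<lambda>(v, u). P (u @ j # v) * \<tau> ((nc_monomial x u - projection E (nc_monomial x u)) o\<^sub>L nc_monomial x (j # v @ c))"
    have d: "(?d has_sum s) (UNIV \<times> UNIV)"
    proof -
      have "((\<lambda>p. ?g p + (- 1) * (\<lambda>(v, u). P (u @ j # v) * \<tau> (projection E (nc_monomial x u) o\<^sub>L nc_monomial x (j # v @ c))) p) has_sum (s + (- 1) * 0)) (UNIV \<times> UNIV)"
        by (intro has_sum_add has_sum_cmult_right s proj0)
      moreover have "?g p + (- 1) * (\<lambda>(v, u). P (u @ j # v) * \<tau> (projection E (nc_monomial x u) o\<^sub>L nc_monomial x (j # v @ c))) p = ?d p" for p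
      proof -
        obtain v u where p: "p = (v, u)" by (cases p)
        show ?thesis
          using projection_mem[OF E(1)]
          by (simp add: p blinfun_compose_diff_left tau_diff nc_monomial_append[of x u "j # v @ c"] right_diff_distrib del: nc_monomial_Cons)
      qed
      ultimately show ?thesis by simp
    qed
    have "cmod (s - sum ?d F) \<le> K ^ length c * H - (\<Sum>p\<in>F. K ^ length c * ?h p)"
    proof (rule has_sum_partial_le[OF _ _ _ F(1)])
      show "(?d has_sum s) UNIV" using d by simp
      show "((\<lambda>p. K ^ length c * ?h p) has_sum K ^ length c * H) UNIV"
        using has_sum_cmult_right[OF H] by simp
      fix p :: "'n list \<times> 'n list"
      obtain v u where p: "p = (v, u)" by (cases p)
      have "cmod (\<tau> ((nc_monomial x u - projection E (nc_monomial x u)) o\<^sub>L nc_monomial x (j # v @ c)))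
        \<le> norm2 \<tau> (nc_monomial x u - projection E (nc_monomial x u)) * norm2 \<tau> (nc_monomial x (j # v @ c))"
        using projection_mem[OF E(1)] by (intro tau_compose_le) auto
      also have "\<dots> \<le> K ^ length u * K ^ length (j # v @ c)"
        using norm2_diff_projection_le[OF E(1) monomial_x_mem, of u] norm2_monomial_le[of u] K_pos
        by (intro mult_mono norm2_monomial_le norm2_ge0) (auto intro: order_trans simp del: nc_monomial_Cons)
      finally have "cmod (P (u @ j # v)) *
          cmod (\<tau> ((nc_monomial x u - projection E (nc_monomial x u)) o\<^sub>L nc_monomial x (j # v @ c)))
        \<le> cmod (P (u @ j # v)) * (K ^ length u * K ^ length (j # v @ c))"
        by (rule mult_left_mono) simp
      then show "cmod (?d p) \<le> K ^ length c * ?h p"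
        by (simp add: p norm_mult power_add ac_simps del: nc_monomial_Cons)
    qed
    moreover have "sum ?d F = 0"
      using fix_F by (intro sum.neutral) (force simp: case_prod_unfold)
    ultimately have "cmod s \<le> K ^ length c * (H - sum ?h F)"
      by (simp add: sum_distrib_left right_diff_distrib)
    also have "\<dots> \<le> K ^ length c * e"
      using F K_pos by (intro mult_left_mono) (auto simp: dist_real_def)
    finally show ?thesis .
  qed
  have "cmod s \<le> 0"
  proof (rule field_le_epsilon)
    fix e :: real assume "e > 0"
    then show "cmod s \<le> 0 + e"
      using small[of "e / K ^ length c"] K_pos by simp
  qed
  then show ?thesis using s by simp
qed

text \<open>
  Contracting with \<open>x\<^sub>j\<close> and summing over \<open>j\<close> counts the letters of each word, so it yields the Euler
  derivation.
\<close>

lemma annihilator_euler: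
  assumes P: "P \<in> annihilator x K"
  shows "nc_euler P \<in> annihilator x K"
proof -
  have "((\<lambda>w. nc_euler P w * \<tau> (nc_monomial x (w @ c))) has_sum 0) UNIV" for c
  proof -
    have occ: "((\<lambda>w. of_nat (card (occurrences j w)) * (P w * \<tau> (nc_monomial x (w @ c)))) has_sum 0) UNIV" for j
    proof -
      let ?g = "\<lambda>(v, u). P (u @ j # v) * \<tau> (nc_monomial x (u @ j # v @ c))"
      have "((\<lambda>(w, k). ?g (drop (Suc k) w, take k w)) has_sum 0) (Sigma UNIV (occurrences j))"
        using annihilator_contraction[OF P] by (simp only: has_sum_occurrences)
      then show ?thesis
      proof (rule has_sum_SigmaD)
        fix w
        have "take k w @ j # drop (Suc k) w @ c = w @ c" if "k \<in> occurrences j w" for k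
          using occurrences_split[OF that] by (metis append.assoc append_Cons)
        then have "(\<Sum>k\<in>occurrences j w. ?g (drop (Suc k) w, take k w)) = (\<Sum>k\<in>occurrences j w. P w * \<tau> (nc_monomial x (w @ c)))"
          by (intro sum.cong refl) (simp only: occurrences_split prod.case)
        then have "(\<Sum>k\<in>occurrences j w. ?g (drop (Suc k) w, take k w)) = of_nat (card (occurrences j w)) * (P w * \<tau> (nc_monomial x (w @ c)))"
          by (simp only: sum_constant)
        then show "((\<lambda>k. case (w, k) of (w, k) \<Rightarrow> ?g (drop (Suc k) w, take k w)) has_sum
          of_nat (card (occurrences j w)) * (P w * \<tau> (nc_monomial x (w @ c)))) (occurrences j w)"
          by (intro has_sum_finiteI) auto
      qed
    qed
    have "((\<lambda>w. \<Sum>j\<in>UNIV. of_nat (card (occurrences j w)) * (P w * \<tau> (nc_monomial x (w @ c)))) has_sum (\<Sum>j\<in>(UNIV::'n set). 0)) UNIV"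
      by (intro has_sum_finite_sum occ)
    moreover have "(\<Sum>j\<in>UNIV. of_nat (card (occurrences j w)) * (P w * \<tau> (nc_monomial x (w @ c)))) = nc_euler P w * \<tau> (nc_monomial x (w @ c))" for w
    proof -
      have "{..<length w} = (\<Union>j\<in>UNIV. occurrences j w)" by (auto simp: occurrences_def)
      then have "length w = card (\<Union>j\<in>UNIV. occurrences j w)" by (metis card_lessThan)
      also have "\<dots> = (\<Sum>j\<in>UNIV. card (occurrences j w))"
        by (rule card_UN_disjoint) (auto simp: occurrences_def)
      finally have "(\<Sum>j\<in>UNIV. of_nat (card (occurrences j w))) = (of_nat (length w) :: complex)"
        by (metis of_nat_sum)
      then show ?thesis by (simp add: nc_euler_def mult.assoc flip: sum_distrib_right)
    qed
    ultimately show ?thesis by simp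
  qed
  moreover have "nc_euler P \<in> nc_analytic K" using P nc_analytic_euler by (auto simp: annihilator_def)
  ultimately show ?thesis by (simp add: annihilator_def)
qed

text \<open>
  The operators with eigenvalues \<open>|w| choose k\<close> are polynomials in the Euler derivation, by
  \<open>(k + 1) (|w| choose (k + 1)) = (|w| - k) (|w| choose k)\<close>.
\<close>

lemma annihilator_binomial:
  assumes P: "P \<in> annihilator x K"
  shows "(\<lambda>w. of_nat (length w choose k) * P w) \<in> annihilator x K"
proof (induction k)
  case 0 then show ?case using P by simp
next
  case (Suc k)
  let ?Q = "\<lambda>w. of_nat (length w choose k) * P w"
  have "(\<lambda>w. (1 / of_nat (Suc k)) * nc_euler ?Q w + (- (of_nat k / of_nat (Suc k))) * ?Q w) \<in> annihilator x K"
    by (intro annihilator_lincomb annihilator_euler Suc)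
  moreover have "(1 / of_nat (Suc k)) * nc_euler ?Q w + (- (of_nat k / of_nat (Suc k))) * ?Q w = of_nat (length w choose Suc k) * P w" for w
  proof -
    have "Suc k * (length w choose Suc k) + k * (length w choose k) = length w * (length w choose k)"
    proof (cases "length w")
      case (Suc m)
      have "Suc k * (Suc m choose Suc k) = Suc m * (m choose k)" by (rule Suc_times_binomial)
      moreover have "k * (Suc m choose k) + Suc m * (m choose k) = Suc m * (Suc m choose k)"
        by (cases k) (auto simp: Suc_times_binomial simp del: mult_Suc binomial_Suc_Suc, simp add: algebra_simps)
      ultimately show ?thesis by (simp only: Suc add.commute)
    qed (cases k, auto)
    then have "(of_nat (Suc k) :: complex) * of_nat (length w choose Suc k) + of_nat k * of_nat (length w choose k)
      = of_nat (length w) * of_nat (length w choose k)"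
      by (metis of_nat_add of_nat_mult)
    then have "(of_nat (length w choose Suc k) :: complex) =
      (of_nat (length w) * of_nat (length w choose k) - of_nat k * of_nat (length w choose k)) / of_nat (Suc k)"
      by (subst nonzero_eq_divide_eq) (auto simp: algebra_simps simp del: of_nat_Suc)
    note * = this
    show ?thesis
      unfolding * nc_euler_def by (simp add: diff_divide_distrib algebra_simps del: of_nat_Suc)
  qed
  ultimately show ?case by simp
qed

lemma finite_words: "finite {w :: 'n list. length w = m}"
  using finite_lists_length_eq[of "UNIV :: 'n set" m] by simp

text \<open>
  The series \<open>z \<mapsto> \<tau>(P(z x) c)\<close> vanishes to infinite order at \<open>z = 1\<close>, hence identically: the
  relations form a graded space.
\<close>

lemma annihilator_homogeneous:
  assumes P: "P \<in> annihilator x K"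
  shows "(\<lambda>w. if length w = m then P w else 0) \<in> annihilator x K"
proof -
  have P': "P \<in> nc_analytic K" using P by (simp add: annihilator_def)
  then obtain R where R: "R > K" "R > 0" "(\<lambda>w. cmod (P w) * R ^ length w) summable_on UNIV"
    by (rule nc_analyticE)
  have graded: "((\<lambda>m. \<Sum>w | length w = m. f w) has_sum s) UNIV"
    if f: "(f has_sum s) UNIV" for f :: "'n list \<Rightarrow> 'b::{topological_comm_monoid_add,t3_space}" and s
  proof (rule has_sum_SigmaD)
    show "((\<lambda>(m, w). f w) has_sum s) (Sigma UNIV (\<lambda>m. {w. length w = m}))"
      using f by (subst has_sum_reindex_bij_witness[where j = snd and i = "\<lambda>w. (length w, w)" and T = UNIV and h = f]) auto
    show "((\<lambda>w. case (m, w) of (m, w) \<Rightarrow> f w) has_sum (\<Sum>w | length w = m. f w)) {w. length w = m}" for m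
      by (intro has_sum_finiteI finite_words) auto
  qed
  have zero: "(\<Sum>w | length w = l. P w * \<tau> (nc_monomial x (w @ c))) = 0" for c l
  proof (rule coeffs_zero_of_taylor_zero_at_one[of "R / K" "\<lambda>m. \<Sum>w | length w = m. P w * \<tau> (nc_monomial x (w @ c))"])
    show "R / K > 1" using R K_pos by simp
    fix k
    have "((\<lambda>m. \<Sum>w | length w = m. of_nat (length w choose k) * P w * \<tau> (nc_monomial x (w @ c))) has_sum 0) UNIV"
      using annihilator_binomial[OF P, of k] by (intro graded) (simp add: annihilator_def)
    then show "((\<lambda>m. of_nat (m choose k) * (\<Sum>w | length w = m. P w * \<tau> (nc_monomial x (w @ c)))) has_sum 0) UNIV"
      by (simp add: sum_distrib_left mult.assoc)
  next
    have "((\<lambda>m. \<Sum>w | length w = m. cmod (P w) * R ^ length w) has_sum infsum (\<lambda>w. cmod (P w) * R ^ length w) UNIV) UNIV"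
      by (intro graded has_sum_infsum R)
    then have "summable (\<lambda>m. \<Sum>w | length w = m. cmod (P w) * R ^ length w)"
      by (intro sums_summable has_sum_imp_sums)
    then have "summable (\<lambda>m. K ^ length c * (\<Sum>w | length w = m. cmod (P w) * R ^ length w))"
      by (rule summable_mult)
    then show "summable (\<lambda>m. cmod (\<Sum>w | length w = m. P w * \<tau> (nc_monomial x (w @ c))) * (R / K) ^ m)"
    proof (rule summable_comparison_test'[of _ 0])
      fix m :: nat
      have "cmod (\<Sum>w | length w = m. P w * \<tau> (nc_monomial x (w @ c))) \<le> (\<Sum>w | length w = m. cmod (P w) * K ^ (m + length c))"
        using tau_monomial_le[of "_ @ c"] by (intro sum_norm_le) (auto simp: norm_mult intro!: mult_left_mono)
      then have "cmod (\<Sum>w | length w = m. P w * \<tau> (nc_monomial x (w @ c))) * (R / K) ^ m \<le>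
        (\<Sum>w | length w = m. cmod (P w) * K ^ (m + length c)) * (R / K) ^ m"
        using R K_pos by (intro mult_right_mono) auto
      also have "\<dots> = (\<Sum>w | length w = m. cmod (P w)) * (K ^ (m + length c) * (R / K) ^ m)"
        by (simp add: sum_distrib_right mult.assoc)
      also have "K ^ (m + length c) * (R / K) ^ m = K ^ length c * R ^ m"
        using K_pos by (simp add: power_add power_divide)
      also have "(\<Sum>w | length w = m. cmod (P w)) * (K ^ length c * R ^ m) = K ^ length c * (\<Sum>w | length w = m. cmod (P w) * R ^ length w)"
        by (simp add: sum_distrib_left sum_distrib_right ac_simps)
      finally show "norm (cmod (\<Sum>w | length w = m. P w * \<tau> (nc_monomial x (w @ c))) * (R / K) ^ m) \<le>
        K ^ length c * (\<Sum>w | length w = m. cmod (P w) * R ^ length w)"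
        using R K_pos by simp
    qed
  qed
  have "((\<lambda>w. (if length w = m then P w else 0) * \<tau> (nc_monomial x (w @ c))) has_sum 0) UNIV" for c
    using zero[of c m] by (intro has_sum_finite_neutralI[of "{w. length w = m}"] finite_words) auto
  moreover have "(\<lambda>w. if length w = m then P w else 0) \<in> nc_analytic K"
    by (rule nc_analyticI[OF R(1,2)], rule summable_on_comparison_test[OF R(3)]) (use R in auto)
  ultimately show ?thesis by (simp add: annihilator_def)
qed

text \<open>\<open>((\<tau> \<otimes> 1) \<circ> \<partial>\<^sub>j) P\<close>, which lowers the degree\<close>

definition partial_trace :: "'n \<Rightarrow> ('n list \<Rightarrow> complex) \<Rightarrow> ('n list \<Rightarrow> complex)" where
  "partial_trace j P = (\<lambda>v. \<Sum>\<^sub>\<infinity>u. P (u @ j # v) * \<tau> (nc_monomial x u))"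

text \<open>
  This is \<open>annihilator_factorization_words\<close> for the empty word \<open>b\<close>, summed over the prefix \<open>u\<close> first.
\<close>

lemma annihilator_partial_trace:
  assumes P: "P \<in> annihilator x K"
  shows "partial_trace j P \<in> annihilator x K"
proof -
  have P': "P \<in> nc_analytic K" using P by (simp add: annihilator_def)
  then obtain R where R: "R > K" "R > 0" "(\<lambda>w. cmod (P w) * R ^ length w) summable_on UNIV"
    by (rule nc_analyticE)
  define r where "r = (K + R) / 2"
  have r: "K < r" "r < R" "r > 0" using R K_pos by (auto simp: r_def)
  have Pr: "P \<in> nc_analytic r" using r R by (intro nc_analyticI[of r R]) auto
  let ?h = "\<lambda>(v, u). cmod (P (u @ j # v)) * r ^ length (u @ j # v)"
  have hs: "?h summable_on UNIV \<times> UNIV"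
    using r by (intro nc_analytic_factorization_summable Pr) simp
  have hv: "(\<lambda>u. cmod (P (u @ j # v)) * r ^ length (u @ j # v)) summable_on UNIV" for v
    using summable_on_SigmaD1[OF hs] by simp
  have term_le: "norm (P (u @ j # v) * \<tau> (nc_monomial x u)) \<le> 1 / r ^ Suc (length v) * (cmod (P (u @ j # v)) * r ^ length (u @ j # v))" for u v
  proof -
    have "cmod (\<tau> (nc_monomial x u)) \<le> r ^ length u"
      using tau_monomial_le[of u] power_mono[of K r "length u"] r K_pos by simp
    then have "cmod (P (u @ j # v)) * cmod (\<tau> (nc_monomial x u)) \<le> cmod (P (u @ j # v)) * r ^ length u"
      by (rule mult_left_mono) simp
    then show ?thesis using r by (simp add: norm_mult power_add)
  qed
  have abs_v: "(\<lambda>u. norm (P (u @ j # v) * \<tau> (nc_monomial x u))) summable_on UNIV" for v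
    by (rule Infinite_Sum.abs_summable_on_comparison_test'[OF summable_on_cmult_right[OF hv] term_le])
  have pt: "((\<lambda>u. P (u @ j # v) * \<tau> (nc_monomial x u)) has_sum partial_trace j P v) UNIV" for v
    unfolding partial_trace_def using Infinite_Sum.abs_summable_summable[OF abs_v] by (rule has_sum_infsum)
  have "partial_trace j P \<in> nc_analytic K"
  proof (rule nc_analyticI[OF r(1,3)], rule summable_on_comparison_test)
    have "((\<lambda>v. infsum (\<lambda>u. cmod (P (u @ j # v)) * r ^ length (u @ j # v)) UNIV) has_sum infsum ?h (UNIV \<times> UNIV)) UNIV"
      by (rule has_sum_SigmaD[OF has_sum_infsum[OF hs]]) (use has_sum_infsum[OF hv] in simp)
    then show "(\<lambda>v. 1 / r * infsum (\<lambda>u. cmod (P (u @ j # v)) * r ^ length (u @ j # v)) UNIV) summable_on UNIV"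
      by (intro summable_on_cmult_right has_sum_imp_summable)
    fix v
    have "cmod (partial_trace j P v) \<le> 1 / r ^ Suc (length v) * infsum (\<lambda>u. cmod (P (u @ j # v)) * r ^ length (u @ j # v)) UNIV"
      by (rule norm_infsum_le[OF pt has_sum_cmult_right[OF has_sum_infsum[OF hv]] term_le])
    then have "cmod (partial_trace j P v) * r ^ length v \<le> (1 / r ^ Suc (length v) * infsum (\<lambda>u. cmod (P (u @ j # v)) * r ^ length (u @ j # v)) UNIV) * r ^ length v"
      using r by (intro mult_right_mono) auto
    also have "\<dots> = 1 / r * infsum (\<lambda>u. cmod (P (u @ j # v)) * r ^ length (u @ j # v)) UNIV"
      using r by (simp add: field_simps)
    finally show "cmod (partial_trace j P v) * r ^ length v \<le> 1 / r * infsum (\<lambda>u. cmod (P (u @ j # v)) * r ^ length (u @ j # v)) UNIV" .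
  qed (use r in auto)
  moreover have "((\<lambda>v. partial_trace j P v * \<tau> (nc_monomial x (v @ c))) has_sum 0) UNIV" for c
  proof (rule has_sum_SigmaD[OF annihilator_factorization_words[OF P, of j "[]" c]])
    show "((\<lambda>u. case (v, u) of (v, u) \<Rightarrow> P (u @ j # v) * (\<tau> (nc_monomial x ([] @ u)) * \<tau> (nc_monomial x (v @ c)))) has_sum
      partial_trace j P v * \<tau> (nc_monomial x (v @ c))) UNIV" for v
      using has_sum_cmult_left[OF pt[of v], of "\<tau> (nc_monomial x (v @ c))"] by (simp add: ac_simps)
  qed
  ultimately show ?thesis by (simp add: annihilator_def)
qed

text \<open>
  A relation of degree \<open>0\<close> is a multiple of \<open>1\<close>, hence trivial. In the top degree the partial trace
  just removes the first letter, so induction on the degree kills the leading coefficients.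
\<close>

lemma annihilator_top_degree:
  assumes "P \<in> annihilator x K" "\<And>w. length w > m \<Longrightarrow> P w = 0" "length w = m"
  shows "P w = 0"
  using assms
proof (induction m arbitrary: P w)
  case 0
  have "((\<lambda>w. P w * \<tau> (nc_monomial x (w @ []))) has_sum 0) UNIV"
    using "0.prems"(1) by (auto simp only: annihilator_def mem_Collect_eq)
  moreover have "((\<lambda>w. P w * \<tau> (nc_monomial x (w @ []))) has_sum P []) UNIV"
    by (rule has_sum_finite_neutralI[of "{[]}"]) (use "0.prems"(2) in \<open>auto simp: tau_one\<close>)
  ultimately show ?case using "0.prems"(3) has_sum_unique by fastforce
next
  case (Suc m)
  obtain j v where w: "w = j # v" "length v = m" using Suc.prems(3) by (cases w) auto
  have pt: "partial_trace j P v = P (j # v)" if "length v \<ge> m" for v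
  proof -
    have "P (u @ j # v) = 0" if "u \<noteq> []" for u
      using that \<open>length v \<ge> m\<close> by (intro Suc.prems(2)) (cases u; simp)
    then have "partial_trace j P v = (\<Sum>\<^sub>\<infinity>u\<in>{[]}. P (u @ j # v) * \<tau> (nc_monomial x u))"
      unfolding partial_trace_def by (intro infsum_cong_neutral) auto
    then show ?thesis by (simp add: tau_one)
  qed
  have "partial_trace j P v = 0"
    by (rule Suc.IH[OF annihilator_partial_trace[OF Suc.prems(1)] _ w(2)])
      (simp add: pt Suc.prems(2))
  then show ?case using pt[of v] w by simp
qed

theorem annihilator_trivial:
  assumes "P \<in> annihilator x K"
  shows "P w = 0"
  using annihilator_top_degree[OF annihilator_homogeneous[OF assms, of "length w"], of "length w" w] by simp

end


section \<open>Absence of analytic relations\<close>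

context tracial_embedding
begin

lemma emb_monomial:
  fixes y :: "'n::finite \<Rightarrow> ('h \<Rightarrow>\<^sub>L 'h)"
  assumes "\<And>j. y j \<in> M"
  shows "\<iota> (nc_monomial y w) = nc_monomial (\<lambda>j. \<iota> (y j)) w"
proof (induction w)
  case (Cons j w)
  then show ?case using assms M.monomial_mem[of y] by (simp add: emb_mult)
qed (simp add: emb_one)

lemma emb_selfadjoint:
  assumes "A \<in> M" "selfadjoint A"
  shows "selfadjoint (\<iota> A)"
  using N.adj_is_adjoint[OF emb_mem[OF assms(1)]] emb_adj[OF assms(1)] M.adj_selfadjoint[OF assms(2)]
  by (simp add: selfadjoint_def)

lemma norm_monomial_le:
  fixes y :: "'n::finite \<Rightarrow> ('h \<Rightarrow>\<^sub>L 'h)"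
  assumes "\<And>j. norm (y j) \<le> r"
  shows "norm (nc_monomial y w) \<le> r ^ length w"
proof (induction w)
  case Nil
  show ?case by (simp add: norm_blinfun_id_le)
next
  case (Cons j w)
  have "r \<ge> 0" using assms[of j] norm_ge_zero order_trans by blast
  have "norm (nc_monomial y (j # w)) \<le> norm (y j) * norm (nc_monomial y w)"
    by (simp add: norm_blinfun_compose)
  also have "\<dots> \<le> r * r ^ length w"
    using Cons assms \<open>r \<ge> 0\<close> by (intro mult_mono) auto
  finally show ?case by simp
qed

text \<open>The embedding preserves moments, and these determine the \<open>L\<^sup>2\<close> operator norm.\<close>

lemma emb_L2_bounded:
  fixes y :: "'n::finite \<Rightarrow> ('h \<Rightarrow>\<^sub>L 'h)"
  assumes y: "\<And>j. y j \<in> M" "\<And>j. selfadjoint (y j)" and r: "\<And>j. norm (y j) \<le> r" "r > 0"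
  shows "N.L2_bounded (\<iota> (y j)) r"
proof (rule N.L2_bounded_moments)
  fix k
  have "op_prod (replicate (2 * k) (\<iota> (y j))) = \<iota> (nc_monomial y (replicate (2 * k) j))"
    by (simp add: emb_monomial[OF y(1)]) (simp add: nc_monomial_def)
  then have "\<sigma> (op_prod (replicate (2 * k) (\<iota> (y j)))) = \<tau> (nc_monomial y (replicate (2 * k) j))"
    using M.monomial_mem[of y, OF y(1)] by (simp add: emb_trace)
  also have "cmod \<dots> \<le> norm (nc_monomial y (replicate (2 * k) j))"
    by (rule order_trans[OF M.tau_le_norm2 M.norm2_le_norm]; rule M.monomial_mem[OF y(1)])
  also have "\<dots> \<le> r ^ (2 * k)" using norm_monomial_le[of y r "replicate (2 * k) j", OF r(1)] by simp
  finally show "Re (\<sigma> (op_prod (replicate (2 * k) (\<iota> (y j))))) \<le> r ^ (2 * k)"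
    using complex_Re_le_cmod order_trans by blast
qed (use emb_mem emb_selfadjoint y r in auto)

text \<open>
  The partial sums of \<open>P(y)\<close> tend to \<open>0\<close> in operator norm, and the trace is a contraction.
\<close>

lemma nc_eval_zero_annihilator:
  fixes y :: "'n::finite \<Rightarrow> ('h \<Rightarrow>\<^sub>L 'h)"
  assumes y: "\<And>j. y j \<in> M" "\<And>j. norm (y j) \<le> R" and P: "P \<in> nc_analytic R" and zero: "nc_eval P y = 0"
  shows "P \<in> N.annihilator (\<lambda>j. \<iota> (y j)) R"
proof -
  have R: "R \<ge> 0" using y(2)[of undefined] norm_ge_zero order_trans by blast
  have m: "nc_monomial y w \<in> M" for w using y(1) by (rule M.monomial_mem)
  have "(\<lambda>w. norm (scale_op (P w) (nc_monomial y w))) summable_on UNIV"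
  proof (rule Infinite_Sum.abs_summable_on_comparison_test'[OF nc_analytic_summable[OF P R]])
    show "norm (scale_op (P w) (nc_monomial y w)) \<le> cmod (P w) * R ^ length w" for w
      using norm_scale_op_le[of "P w" "nc_monomial y w"] mult_left_mono[OF norm_monomial_le[of y R w, OF y(2)], of "cmod (P w)"]
      by simp
  qed
  then have "(\<lambda>w. scale_op (P w) (nc_monomial y w)) summable_on UNIV"
    by (rule Infinite_Sum.abs_summable_summable)
  then have sum0: "((\<lambda>F. \<Sum>w\<in>F. scale_op (P w) (nc_monomial y w)) \<longlongrightarrow> 0) (finite_subsets_at_top UNIV)"
    using has_sum_infsum zero unfolding nc_eval_def has_sum_def by metis
  have "((\<lambda>w. P w * \<sigma> (nc_monomial (\<lambda>j. \<iota> (y j)) (w @ c))) has_sum 0) UNIV" for c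
    unfolding has_sum_def
  proof (rule Lim_null_comparison)
    let ?Q = "\<lambda>F. \<Sum>w\<in>F. scale_op (P w) (nc_monomial y w)"
    show "\<forall>\<^sub>F F in finite_subsets_at_top UNIV.
      norm (\<Sum>w\<in>F. P w * \<sigma> (nc_monomial (\<lambda>j. \<iota> (y j)) (w @ c))) \<le> norm (?Q F) * norm (nc_monomial y c)"
    proof (intro always_eventually allI)
      fix F
      have "\<sigma> (nc_monomial (\<lambda>j. \<iota> (y j)) w) = \<tau> (nc_monomial y w)" for w
        using emb_trace[OF m] by (simp add: emb_monomial[OF y(1)])
      moreover have "?Q F o\<^sub>L nc_monomial y c = (\<Sum>w\<in>F. scale_op (P w) (nc_monomial y (w @ c)))"
        by (induction F rule: infinite_finite_induct)
          (auto simp: blinfun_compose_add_left blinfun_compose_scale_left nc_monomial_append intro!: blinfun_eqI)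
      ultimately have "(\<Sum>w\<in>F. P w * \<sigma> (nc_monomial (\<lambda>j. \<iota> (y j)) (w @ c))) = \<tau> (?Q F o\<^sub>L nc_monomial y c)"
        using m by (simp add: M.tau_sum M.tau_scale)
      also have "cmod \<dots> \<le> norm (?Q F o\<^sub>L nc_monomial y c)"
        using m by (meson M.compose_mem M.norm2_le_norm M.scale_mem M.sum_mem M.tau_le_norm2 order_trans)
      also have "\<dots> \<le> norm (?Q F) * norm (nc_monomial y c)" by (rule norm_blinfun_compose)
      finally show "norm (\<Sum>w\<in>F. P w * \<sigma> (nc_monomial (\<lambda>j. \<iota> (y j)) (w @ c))) \<le> norm (?Q F) * norm (nc_monomial y c)" .
    qed
    show "((\<lambda>F. norm (?Q F) * norm (nc_monomial y c)) \<longlongrightarrow> 0) (finite_subsets_at_top UNIV)"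
      using tendsto_mult_right[OF tendsto_norm[OF sum0], of "norm (nc_monomial y c)"] by simp
  qed
  then show ?thesis using P by (simp add: N.annihilator_def)
qed

end

text \<open>
  The perturbation \<open>sqrt \<epsilon> S + sqrt t T\<close> has size at most \<open>d = 2 sqrt \<epsilon> + 2 sqrt t\<close>, and
  \<open>d\<^sup>2 \<le> 8 (\<epsilon> + t)\<close>. So information of order \<open>o(1 / (\<epsilon> + t))\<close> means conjugate variables of norm \<open>o(1 / d)\<close>.
\<close>

lemma vanishing_information_of_full_dimension:
  fixes x :: "'n::finite \<Rightarrow> ('h::chilbert_space \<Rightarrow>\<^sub>L 'h)"
  assumes M: "tracial_von_neumann_algebra M \<tau>"
    and x: "\<And>j. x j \<in> M" "\<And>j. selfadjoint (x j)"
    and bd: "\<And>j. tracial_von_neumann_algebra.L2_bounded M \<tau> (x j) r" and rR: "r < R"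
    and S: "free_semicirculars M \<tau> x S"
    and T: "\<And>\<epsilon>. \<epsilon> > 0 \<Longrightarrow> free_semicirculars M \<tau> (perturb x S \<epsilon>) (T \<epsilon>)"
    and dim: "delta_star \<tau> x S T = ereal (real CARD('n))"
  shows "vanishing_information M \<tau> x R"
proof -
  interpret tracial_von_neumann_algebra M \<tau> by (rule M)
  have r: "r \<ge> 0" using bd[of undefined] by (auto simp: L2_bounded_def)
  show ?thesis
  proof unfold_locales
    show "L2_bounded (x j) R" for j using L2_bounded_mono[OF bd] rR by simp
    fix e :: real assume e: "e > 0"
    \<comment> \<open>\<open>d < m\<close> will keep the perturbed tuple within the bound \<open>R\<close>.\<close>
    define m where "m = min e (R - r)"
    have m: "m > 0" using e rR by (simp add: m_def)
    from delta_star_full_small_information[OF M x bd S T dim, of "e\<^sup>2 / 8" "(m / 4)\<^sup>2"] e m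
    obtain \<epsilon> t where \<epsilon>: "0 < \<epsilon>" "\<epsilon> < (m / 4)\<^sup>2" and t: "0 < t" "t < (m / 4)\<^sup>2"
      and Phi: "Phi_star \<tau> (perturb (perturb x S \<epsilon>) (T \<epsilon>) t) < ereal (e\<^sup>2 / 8 / (\<epsilon> + t))"
      by auto
    define z where "z = perturb (perturb x S \<epsilon>) (T \<epsilon>) t"
    obtain \<xi> where cv: "\<And>j. conjugate_variable \<tau> z j (\<xi> j)" and xi: "\<And>j. (L2_norm \<tau> (\<xi> j))\<^sup>2 < e\<^sup>2 / 8 / (\<epsilon> + t)"
      using Phi_star_less_conjugate_variable[OF Phi] unfolding z_def by blast
    define d where "d = sqrt \<epsilon> * 2 + sqrt t * 2"
    have d0: "d \<ge> 0" using \<epsilon> t by (simp add: d_def)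
    have "sqrt \<epsilon> < m / 4" "sqrt t < m / 4"
      using real_sqrt_less_mono[OF \<epsilon>(2)] real_sqrt_less_mono[OF t(2)] m by simp_all
    then have dm: "d < m" by (simp add: d_def)
    have zx: "L2_bounded (z j - x j) d" for j
    proof -
      have "L2_bounded (S j) 2" "L2_bounded (T \<epsilon> j) 2"
        using S T[OF \<epsilon>(1)] by (auto simp: free_semicirculars_def intro: L2_bounded_semicircular)
      then have "L2_bounded (sqrt \<epsilon> *\<^sub>R S j + sqrt t *\<^sub>R T \<epsilon> j) (\<bar>sqrt \<epsilon>\<bar> * 2 + \<bar>sqrt t\<bar> * 2)"
        by (intro L2_bounded_add L2_bounded_scaleR)
      moreover have "z j - x j = sqrt \<epsilon> *\<^sub>R S j + sqrt t *\<^sub>R T \<epsilon> j"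
        by (simp add: z_def perturb_def)
      ultimately show ?thesis using \<epsilon> t by (simp add: d_def)
    qed
    have zR: "L2_bounded (z j) R" for j
    proof -
      have "L2_bounded (x j + (z j - x j)) (r + d)" by (intro L2_bounded_add bd zx)
      then show ?thesis using dm by (auto simp: m_def intro: L2_bounded_mono)
    qed
    have "L2_norm \<tau> (\<xi> j) * d < e" for j
    proof -
      have "d\<^sup>2 \<le> 8 * (\<epsilon> + t)"
      proof -
        have "d\<^sup>2 = 4 * (sqrt \<epsilon>)\<^sup>2 + 4 * (sqrt t)\<^sup>2 + 4 * (2 * sqrt \<epsilon> * sqrt t)"
          using \<epsilon> t by (simp add: d_def power2_sum power_mult_distrib)
        then show ?thesis
          using sum_squares_bound[of "sqrt \<epsilon>" "sqrt t"] \<epsilon> t by simp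
      qed
      have "(L2_norm \<tau> (\<xi> j) * d)\<^sup>2 \<le> (L2_norm \<tau> (\<xi> j))\<^sup>2 * (8 * (\<epsilon> + t))"
        unfolding power_mult_distrib by (intro mult_left_mono \<open>d\<^sup>2 \<le> 8 * (\<epsilon> + t)\<close>) simp
      also have "\<dots> < e\<^sup>2 / 8 / (\<epsilon> + t) * (8 * (\<epsilon> + t))"
        using \<epsilon> t xi[of j] by (intro mult_strict_right_mono) auto
      also have "\<dots> = e\<^sup>2" using \<epsilon> t by simp
      finally show ?thesis using e by - (rule power2_less_imp_less, auto)
    qed
    then show "\<exists>z \<xi> d. d < e \<and> (\<forall>j. L2_bounded (z j) R \<and> L2_bounded (z j - x j) d \<and>
      conjugate_variable \<tau> z j (\<xi> j) \<and> L2_norm \<tau> (\<xi> j) * d < e)"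
      using dm zR zx cv by (intro exI[of _ z] exI[of _ \<xi>] exI[of _ d]) (auto simp: m_def)
  qed (use r rR x in auto)
qed

theorem theorem4:
  fixes M :: "('h::chilbert_space \<Rightarrow>\<^sub>L 'h) set" and \<tau> :: "('h \<Rightarrow>\<^sub>L 'h) \<Rightarrow> complex"
    and N :: "('k::chilbert_space \<Rightarrow>\<^sub>L 'k) set" and \<sigma> :: "('k \<Rightarrow>\<^sub>L 'k) \<Rightarrow> complex"
    and \<iota> :: "('h \<Rightarrow>\<^sub>L 'h) \<Rightarrow> ('k \<Rightarrow>\<^sub>L 'k)"
    and y :: "'n::finite \<Rightarrow> ('h \<Rightarrow>\<^sub>L 'h)"
    and S :: "'n \<Rightarrow> ('k \<Rightarrow>\<^sub>L 'k)" and T :: "real \<Rightarrow> 'n \<Rightarrow> ('k \<Rightarrow>\<^sub>L 'k)"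
    and R :: real and P :: "'n list \<Rightarrow> complex"
  assumes "tracial_von_neumann_algebra M \<tau>"
    and "\<And>j. y j \<in> M" and "\<And>j. selfadjoint (y j)" and "\<And>j. norm (y j) < R"
    and "tracial_embedding M \<tau> N \<sigma> \<iota>"
    and "free_semicirculars N \<sigma> (\<lambda>j. \<iota> (y j)) S"
    and "\<And>\<epsilon>. \<epsilon> > 0 \<Longrightarrow> free_semicirculars N \<sigma> (perturb (\<lambda>j. \<iota> (y j)) S \<epsilon>) (T \<epsilon>)"
    and "delta_star \<sigma> (\<lambda>j. \<iota> (y j)) S T = ereal (real CARD('n))"
    and "P \<in> nc_analytic R"
    and "nc_eval P y = 0"
  shows "P = (\<lambda>w. 0)"
proof -
  interpret tracial_embedding M \<tau> N \<sigma> \<iota> by (rule assms(5))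
  \<comment> \<open>\<open>R / 2\<close> makes the bound positive even if all \<open>y\<^sub>j\<close> vanish.\<close>
  define r where "r = Max (insert (R / 2) (range (\<lambda>j. norm (y j))))"
  have R: "R > 0" using assms(4)[of undefined] norm_ge_zero order_le_less_trans by blast
  have r_le: "norm (y j) \<le> r" for j unfolding r_def by (rule Max_ge) auto
  have "R / 2 \<le> r" by (simp add: r_def)
  have "r < R" using R assms(4) by (auto simp: r_def)
  have "vanishing_information N \<sigma> (\<lambda>j. \<iota> (y j)) R"
  proof (rule vanishing_information_of_full_dimension[OF N.tracial_von_neumann_algebra_axioms _ _ _ \<open>r < R\<close> assms(6-8)])
    show "N.L2_bounded (\<iota> (y j)) r" for j
      using r_le R \<open>R / 2 \<le> r\<close> assms(2,3) by (intro emb_L2_bounded) auto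
  qed (use assms emb_mem emb_selfadjoint in auto)
  then interpret vanishing_information N \<sigma> "\<lambda>j. \<iota> (y j)" R .
  have "P \<in> N.annihilator (\<lambda>j. \<iota> (y j)) R"
    using assms(2,4,9,10) by (intro nc_eval_zero_annihilator) (auto intro: less_imp_le)
  then show ?thesis using annihilator_trivial by blast
qed

end
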